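(* Let $Z$ be a spectrally positive Lévy process with unbounded variation which drifts to $+\infty$, let $Z^{\uparrow}$ be $Z$ conditioned to stay positive (starting from $0$), and let $I(Z) := \int_0^{+\infty}e^{-Z(t)}\,dt$ and $I(Z^{\uparrow}) := \int_0^{+\infty}e^{-Z^{\uparrow}(t)}\,dt$. Let $\kappa_Z$ and $\Phi_{-Z}$ be as defined in the context. Then $I(Z)$ is stochastically greater than $I(Z^{\uparrow})$; as a consequence, $$\forall x>0,\quad \mathbb{P}\left(I(Z)\leq x\right)\leq\mathbb{P}\left(I(Z^{\uparrow})\leq x\right).$$ More precisely, for any $\epsilon>0$ there is a positive constant $C$ (depending on $Z$ and on $\epsilon$) such that for all $x>0$ small enough $$\frac{1-\epsilon}{\kappa_Z\,e}\,\Phi_{-Z}\left(\frac1x\right)\mathbb{P}\left(I(Z)\leq x\right)\leq\mathbb{P}\left(I(Z^{\uparrow})\leq x\right)\leq C\,\Phi_{-Z}\left(\frac1x\right)\mathbb{P}\left(I(Z)\leq(1+\epsilon)x\right).$$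
   Context: A spectrally positive Lévy process is a real-valued càdlàg Lévy process $Z$ with $Z(0)=0$ and no negative jumps; $Z$ drifts to $+\infty$ if $Z(t)\to+\infty$ a.s. Write $Z_x := x+Z$. For $x>0$, $Z^{\uparrow}_x$ denotes the process $Z_x$ conditioned (in the usual sense, on an event of positive probability) on $\{\inf_{[0,+\infty[}Z_x>0\}$. $Z^{\uparrow}=Z^{\uparrow}_0$ is the limit in distribution of $Z^{\uparrow}_x$ as $x\to0+$, a Markov process started from $0$ with the same transition laws on $]0,+\infty[$; it is well defined because $Z$ has unbounded variation. $-Z$ is spectrally negative and drifts to $-\infty$; its Laplace exponent $\Psi_{-Z}$ is defined by $\mathbb{E}[e^{-\lambda Z(t)}]=e^{t\Psi_{-Z}(\lambda)}$, $\lambda\geq0$, and $\kappa_Z>0$ denotes the non-trivial zero of $\Psi_{-Z}$. With $\tau(-Z,1):=\inf\{t\geq0:-Z(t)=1\}$ ($\inf\emptyset=\infty$), $\Phi_{-Z}(\lambda):=-\log\left(\mathbb{E}\left[e^{-\lambda\tau(-Z,1)}\right]\right)$ for $\lambda\ge 0$ (with contribution of the event $\{\tau(-Z,1)=\infty\}$ equal to $0$); $\Phi_{-Z}$ is the inverse of the restriction of $\Psi_{-Z}$ to $[\kappa_Z,+\infty[$. A random variable $A$ is stochastically greater than $B$ if $\mathbb{P}(A\leq x)\leq\mathbb{P}(B\leq x)$ for all $x$. $e$ is Euler's number. *)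

theory Defs
  imports "HOL-Probability.Probability"
begin

text \<open>
  A real-valued process on a probability space \<open>M\<close> is a function \<open>X :: real \<Rightarrow> 'a \<Rightarrow> real\<close>, of which
  only the values \<open>X t \<omega>\<close> with \<open>0 \<le> t\<close> and \<open>\<omega> \<in> space M\<close> are relevant.
\<close>

definition cadlag :: "(real \<Rightarrow> real) \<Rightarrow> bool" where
  "cadlag f \<longleftrightarrow> (\<forall>t\<ge>0. continuous (at_right t) f) \<and> (\<forall>t>0. \<exists>l. (f \<longlongrightarrow> l) (at_left t))"

definition cadlag_process :: "'a measure \<Rightarrow> (real \<Rightarrow> 'a \<Rightarrow> real) \<Rightarrow> bool" where
  "cadlag_process M X \<longleftrightarrow> prob_space M \<and> (\<forall>t\<ge>0. X t \<in> borel_measurable M) \<and>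
     (\<forall>\<omega>\<in>space M. cadlag (\<lambda>t. X t \<omega>))"

definition levy_process :: "'a measure \<Rightarrow> (real \<Rightarrow> 'a \<Rightarrow> real) \<Rightarrow> bool" where
  "levy_process M X \<longleftrightarrow> cadlag_process M X \<and>
     (AE \<omega> in M. X 0 \<omega> = 0) \<and>
     (\<forall>(n::nat) u. 0 \<le> u 0 \<and> mono_on {..n} u \<longrightarrow>
        prob_space.indep_vars M (\<lambda>_. borel) (\<lambda>i \<omega>. X (u (Suc i)) \<omega> - X (u i) \<omega>) {..<n}) \<and>
     (\<forall>s\<ge>0. \<forall>h\<ge>0. distr M borel (\<lambda>\<omega>. X (s + h) \<omega> - X s \<omega>) = distr M borel (X h))"

definition no_negative_jumps :: "(real \<Rightarrow> real) \<Rightarrow> bool" where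
  "no_negative_jumps f \<longleftrightarrow> (\<forall>t>0. \<forall>l. (f \<longlongrightarrow> l) (at_left t) \<longrightarrow> l \<le> f t)"

definition spectrally_positive_levy :: "'a measure \<Rightarrow> (real \<Rightarrow> 'a \<Rightarrow> real) \<Rightarrow> bool" where
  "spectrally_positive_levy M X \<longleftrightarrow> levy_process M X \<and> (AE \<omega> in M. no_negative_jumps (\<lambda>t. X t \<omega>))"

definition bounded_variation_upto :: "real \<Rightarrow> (real \<Rightarrow> real) \<Rightarrow> bool" where
  "bounded_variation_upto T f \<longleftrightarrow>
     (\<exists>B. \<forall>(n::nat) u. mono_on {..n} u \<and> u ` {..n} \<subseteq> {0..T} \<longrightarrow>
        (\<Sum>i<n. \<bar>f (u (Suc i)) - f (u i)\<bar>) \<le> B)"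

definition unbounded_variation :: "'a measure \<Rightarrow> (real \<Rightarrow> 'a \<Rightarrow> real) \<Rightarrow> bool" where
  "unbounded_variation M X \<longleftrightarrow> (AE \<omega> in M. \<forall>T>0. \<not> bounded_variation_upto T (\<lambda>t. X t \<omega>))"

definition drifts_to_infinity :: "'a measure \<Rightarrow> (real \<Rightarrow> 'a \<Rightarrow> real) \<Rightarrow> bool" where
  "drifts_to_infinity M X \<longleftrightarrow> (AE \<omega> in M. filterlim (\<lambda>t. X t \<omega>) at_top at_top)"


text \<open>
  The Skorokhod space \<open>D([0,\<infinity>))\<close>. Paths are extensional functions on \<open>[0,\<infinity>)\<close>. The \<open>\<sigma>\<close>-algebra is the
  one generated by the coordinates; it coincides with the Borel \<open>\<sigma>\<close>-algebra of the Skorokhod topology.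
\<close>

definition skorokhod_space :: "(real \<Rightarrow> real) measure" where
  "skorokhod_space = restrict_space (Pi\<^sub>M {0..} (\<lambda>_. borel)) {w. cadlag w}"

definition time_change :: "(real \<Rightarrow> real) \<Rightarrow> bool" where
  "time_change h \<longleftrightarrow> strict_mono_on {0..} h \<and> bij_betw h {0..} {0..}"

text \<open>Convergence of sequences for the Skorokhod (J1) topology on \<open>D([0,\<infinity>))\<close>.\<close>

definition skorokhod_tendsto :: "(nat \<Rightarrow> real \<Rightarrow> real) \<Rightarrow> (real \<Rightarrow> real) \<Rightarrow> bool" where
  "skorokhod_tendsto w v \<longleftrightarrow>
     (\<exists>h. (\<forall>n. time_change (h n)) \<and>
          uniform_limit {0..} h (\<lambda>t. t) sequentially \<and>
          (\<forall>T\<ge>0. uniform_limit {0..T} (\<lambda>n t. w n (h n t)) v sequentially))"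

text \<open>The topology being metrizable, continuity is the same as sequential continuity.\<close>

definition skorokhod_continuous :: "((real \<Rightarrow> real) \<Rightarrow> real) \<Rightarrow> bool" where
  "skorokhod_continuous F \<longleftrightarrow>
     (\<forall>w v. (\<forall>n. w n \<in> space skorokhod_space) \<and> v \<in> space skorokhod_space \<and>
        skorokhod_tendsto w v \<longrightarrow> (\<lambda>n. F (w n)) \<longlonglongrightarrow> F v)"

definition path_law :: "'a measure \<Rightarrow> (real \<Rightarrow> 'a \<Rightarrow> real) \<Rightarrow> (real \<Rightarrow> real) measure" where
  "path_law M X = distr M skorokhod_space (\<lambda>\<omega>. \<lambda>t\<in>{0..}. X t \<omega>)"

definition skorokhod_weak_limit ::
    "('i \<Rightarrow> (real \<Rightarrow> real) measure) \<Rightarrow> (real \<Rightarrow> real) measure \<Rightarrow> 'i filter \<Rightarrow> bool" where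
  "skorokhod_weak_limit P Q \<F> \<longleftrightarrow>
     (\<forall>F. F \<in> borel_measurable skorokhod_space \<and> skorokhod_continuous F \<and>
          bounded (F ` space skorokhod_space) \<longrightarrow>
          ((\<lambda>i. \<integral>w. F w \<partial>P i) \<longlongrightarrow> (\<integral>w. F w \<partial>Q)) \<F>)"


text \<open>
  For \<open>x > 0\<close>, the process \<open>Z\<close> started from \<open>x\<close> and conditioned to stay positive is \<open>x + Z\<close> under the
  measure \<open>M\<close> conditioned on the event below. The infimum is taken in the extended reals since
  \<^const>\<open>Inf\<close> is unspecified on sets of reals that are not bounded below.
\<close>

definition stays_positive :: "'a measure \<Rightarrow> (real \<Rightarrow> 'a \<Rightarrow> real) \<Rightarrow> real \<Rightarrow> 'a set" where
  "stays_positive M Z x = {\<omega> \<in> space M. (INF t\<in>{0..}. ereal (x + Z t \<omega>)) > 0}"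

definition conditioned_positive_law ::
    "'a measure \<Rightarrow> (real \<Rightarrow> 'a \<Rightarrow> real) \<Rightarrow> real \<Rightarrow> (real \<Rightarrow> real) measure" where
  "conditioned_positive_law M Z x =
     path_law (uniform_measure M (stays_positive M Z x)) (\<lambda>t \<omega>. x + Z t \<omega>)"

text \<open>
  \<open>Y\<close>, on the probability space \<open>N\<close>, is a version of \<open>Z\<close> conditioned to stay positive and started
  from \<open>0\<close>. This determines the law of \<open>Y\<close>.
\<close>

definition conditioned_positive_from_zero ::
    "'a measure \<Rightarrow> (real \<Rightarrow> 'a \<Rightarrow> real) \<Rightarrow> 'b measure \<Rightarrow> (real \<Rightarrow> 'b \<Rightarrow> real) \<Rightarrow> bool" where
  "conditioned_positive_from_zero M Z N Y \<longleftrightarrow> cadlag_process N Y \<and>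
     skorokhod_weak_limit (conditioned_positive_law M Z) (path_law N Y) (at_right 0)"


definition exp_functional :: "(real \<Rightarrow> 'a \<Rightarrow> real) \<Rightarrow> 'a \<Rightarrow> ennreal" where
  "exp_functional X \<omega> = (\<integral>\<^sup>+t\<in>{0..}. ennreal (exp (- X t \<omega>)) \<partial>lborel)"

definition stochastically_greater ::
    "'a measure \<Rightarrow> ('a \<Rightarrow> ennreal) \<Rightarrow> 'b measure \<Rightarrow> ('b \<Rightarrow> ennreal) \<Rightarrow> bool" where
  "stochastically_greater M A N B \<longleftrightarrow>
     (\<forall>x. measure M {\<omega> \<in> space M. A \<omega> \<le> x} \<le> measure N {\<omega> \<in> space N. B \<omega> \<le> x})"


definition laplace_exponent :: "'a measure \<Rightarrow> (real \<Rightarrow> 'a \<Rightarrow> real) \<Rightarrow> real \<Rightarrow> real" where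
  "laplace_exponent M X q = (THE \<psi>. \<forall>t\<ge>0. (\<integral>\<omega>. exp (q * X t \<omega>) \<partial>M) = exp (t * \<psi>))"

definition nontrivial_zero :: "(real \<Rightarrow> real) \<Rightarrow> real" where
  "nontrivial_zero \<psi> = (THE \<kappa>. \<kappa> > 0 \<and> \<psi> \<kappa> = 0)"

definition hitting_time :: "(real \<Rightarrow> 'a \<Rightarrow> real) \<Rightarrow> real \<Rightarrow> 'a \<Rightarrow> ereal" where
  "hitting_time X y \<omega> = Inf {ereal t | t. 0 \<le> t \<and> X t \<omega> = y}"

text \<open>
  The hitting time is in general only almost everywhere equal to a measurable function;
  unlike the Bochner integral, the nonnegative integral is invariant under such a modification
  without any measurability requirement.
\<close>

definition passage_exponent :: "'a measure \<Rightarrow> (real \<Rightarrow> 'a \<Rightarrow> real) \<Rightarrow> real \<Rightarrow> real" where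
  "passage_exponent M X q = - ln (enn2real (\<integral>\<^sup>+\<omega>.
     (if hitting_time X 1 \<omega> = \<infinity> then 0
      else ennreal (exp (- q * real_of_ereal (hitting_time X 1 \<omega>)))) \<partial>M))"

definition kappa_minus :: "'a measure \<Rightarrow> (real \<Rightarrow> 'a \<Rightarrow> real) \<Rightarrow> real" where
  "kappa_minus M Z = nontrivial_zero (laplace_exponent M (\<lambda>t \<omega>. - Z t \<omega>))"

definition Phi_minus :: "'a measure \<Rightarrow> (real \<Rightarrow> 'a \<Rightarrow> real) \<Rightarrow> real \<Rightarrow> real" where
  "Phi_minus M Z = passage_exponent M (\<lambda>t \<omega>. - Z t \<omega>)"

end

theory Submission
  imports Defs
begin

text \<open>
  Write \<open>\<tau>\<^sub>s\<close> for the first passage of \<open>Z\<close> below \<open>- s\<close>. As \<open>Z\<close> has no negative jumps, \<open>Z = - s\<close> at that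
  time, so by the strong Markov property \<open>E[exp (- q \<tau>\<^sub>s); \<tau>\<^sub>s < \<infinity>]\<close> is multiplicative in \<open>s\<close> and equals
  \<open>exp (- s \<Phi>(q))\<close>; in particular \<open>P(\<tau>\<^sub>s < \<infinity>) = exp (- \<kappa> s)\<close> with \<open>\<kappa> = \<Phi>(0)\<close>. Unbounded variation enters
  only to exclude that \<open>Z\<close> is nondecreasing, which is the case where these quantities vanish.

  On \<open>\<tau>\<^sub>s < \<infinity>\<close> the exponential functional splits as \<open>I = A\<^sub>s + exp s * I'\<close>, where \<open>A\<^sub>s\<close> is its part before
  \<open>\<tau>\<^sub>s\<close> and \<open>I'\<close> is an independent copy of \<open>I\<close>. Hence \<open>P(I \<le> y, \<tau>\<^sub>s < \<infinity>) \<le> P(\<tau>\<^sub>s < \<infinity>) P(I \<le> y)\<close>, that is,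
  conditioning on \<open>\<tau>\<^sub>s = \<infinity>\<close> makes \<open>I\<close> stochastically smaller; letting \<open>s\<close> tend to \<open>0\<close> gives the domination.

  For the two-sided bound, decompose \<open>{I \<le> x}\<close> according to the last level \<open>k \<delta>\<close> that is passed:
  \<open>P(I \<le> x)\<close> is at most \<open>P(I \<le> x, \<tau>\<^sub>\<delta> = \<infinity>)\<close> times the sum over \<open>k\<close> of \<open>P(A \<le> x)\<close> at level \<open>k \<delta>\<close>.
  Since \<open>A\<^sub>s\<close> is comparable to \<open>\<tau>\<^sub>s\<close> for small \<open>s\<close>, Markov's inequality bounds the summand by about
  \<open>e * exp (- k \<delta> \<Phi>(1/x))\<close>, and \<open>\<delta>\<close> times the sum tends to \<open>e / \<Phi>(1/x)\<close>. As \<open>P(\<tau>\<^sub>\<delta> = \<infinity>)\<close> is about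
  \<open>\<kappa> \<delta>\<close>, this is the lower bound. The upper bound is the converse decomposition restricted to levels
  of order \<open>1 / \<Phi>(1/x)\<close>.
\<close>

section \<open>Right-continuous paths with left limits\<close>

text \<open>The full integral \<open>I\<close> is not Skorokhod continuous, since convergence on
  compact time intervals says nothing about the tail. Weak convergence is therefore applied to a
  continuous function of the integral up to a finite time, and the tail must be small uniformly in
  the starting point. The conditioning inequality behind the domination provides this as well:
  applied to the integral over \<open>{T..}\<close>, it bounds the tail under every conditioned law
  by the unconditioned one, which vanishes because \<open>I\<close> is almost surely finite.

  The limit is taken at fixed \<open>x\<close>, so both estimates must hold along meshes \<delta>
  tending to 0. A depth of order \<open>1 / phi (1 / x)\<close> is fixed and divided into
  \<open>n\<close> cells; the number of cells then cancels against the probability of never passing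
  \<delta>, which is of order \<open>kap * \<delta>\<close>.

  The theorem takes \<kappa> as a zero of the Laplace exponent, whereas passage probabilities
  produce it as \<open>phi 0\<close>. They are identified by writing
  \<open>E[exp (- kap * Z t)]\<close> as a limit of rescaled passage probabilities of remote levels;
  strict convexity gives uniqueness.\<close>

lemma additive_bounded_above_linear:
  fixes g :: "real \<Rightarrow> real"
  assumes add: "\<And>s t. 0 < s \<Longrightarrow> 0 < t \<Longrightarrow> g (s + t) = g s + g t"
    and bd: "\<And>t. 0 < t \<Longrightarrow> t \<le> 1 \<Longrightarrow> g t \<le> B"
    and "0 < t"
  shows "g t = t * g 1"
proof -
  \<comment> \<open>Removing the linear part makes \<open>u\<close> vanish at the positive integers.
    The bound on (0, 1] then spreads to the half-line, and multiplicativity in integers turns an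
    upper bound into \<open>u \<le> 0\<close>.\<close>
  define u where "u t = g t - t * g 1" for t
  have uadd: "u (s + t) = u s + u t" if "0 < s" "0 < t" for s t
    using add[OF that] by (simp add: u_def algebra_simps)
  have u1: "u 1 = 0" by (simp add: u_def)
  have uint: "u (real (Suc n)) = 0" for n
  proof (induction n)
    case (Suc n)
    then show ?case using uadd[of "real (Suc n)" 1] u1 by (simp add: add.commute)
  qed (simp add: u1)
  have uB: "u t \<le> B + \<bar>g 1\<bar>" if "0 < t" for t
  proof (cases "t \<le> 1")
    case True
    have "- (t * g 1) \<le> \<bar>t * g 1\<bar>" by simp
    also have "\<dots> \<le> \<bar>g 1\<bar>" using True that by (simp add: abs_mult mult_left_le_one_le)
    finally show ?thesis using bd[OF that True] by (simp add: u_def)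
  next
    case False
    define n where "n = nat (\<lceil>t\<rceil> - 2)"
    have c: "\<lceil>t\<rceil> \<ge> 2" using False by linarith
    have n: "real (Suc n) = of_int \<lceil>t\<rceil> - 1" using c by (simp add: n_def)
    have b: "0 < t - real (Suc n)" "t - real (Suc n) \<le> 1" unfolding n by linarith+
    have "u t = u (t - real (Suc n)) + u (real (Suc n))"
      using uadd[of "t - real (Suc n)" "real (Suc n)"] b by simp
    then have e: "u t = u (t - real (Suc n))" by (simp only: uint add_0_right)
    define r where "r = t - real (Suc n)"
    have "- (r * g 1) \<le> \<bar>r * g 1\<bar>" by simp
    also have "\<dots> \<le> \<bar>g 1\<bar>" using b by (simp add: abs_mult mult_left_le_one_le r_def)
    finally have "u r \<le> B + \<bar>g 1\<bar>" using bd[OF b] by (simp add: u_def r_def)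
    then show ?thesis using e by (simp add: r_def)
  qed
  have umul: "u (real (Suc n) * t) = real (Suc n) * u t" if "0 < t" for n t
  proof (induction n)
    case (Suc n)
    have "u (real (Suc n) * t + t) = u (real (Suc n) * t) + u t"
      by (rule uadd) (use that in auto)
    moreover have "real (Suc (Suc n)) * t = real (Suc n) * t + t" by (simp add: algebra_simps)
    ultimately show ?case using Suc by (simp add: algebra_simps)
  qed simp
  have uneg: "u t \<le> 0" if t: "0 < t" for t
  proof (rule ccontr)
    assume "\<not> u t \<le> 0"
    then have p: "u t > 0" by simp
    then obtain n where n: "B + \<bar>g 1\<bar> < real n * u t" using ex_less_of_nat_mult by blast
    have "real n * u t \<le> real (Suc n) * u t" using p by (simp add: algebra_simps)
    also have "\<dots> = u (real (Suc n) * t)" using umul[OF t] by simp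
    also have "\<dots> \<le> B + \<bar>g 1\<bar>" by (rule uB) (use t in auto)
    finally show False using n by simp
  qed
  \<comment> \<open>For an integer above \<open>t\<close>, the values of \<open>u\<close> at
    \<open>t\<close> and at the remainder are both nonpositive and add up to 0.\<close>
  define n where "n = nat \<lceil>t\<rceil>"
  have nt: "real (Suc n) - t > 0" unfolding n_def by linarith
  have "u t + u (real (Suc n) - t) = 0"
    using uadd[OF \<open>0 < t\<close> nt] uint[of n] by simp
  with uneg[OF \<open>0 < t\<close>] uneg[OF nt] have "u t = 0" by linarith
  then show ?thesis by (simp add: u_def)
qed

lemma cadlag_right: "cadlag f \<Longrightarrow> 0 \<le> t \<Longrightarrow> (f \<longlongrightarrow> f t) (at_right t)"
  by (auto simp: cadlag_def continuous_within)

lemma cadlag_left: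
  assumes "cadlag f" "0 < t" obtains l where "(f \<longlongrightarrow> l) (at_left t)"
  using assms by (auto simp: cadlag_def)

lemma cadlag_locally_bounded:
  assumes "cadlag f" "0 \<le> t"
  shows "\<exists>d>0. \<exists>B. \<forall>s\<ge>0. \<bar>s - t\<bar> < d \<longrightarrow> \<bar>f s\<bar> \<le> B"
proof -
  have "eventually (\<lambda>s. dist (f s) (f t) < 1) (at_right t)"
    using cadlag_right[OF assms] by (rule tendstoD) simp
  then obtain b where b: "b > t" "\<And>s. t < s \<Longrightarrow> s < b \<Longrightarrow> \<bar>f s - f t\<bar> < 1"
    by (auto simp: eventually_at_right_field dist_real_def)
  have "\<exists>a<t. \<exists>l. \<forall>s\<ge>0. a < s \<longrightarrow> s < t \<longrightarrow> \<bar>f s - l\<bar> < 1"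
  proof (cases "t = 0")
    case True then show ?thesis by (intro exI[of _ "-1"]) auto
  next
    case False
    with assms have "0 < t" by simp
    then obtain l where "(f \<longlongrightarrow> l) (at_left t)" using cadlag_left[OF assms(1)] by blast
    then have "eventually (\<lambda>s. dist (f s) l < 1) (at_left t)" by (rule tendstoD) simp
    then show ?thesis by (auto simp: eventually_at_left_field dist_real_def)
  qed
  then obtain a l where a: "a < t" "\<And>s. 0 \<le> s \<Longrightarrow> a < s \<Longrightarrow> s < t \<Longrightarrow> \<bar>f s - l\<bar> < 1" by blast
  define d where "d = min (b - t) (t - a)"
  have "d > 0" using a b by (simp add: d_def)
  moreover have "\<bar>f s\<bar> \<le> \<bar>f t\<bar> + \<bar>l\<bar> + 1" if "s \<ge> 0" "\<bar>s - t\<bar> < d" for s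
  proof (cases s t rule: linorder_cases)
    case less then show ?thesis using a(2)[of s] that by (auto simp: d_def)
  next
    case greater then show ?thesis using b(2)[of s] that by (auto simp: d_def)
  qed auto
  ultimately show ?thesis by blast
qed

lemma cadlag_bounded_on_compact:
  assumes "cadlag f"
  shows "\<exists>B. \<forall>t\<in>{0..T}. \<bar>f t\<bar> \<le> B"
proof -
  have "\<forall>t\<in>{0..T}. \<exists>d>0. \<exists>B. \<forall>s\<ge>0. \<bar>s - t\<bar> < d \<longrightarrow> \<bar>f s\<bar> \<le> B"
    using cadlag_locally_bounded[OF assms] by auto
  then obtain d B where d: "\<And>t. t \<in> {0..T} \<Longrightarrow> d t > 0"
    and B: "\<And>t s. t \<in> {0..T} \<Longrightarrow> s \<ge> 0 \<Longrightarrow> \<bar>s - t\<bar> < d t \<Longrightarrow> \<bar>f s\<bar> \<le> B t"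
    by metis
  have "compact {0..T}" by simp
  then obtain C where C: "C \<subseteq> {0..T}" "finite C" "{0..T} \<subseteq> (\<Union>t\<in>C. ball t (d t))"
    by (rule compactE_image[of _ "{0..T}" "\<lambda>t. ball t (d t)"]) (auto simp: d)
  have "\<bar>f s\<bar> \<le> (\<Sum>t\<in>C. \<bar>B t\<bar>)" if s: "s \<in> {0..T}" for s
  proof -
    obtain t where t: "t \<in> C" "s \<in> ball t (d t)" using C s by blast
    then have "\<bar>f s\<bar> \<le> B t" using B[of t s] C s by (auto simp: dist_real_def abs_minus_commute)
    also have "\<dots> \<le> \<bar>B t\<bar>" by simp
    also have "\<dots> \<le> (\<Sum>t\<in>C. \<bar>B t\<bar>)" using t C by (intro member_le_sum) auto
    finally show ?thesis .
  qed
  then show ?thesis by blast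
qed

text \<open>A jump time \<open>t\<close> is coded by rationals with \<open>f < q\<close> on the
  interval from \<open>p\<close> to \<open>t\<close> and \<open>q < f t\<close>. Of two jump times
  with the same code, the earlier would lie in the interval of the later, where
  \<open>f < q\<close>, a contradiction. Countability is what makes Skorokhod convergence a
  pointwise convergence at almost every time.\<close>

lemma countable_up_jumps:
  fixes f :: "real \<Rightarrow> real"
  shows "countable {t. \<exists>l. (f \<longlongrightarrow> l) (at_left t) \<and> l < f t}"
proof -
  let ?J = "{t. \<exists>l. (f \<longlongrightarrow> l) (at_left t) \<and> l < f t}"
  have "\<forall>t\<in>?J. \<exists>p q. p \<in> \<rat> \<and> q \<in> \<rat> \<and> p < t \<and> q < f t \<and> (\<forall>s. p < s \<longrightarrow> s < t \<longrightarrow> f s < q)"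
  proof
    fix t assume "t \<in> ?J"
    then obtain l where l: "(f \<longlongrightarrow> l) (at_left t)" "l < f t" by auto
    obtain q where q: "q \<in> \<rat>" "l < q" "q < f t" using Rats_dense_in_real[OF l(2)] by auto
    have "eventually (\<lambda>s. f s < q) (at_left t)" using l(1) q(2) by (rule order_tendstoD)
    then obtain b where b: "b < t" "\<And>s. b < s \<Longrightarrow> s < t \<Longrightarrow> f s < q"
      by (auto simp: eventually_at_left_field)
    obtain p where "p \<in> \<rat>" "b < p" "p < t" using Rats_dense_in_real[OF b(1)] by auto
    with q b show "\<exists>p q. p \<in> \<rat> \<and> q \<in> \<rat> \<and> p < t \<and> q < f t \<and> (\<forall>s. p < s \<longrightarrow> s < t \<longrightarrow> f s < q)"
      by (intro exI[of _ p] exI[of _ q]) auto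
  qed
  from this[THEN bchoice] obtain p where
    "\<forall>t\<in>?J. \<exists>q. p t \<in> \<rat> \<and> q \<in> \<rat> \<and> p t < t \<and> q < f t \<and> (\<forall>s. p t < s \<longrightarrow> s < t \<longrightarrow> f s < q)" ..
  from this[THEN bchoice] obtain q where pq: "\<And>t. t \<in> ?J \<Longrightarrow> p t \<in> \<rat> \<and> q t \<in> \<rat> \<and> p t < t \<and> q t < f t \<and>
      (\<forall>s. p t < s \<longrightarrow> s < t \<longrightarrow> f s < q t)"
    by blast
  have inj: "inj_on (\<lambda>t. (p t, q t)) ?J"
  proof (rule inj_onI)
    have ne: False if "t \<in> ?J" "t' \<in> ?J" "(p t, q t) = (p t', q t')" "t < t'" for t t'
    proof -
      have "p t' < t" "q t' < f t" using pq[OF that(1)] that(3) by auto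
      then show False using pq[OF that(2)] that(4) by force
    qed
    show "t = t'" if "t \<in> ?J" "t' \<in> ?J" "(p t, q t) = (p t', q t')" for t t'
      using ne[OF that] ne[OF that(2,1) that(3)[symmetric]] by (meson linorder_neqE)
  qed
  have "countable ((\<lambda>t. (p t, q t)) ` ?J)"
    by (rule countable_subset[of _ "\<rat> \<times> \<rat>"]) (use pq in \<open>auto intro: countable_rat\<close>)
  then show ?thesis using inj by (rule countable_image_inj_on)
qed

lemma countable_jumps:
  fixes f :: "real \<Rightarrow> real"
  shows "countable {t. \<exists>l. (f \<longlongrightarrow> l) (at_left t) \<and> l \<noteq> f t}"
proof -
  have "{t. \<exists>l. (f \<longlongrightarrow> l) (at_left t) \<and> l \<noteq> f t} \<subseteq>
    {t. \<exists>l. (f \<longlongrightarrow> l) (at_left t) \<and> l < f t} \<union> {t. \<exists>l. ((\<lambda>s. - f s) \<longlongrightarrow> l) (at_left t) \<and> l < - f t}"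
  proof (clarify)
    fix t l assume l: "(f \<longlongrightarrow> l) (at_left t)" "l \<noteq> f t" "\<not> (\<exists>l. ((\<lambda>s. - f s) \<longlongrightarrow> l) (at_left t) \<and> l < - f t)"
    then have "((\<lambda>s. - f s) \<longlongrightarrow> - l) (at_left t)" by (intro tendsto_minus)
    with l have "\<not> - l < - f t" by blast
    with l show "\<exists>l. (f \<longlongrightarrow> l) (at_left t) \<and> l < f t" by auto
  qed
  then show ?thesis using countable_up_jumps[of f] countable_up_jumps[of "\<lambda>s. - f s"]
    by (meson countable_Un countable_subset)
qed

lemma cadlag_cong:
  assumes "\<And>t. 0 \<le> t \<Longrightarrow> f t = g t" shows "cadlag f \<longleftrightarrow> cadlag g"
proof -
  have R: "continuous (at_right t) f \<longleftrightarrow> continuous (at_right t) g" if "0 \<le> t" for t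
    unfolding continuous_within
    by (rule tendsto_cong[THEN trans])
      (use assms that in \<open>auto simp: eventually_at_right_field intro!: exI[of _ "t + 1"]\<close>)
  have L: "(f \<longlongrightarrow> l) (at_left t) \<longleftrightarrow> (g \<longlongrightarrow> l) (at_left t)" if "0 < t" for t l
    by (rule tendsto_cong) (use assms that in \<open>auto simp: eventually_at_left_field intro!: exI[of _ 0]\<close>)
  show ?thesis unfolding cadlag_def using R L by blast
qed

lemma no_negative_jumps_cong:
  assumes "\<And>t. 0 \<le> t \<Longrightarrow> f t = g t" shows "no_negative_jumps f \<longleftrightarrow> no_negative_jumps g"
proof -
  have L: "(f \<longlongrightarrow> l) (at_left t) \<longleftrightarrow> (g \<longlongrightarrow> l) (at_left t)" if "0 < t" for t l
    by (rule tendsto_cong) (use assms that in \<open>auto simp: eventually_at_left_field intro!: exI[of _ 0]\<close>)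
  show ?thesis unfolding no_negative_jumps_def using L assms by auto
qed

lemma no_neg_jumpsD: "no_negative_jumps f \<Longrightarrow> 0 < t \<Longrightarrow> (f \<longlongrightarrow> l) (at_left t) \<Longrightarrow> l \<le> f t"
  by (auto simp: no_negative_jumps_def)

section \<open>First passage below a level\<close>

text \<open>
  The inequality is strict so that passage before time \<open>a\<close> is a countable condition on a
  right-continuous path. The value of \<open>tau\<close> is unspecified when the level is never passed.
\<close>

definition dies :: "real \<Rightarrow> (real \<Rightarrow> real) \<Rightarrow> bool" where
  "dies s w \<longleftrightarrow> (\<exists>t\<ge>0. w t < - s)"

definition tau :: "real \<Rightarrow> (real \<Rightarrow> real) \<Rightarrow> real" where
  "tau s w = Inf {t. 0 \<le> t \<and> w t < - s}"

definition efun :: "real set \<Rightarrow> (real \<Rightarrow> real) \<Rightarrow> ennreal" where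
  "efun S w = (\<integral>\<^sup>+t\<in>S. ennreal (exp (- w t)) \<partial>lborel)"

text \<open>Restricted to \<open>{0..}\<close>, as is \<open>shift\<close>, because the points of
  \<open>skorokhod_space\<close> are extensional functions.\<close>

definition stop :: "real \<Rightarrow> (real \<Rightarrow> real) \<Rightarrow> real \<Rightarrow> real" where
  "stop K w = (\<lambda>t\<in>{0..}. w (min t K))"

definition shift :: "real \<Rightarrow> (real \<Rightarrow> real) \<Rightarrow> real \<Rightarrow> real" where
  "shift K w = (\<lambda>t\<in>{0..}. w (K + t) - w K)"

section \<open>Measurability of path functionals\<close>

lemma space_skorokhod: "space skorokhod_space = {w \<in> extensional {0..}. cadlag w}"
  by (auto simp: skorokhod_space_def space_restrict_space space_PiM PiE_def)

lemma cadlag_restrict: "cadlag (restrict f {0..}) \<longleftrightarrow> cadlag f"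
  by (rule cadlag_cong) auto

lemma restrict_in_space_skorokhod: "cadlag f \<Longrightarrow> restrict f {0..} \<in> space skorokhod_space"
  by (simp add: space_skorokhod cadlag_restrict)

lemma measurable_skorokhod_eval:
  "0 \<le> t \<Longrightarrow> (\<lambda>w. w t) \<in> borel_measurable skorokhod_space"
  unfolding skorokhod_space_def by (intro measurable_restrict_space1 measurable_component_singleton) auto

lemma measurable_skorokhodI:
  assumes "\<And>t. 0 \<le> t \<Longrightarrow> (\<lambda>x. f x t) \<in> borel_measurable M"
    and "\<And>x. x \<in> space M \<Longrightarrow> f x \<in> space skorokhod_space"
  shows "f \<in> measurable M skorokhod_space"
  unfolding skorokhod_space_def
proof (rule measurable_restrict_space2)
  show "f \<in> space M \<rightarrow> {w. cadlag w}" using assms(2) by (auto simp: space_skorokhod)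
  show "f \<in> measurable M (Pi\<^sub>M {0..} (\<lambda>_. borel))"
    by (rule measurable_PiM_single') (use assms in \<open>auto simp: space_skorokhod PiE_def\<close>)
qed

text \<open>Right-continuity carries a strict inequality to a slightly later rational time.
  Existential statements about real times thereby become countable ones.\<close>

lemma cadlag_approx_less:
  assumes "cadlag w" "0 \<le> t" "w t < c" "t < b"
  shows "\<exists>r\<in>\<rat>. t < r \<and> r < b \<and> w r < c"
proof -
  have "eventually (\<lambda>u. w u < c) (at_right t)"
    using cadlag_right[OF assms(1,2)] assms(3) by (rule order_tendstoD)
  then obtain d where d: "d > t" "\<And>u. t < u \<Longrightarrow> u < d \<Longrightarrow> w u < c"
    by (auto simp: eventually_at_right_field)
  obtain r where "r \<in> \<rat>" "t < r" "r < min b d"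
    using Rats_dense_in_real[of t "min b d"] d assms by auto
  with d show ?thesis by auto
qed

lemma cadlag_uminus: "cadlag w \<Longrightarrow> cadlag (\<lambda>t. - w t)"
  unfolding cadlag_def by (metis continuous_minus tendsto_minus)

lemma cadlag_approx_greater:
  assumes "cadlag w" "0 \<le> t" "w t > c" "t < b"
  shows "\<exists>r\<in>\<rat>. t < r \<and> r < b \<and> w r > c"
  using cadlag_approx_less[OF cadlag_uminus[OF assms(1)] assms(2), of "- c" b] assms by auto

lemma sets_countable_ex_rat:
  assumes "\<And>r. r \<in> \<rat> \<Longrightarrow> Measurable.pred M (P r)"
  shows "Measurable.pred M (\<lambda>x. \<exists>r\<in>\<rat>. P r x)"
proof -
  have "{x \<in> space M. \<exists>r\<in>\<rat>. P r x} = (\<Union>r\<in>\<rat>. {x \<in> space M. P r x})" by auto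
  also have "\<dots> \<in> sets M"
    by (rule sets.countable_UN'') (use assms in \<open>auto simp: pred_def intro: countable_rat\<close>)
  finally show ?thesis by (simp add: pred_def)
qed

lemma before_iff_rat:
  assumes "cadlag w"
  shows "(\<exists>t\<ge>0. t < a \<and> w t < c) \<longleftrightarrow> (\<exists>r\<in>\<rat>. 0 \<le> r \<and> r < a \<and> w r < c)"
  by (meson assms cadlag_approx_less dual_order.strict_trans less_eq_real_def order_le_less_trans)

lemma measurable_before_less [measurable]:
  "Measurable.pred skorokhod_space (\<lambda>w. \<exists>t\<ge>0. t < a \<and> w t < c)"
proof -
  have "Measurable.pred skorokhod_space (\<lambda>w. \<exists>r\<in>\<rat>. 0 \<le> r \<and> r < a \<and> w r < c)"
  proof (rule sets_countable_ex_rat)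
    note measurable_skorokhod_eval[measurable]
    show "Measurable.pred skorokhod_space (\<lambda>w. 0 \<le> r \<and> r < a \<and> w r < c)" for r :: real
      by (cases "0 \<le> r") auto
  qed
  then show ?thesis
    by (rule measurable_cong[THEN iffD1, rotated]) (simp add: space_skorokhod before_iff_rat)
qed

lemma measurable_before_greater [measurable]:
  "Measurable.pred skorokhod_space (\<lambda>w. \<exists>t\<ge>0. t < a \<and> w t > c)"
proof -
  have "Measurable.pred skorokhod_space (\<lambda>w. \<exists>r\<in>\<rat>. 0 \<le> r \<and> r < a \<and> w r > c)"
  proof (rule sets_countable_ex_rat)
    note measurable_skorokhod_eval[measurable]
    show "Measurable.pred skorokhod_space (\<lambda>w. 0 \<le> r \<and> r < a \<and> w r > c)" for r :: real
      by (cases "0 \<le> r") auto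
  qed
  moreover have "(\<exists>t\<ge>0. t < a \<and> w t > c) \<longleftrightarrow> (\<exists>r\<in>\<rat>. 0 \<le> r \<and> r < a \<and> w r > c)"
    if "w \<in> space skorokhod_space" for w
    using before_iff_rat[OF cadlag_uminus, of w a "- c"] that by (simp add: space_skorokhod)
  ultimately show ?thesis
    by (subst measurable_cong) auto
qed

lemma dies_iff_before: "dies s w \<longleftrightarrow> (\<exists>n::nat. \<exists>t\<ge>0. t < real n \<and> w t < - s)"
  unfolding dies_def using reals_Archimedean2 by blast

lemma measurable_dies [measurable]: "Measurable.pred skorokhod_space (dies s)"
  unfolding dies_iff_before[abs_def] by measurable

lemma tau_less_iff:
  assumes "dies s w" shows "tau s w < a \<longleftrightarrow> (\<exists>t\<ge>0. t < a \<and> w t < - s)"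
proof -
  have "bdd_below {t. 0 \<le> t \<and> w t < - s}" by (rule bdd_belowI[of _ 0]) auto
  moreover have "{t. 0 \<le> t \<and> w t < - s} \<noteq> {}" using assms by (auto simp: dies_def)
  ultimately show ?thesis unfolding tau_def by (subst cInf_less_iff) auto
qed

lemma measurable_tau [measurable]: "tau s \<in> borel_measurable skorokhod_space"
proof (rule borel_measurableI_less)
  fix a :: real
  \<comment> \<open>On paths that never pass the level, \<open>tau\<close> is the fixed number
    \<open>Inf {}\<close>, which has to be treated as a separate constant case.\<close>
  have "Measurable.pred skorokhod_space
    (\<lambda>w. (dies s w \<and> (\<exists>t\<ge>0. t < a \<and> w t < - s)) \<or> (\<not> dies s w \<and> Inf ({} :: real set) < a))"
    by measurable
  moreover have "tau s w < a \<longleftrightarrow>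
      (dies s w \<and> (\<exists>t\<ge>0. t < a \<and> w t < - s)) \<or> (\<not> dies s w \<and> Inf ({} :: real set) < a)" for w
  proof (cases "dies s w")
    case True then show ?thesis by (simp add: tau_less_iff)
  next
    case False
    then have e: "{t. 0 \<le> t \<and> w t < - s} = {}" by (auto simp: dies_def)
    show ?thesis unfolding tau_def e using False by simp
  qed
  ultimately show "{w \<in> space skorokhod_space. tau s w < a} \<in> sets skorokhod_space"
    by (simp add: pred_def)
qed

text \<open>For nonnegative \<open>t\<close>, the first point strictly after \<open>t\<close> of the
  grid of mesh \<open>1 / (n + 1)\<close>. Being strictly later lets right-continuity apply and lets
  the path up to the grid point reveal that a passage at \<open>t\<close> has occurred.\<close>

definition grid_up :: "nat \<Rightarrow> real \<Rightarrow> real" where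
  "grid_up n t = (real (nat \<lfloor>t * real (Suc n)\<rfloor>) + 1) / real (Suc n)"

lemma grid_up_nonneg: "0 \<le> grid_up n t"
  by (simp add: grid_up_def)

lemma grid_up_measurable [measurable]: "grid_up n \<in> borel_measurable borel"
  unfolding grid_up_def[abs_def] by measurable

lemma grid_up_at_right:
  assumes "0 \<le> t"
  shows "filterlim (\<lambda>n. grid_up n t) (at_right t) sequentially"
proof -
  have gb: "t < grid_up n t \<and> grid_up n t \<le> t + 1 / real (Suc n)" for n
  proof -
    have "real (nat \<lfloor>t * real (Suc n)\<rfloor>) = of_int \<lfloor>t * real (Suc n)\<rfloor>"
      using assms by simp
    then have "t * real (Suc n) < real (nat \<lfloor>t * real (Suc n)\<rfloor>) + 1"
      "real (nat \<lfloor>t * real (Suc n)\<rfloor>) \<le> t * real (Suc n)" by linarith+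
    then have "t < (real (nat \<lfloor>t * real (Suc n)\<rfloor>) + 1) / real (Suc n)"
      "real (nat \<lfloor>t * real (Suc n)\<rfloor>) / real (Suc n) \<le> t"
      by (simp_all add: less_divide_eq divide_le_eq del: of_nat_Suc)
    then show ?thesis by (simp add: grid_up_def add_divide_distrib del: of_nat_Suc)
  qed
  have "(\<lambda>n. grid_up n t) \<longlonglongrightarrow> t"
  proof (rule tendsto_sandwich[of "\<lambda>_. t" _ _ "\<lambda>n. t + 1 / real (Suc n)"])
    show "(\<lambda>n. t + 1 / real (Suc n)) \<longlonglongrightarrow> t"
      using tendsto_add[OF tendsto_const[of t] LIMSEQ_inverse_real_of_nat] by (simp add: inverse_eq_divide)
  qed (use gb in \<open>auto simp: less_imp_le\<close>)
  then show ?thesis using gb by (auto simp: filterlim_at less_imp_neq[THEN not_sym])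
qed

text \<open>Evaluation at a grid time is a countable case distinction, and right-continuity passes
  to the limit. Clipping at 0 keeps the evaluation among the coordinates of the path space.\<close>

lemma measurable_path_eval:
  "(\<lambda>p. fst p (max 0 (snd p))) \<in> borel_measurable (skorokhod_space \<Otimes>\<^sub>M lborel)"
proof (rule borel_measurable_LIMSEQ_real)
  define a where "a n k = (real k + 1) / real (Suc n)" for n k :: nat
  show "(\<lambda>p. fst p (grid_up n (max 0 (snd p)))) \<in> borel_measurable (skorokhod_space \<Otimes>\<^sub>M lborel)" for n
    unfolding grid_up_def a_def[symmetric]
  proof (rule measurable_compose_countable[where f = "\<lambda>k p. fst p (a n k)"])
    show "(\<lambda>p. fst p (a n k)) \<in> borel_measurable (skorokhod_space \<Otimes>\<^sub>M lborel)" for k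
      by (rule measurable_compose[OF measurable_fst measurable_skorokhod_eval]) (simp add: a_def)
    have "(\<lambda>t. nat \<lfloor>max 0 t * real (Suc n)\<rfloor>) \<in> measurable lborel (count_space UNIV)" by measurable
    then show "(\<lambda>p. nat \<lfloor>max 0 (snd p) * real (Suc n)\<rfloor>) \<in> measurable (skorokhod_space \<Otimes>\<^sub>M lborel) (count_space UNIV)"
      by (rule measurable_compose[OF measurable_snd])
  qed
  show "(\<lambda>n. fst p (grid_up n (max 0 (snd p)))) \<longlonglongrightarrow> fst p (max 0 (snd p))"
    if "p \<in> space (skorokhod_space \<Otimes>\<^sub>M lborel)" for p
    using that by (intro filterlim_compose[OF cadlag_right grid_up_at_right])
      (auto simp: space_pair_measure space_skorokhod)
qed

lemma efun_eq_max:
  "S \<subseteq> {0..} \<Longrightarrow> efun S w = (\<integral>\<^sup>+t\<in>S. ennreal (exp (- w (max 0 t))) \<partial>lborel)"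
  unfolding efun_def by (intro nn_integral_cong) (auto split: split_indicator simp: max_def)

lemma measurable_efun:
  assumes "Measurable.pred (skorokhod_space \<Otimes>\<^sub>M lborel) (\<lambda>p. snd p \<in> S (fst p))"
    and "\<And>w. S w \<subseteq> {0..}"
  shows "(\<lambda>w. efun (S w) w) \<in> borel_measurable skorokhod_space"
proof -
  have "(\<lambda>p. ennreal (exp (- fst p (max 0 (snd p)))) * indicator {q. snd q \<in> S (fst q)} p)
      \<in> borel_measurable (skorokhod_space \<Otimes>\<^sub>M lborel)"
    using measurable_path_eval assms(1) by measurable
  from lborel.borel_measurable_nn_integral_fst[OF this]
  have "(\<lambda>w. \<integral>\<^sup>+ t. ennreal (exp (- w (max 0 t))) * indicator {q. snd q \<in> S (fst q)} (w, t) \<partial>lborel)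
      \<in> borel_measurable skorokhod_space" by simp
  moreover have "(\<integral>\<^sup>+ t. ennreal (exp (- w (max 0 t))) * indicator {q. snd q \<in> S (fst q)} (w, t) \<partial>lborel)
      = efun (S w) w" for w
    unfolding efun_eq_max[OF assms(2)] by (intro nn_integral_cong) (auto split: split_indicator)
  ultimately show ?thesis by simp
qed

lemma measurable_efun_atLeast [measurable]:
  "0 \<le> T \<Longrightarrow> efun {T..} \<in> borel_measurable skorokhod_space"
  by (rule measurable_efun[of "\<lambda>_. {T..}"]) auto

lemma measurable_efun_upto [measurable]:
  "efun {0..<T} \<in> borel_measurable skorokhod_space"
  by (rule measurable_efun[of "\<lambda>_. {0..<T}"]) auto

lemma measurable_efun_tau [measurable]:
  "(\<lambda>w. efun {0..<tau s w} w) \<in> borel_measurable skorokhod_space"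
  by (rule measurable_efun[of "\<lambda>w. {0..<tau s w}"]) auto

lemma efun_cong: "(\<And>t. t \<in> S \<Longrightarrow> v t = w t) \<Longrightarrow> efun S v = efun S w"
  unfolding efun_def by (intro nn_integral_cong) (auto split: split_indicator)

lemma efun_mono_set: "S \<subseteq> T \<Longrightarrow> efun S w \<le> efun T w"
  unfolding efun_def by (intro nn_integral_mono) (auto split: split_indicator)

section \<open>Stopped and shifted paths\<close>

lemma cadlag_stop:
  assumes w: "cadlag w" and K: "0 \<le> K" shows "stop K w \<in> space skorokhod_space"
proof -
  have "cadlag (\<lambda>t. w (min t K))"
    unfolding cadlag_def continuous_within
  proof (intro conjI allI impI)
    fix t :: real assume t: "0 \<le> t"
    show "((\<lambda>t. w (min t K)) \<longlongrightarrow> w (min t K)) (at_right t)"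
    proof (cases "t < K")
      case True
      have "eventually (\<lambda>u. w (min u K) = w u) (at_right t)"
        using True by (auto simp: eventually_at_right_field intro!: exI[of _ K])
      from tendsto_cong[OF this] show ?thesis using cadlag_right[OF w t] True by simp
    next
      case False
      have "eventually (\<lambda>u. w (min u K) = w K) (at_right t)"
        using False by (auto simp: eventually_at_right_field min_def intro!: exI[of _ "t + 1"])
      from tendsto_cong[OF this] show ?thesis using False by (simp add: min_def)
    qed
  next
    fix t :: real assume t: "0 < t"
    show "\<exists>l. ((\<lambda>t. w (min t K)) \<longlongrightarrow> l) (at_left t)"
    proof (cases "t \<le> K")
      case True
      obtain l where l: "(w \<longlongrightarrow> l) (at_left t)" using cadlag_left[OF w t] by blast
      have "eventually (\<lambda>u. w (min u K) = w u) (at_left t)"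
        using True by (auto simp: eventually_at_left_field min_def intro!: exI[of _ "t - 1"])
      from tendsto_cong[OF this] show ?thesis using l by blast
    next
      case False
      have "eventually (\<lambda>u. w (min u K) = w K) (at_left t)"
        using False by (auto simp: eventually_at_left_field min_def intro!: exI[of _ K])
      from tendsto_cong[OF this] show ?thesis by (metis tendsto_const)
    qed
  qed
  then show ?thesis unfolding stop_def by (rule restrict_in_space_skorokhod)
qed

lemma filterlim_plus_at_right: "filterlim (\<lambda>u. K + u) (at_right (K + t)) (at_right (t::real))"
  unfolding filterlim_at
  by (auto simp: eventually_at_right_field intro!: tendsto_intros exI[of _ "t + 1"])

lemma filterlim_plus_at_left: "filterlim (\<lambda>u. K + u) (at_left (K + t)) (at_left (t::real))"
  unfolding filterlim_at
  by (auto simp: eventually_at_left_field intro!: tendsto_intros exI[of _ "t - 1"])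

lemma cadlag_shift:
  assumes w: "cadlag w" and K: "0 \<le> K" shows "shift K w \<in> space skorokhod_space"
proof -
  have "cadlag (\<lambda>t. w (K + t) - w K)"
    unfolding cadlag_def continuous_within
  proof (intro conjI allI impI)
    fix t :: real assume t: "0 \<le> t"
    show "((\<lambda>t. w (K + t) - w K) \<longlongrightarrow> w (K + t) - w K) (at_right t)"
      using filterlim_compose[OF cadlag_right[OF w] filterlim_plus_at_right] t K by (intro tendsto_diff) auto
  next
    fix t :: real assume t: "0 < t"
    obtain l where "(w \<longlongrightarrow> l) (at_left (K + t))" using cadlag_left[OF w, of "K + t"] t K by auto
    from filterlim_compose[OF this filterlim_plus_at_left]
    have "((\<lambda>t. w (K + t) - w K) \<longlongrightarrow> l - w K) (at_left t)" by (intro tendsto_diff) auto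
    then show "\<exists>l. ((\<lambda>t. w (K + t) - w K) \<longlongrightarrow> l) (at_left t)" ..
  qed
  then show ?thesis unfolding shift_def by (rule restrict_in_space_skorokhod)
qed

section \<open>Passage times of paths without negative jumps\<close>

definition good_path :: "(real \<Rightarrow> real) \<Rightarrow> bool" where
  "good_path w \<longleftrightarrow> cadlag w \<and> w 0 = 0 \<and> no_negative_jumps w"

lemma good_path_shift:
  assumes w: "good_path w" and K: "0 \<le> K" shows "good_path (shift K w)"
proof -
  have c: "cadlag w" using w by (simp add: good_path_def)
  have "no_negative_jumps (\<lambda>t. w (K + t) - w K)"
    unfolding no_negative_jumps_def
  proof (intro allI impI)
    fix t l assume t: "0 < t" and l: "((\<lambda>t. w (K + t) - w K) \<longlongrightarrow> l) (at_left t)"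
    obtain l' where l': "(w \<longlongrightarrow> l') (at_left (K + t))" using cadlag_left[OF c, of "K + t"] t K by auto
    from filterlim_compose[OF this filterlim_plus_at_left]
    have "((\<lambda>t. w (K + t) - w K) \<longlongrightarrow> l' - w K) (at_left t)" by (intro tendsto_diff) auto
    with l have "l = l' - w K" using tendsto_unique trivial_limit_at_left_real by blast
    moreover have "l' \<le> w (K + t)"
      using w l' t K no_neg_jumpsD[of w "K + t" l'] by (simp add: good_path_def)
    ultimately show "l \<le> w (K + t) - w K" by simp
  qed
  then have "no_negative_jumps (shift K w)"
    by (subst no_negative_jumps_cong[of _ "\<lambda>t. w (K + t) - w K"]) (auto simp: shift_def)
  then show ?thesis using cadlag_shift[OF c K] K by (auto simp: good_path_def space_skorokhod shift_def)
qed

text \<open>Passage happens exactly at the level. Right-continuity excludes a value above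
  \<open>- s\<close> at the infimum; the left limit there is at least \<open>- s\<close> and a jump
  can only go up. If the passage time is 0, the start \<open>w 0 = 0\<close> settles the
  matter.\<close>

lemma
  assumes w: "good_path w" and d: "dies s w" and s: "0 \<le> s"
  shows tau_nonneg: "0 \<le> tau s w"
    and before_tau: "\<And>t. 0 \<le> t \<Longrightarrow> t < tau s w \<Longrightarrow> - s \<le> w t"
    and at_tau: "w (tau s w) = - s"
proof -
  show 0: "0 \<le> tau s w" using tau_less_iff[OF d, of 0] by (meson leI less_le_not_le)
  show b: "- s \<le> w t" if "0 \<le> t" "t < tau s w" for t
  proof (rule ccontr)
    assume a: "\<not> - s \<le> w t"
    have "tau s w \<le> t" unfolding tau_def
      by (rule cInf_lower) (use that a in \<open>auto intro!: bdd_belowI[of _ 0]\<close>)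
    with that show False by simp
  qed
  have c: "cadlag w" using w by (simp add: good_path_def)
  have "w (tau s w) \<le> - s"
  proof (rule ccontr)
    assume a: "\<not> w (tau s w) \<le> - s"
    then have "eventually (\<lambda>u. w u > - s) (at_right (tau s w))"
      using order_tendstoD(1)[OF cadlag_right[OF c 0], of "- s"] by simp
    then obtain e where e: "e > tau s w" "\<And>u. tau s w < u \<Longrightarrow> u < e \<Longrightarrow> w u > - s"
      by (auto simp: eventually_at_right_field)
    obtain t where t: "t \<ge> 0" "t < e" "w t < - s" using tau_less_iff[OF d, of e] e by auto
    have "t \<le> tau s w" using e(2)[of t] t by force
    then have "t = tau s w" using b[of t] t by force
    then show False using a t by simp
  qed
  moreover have "- s \<le> w (tau s w)"
  proof (cases "tau s w = 0")
    case True then show ?thesis using w s by (simp add: good_path_def)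
  next
    case False
    then have p: "0 < tau s w" using 0 by simp
    obtain l where l: "(w \<longlongrightarrow> l) (at_left (tau s w))" using cadlag_left[OF c p] by blast
    have "eventually (\<lambda>u. - s \<le> w u) (at_left (tau s w))"
      using b p by (auto simp: eventually_at_left_field intro!: exI[of _ 0])
    then have "- s \<le> l" using l by (intro tendsto_lowerbound) auto
    also have "l \<le> w (tau s w)" using w p l no_neg_jumpsD by (auto simp: good_path_def)
    finally show ?thesis .
  qed
  ultimately show "w (tau s w) = - s" by simp
qed

text \<open>Since the path is exactly at \<open>- s\<close> at its passage, the recentred remainder
  has precisely the depth \<open>r\<close> left to go.\<close>

lemma dies_add:
  assumes w: "good_path w" and s: "0 \<le> s" and r: "0 \<le> r"
  shows "dies (s + r) w \<longleftrightarrow> dies s w \<and> dies r (shift (tau s w) w)"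
proof
  assume "dies (s + r) w"
  then obtain t where t: "0 \<le> t" "w t < - (s + r)" by (auto simp: dies_def)
  then have d: "dies s w" using r by (auto simp: dies_def intro!: exI[of _ t])
  have "tau s w \<le> t" using before_tau[OF w d s, of t] t r by force
  then have "shift (tau s w) w (t - tau s w) < - r"
    using t by (simp add: shift_def at_tau[OF w d s])
  with d \<open>tau s w \<le> t\<close> show "dies s w \<and> dies r (shift (tau s w) w)"
    by (auto simp: dies_def[of r] intro!: exI[of _ "t - tau s w"])
next
  assume "dies s w \<and> dies r (shift (tau s w) w)"
  then obtain t where d: "dies s w" and t: "0 \<le> t" "shift (tau s w) w t < - r" by (auto simp: dies_def[of r])
  then have "w (tau s w + t) < - (s + r)" by (simp add: shift_def at_tau[OF w d s])
  then show "dies (s + r) w" using t tau_nonneg[OF w d s] by (auto simp: dies_def intro!: exI[of _ "tau s w + t"])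
qed

lemma eq_by_less_iff: "(\<And>a. x < a \<longleftrightarrow> y < a) \<Longrightarrow> x = (y :: real)"
  by (meson less_irrefl linorder_neqE)

lemma tau_add:
  assumes w: "good_path w" and s: "0 \<le> s" and r: "0 \<le> r" and d: "dies (s + r) w"
  shows "tau (s + r) w = tau s w + tau r (shift (tau s w) w)"
proof (rule eq_by_less_iff)
  fix a
  have ds: "dies s w" and dr: "dies r (shift (tau s w) w)" using d dies_add[OF w s r] by auto
  have "(\<exists>t\<ge>0. t < a \<and> w t < - (s + r)) \<longleftrightarrow> (\<exists>t\<ge>0. t < a - tau s w \<and> shift (tau s w) w t < - r)"
  proof
    assume "\<exists>t\<ge>0. t < a \<and> w t < - (s + r)"
    then obtain t where t: "0 \<le> t" "t < a" "w t < - (s + r)" by blast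
    have "tau s w \<le> t" using before_tau[OF w ds s, of t] t r by force
    then show "\<exists>t\<ge>0. t < a - tau s w \<and> shift (tau s w) w t < - r"
      using t by (intro exI[of _ "t - tau s w"]) (simp add: shift_def at_tau[OF w ds s])
  next
    assume "\<exists>t\<ge>0. t < a - tau s w \<and> shift (tau s w) w t < - r"
    then obtain t where t: "0 \<le> t" "t < a - tau s w" "shift (tau s w) w t < - r" by blast
    then show "\<exists>t\<ge>0. t < a \<and> w t < - (s + r)"
      using tau_nonneg[OF w ds s]
      by (intro exI[of _ "tau s w + t"]) (simp add: shift_def at_tau[OF w ds s])
  qed
  then show "tau (s + r) w < a \<longleftrightarrow> tau s w + tau r (shift (tau s w) w) < a"
    using tau_less_iff[OF d, of a] tau_less_iff[OF dr, of "a - tau s w"]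
    by (simp add: less_diff_eq add.commute)
qed

lemma dies_antimono: "s \<le> r \<Longrightarrow> dies r w \<Longrightarrow> dies s w"
  unfolding dies_def by (meson le_less_trans less_le_trans neg_le_iff_le)

lemma tau_mono:
  assumes "s \<le> r" "dies r w" shows "tau s w \<le> tau r w"
proof (rule ccontr)
  assume "\<not> tau s w \<le> tau r w"
  then obtain t where "0 \<le> t" "t < tau s w" "w t < - r"
    using tau_less_iff[OF assms(2), of "tau s w"] by auto
  moreover from this assms have "tau s w < tau s w"
    using tau_less_iff[OF dies_antimono[OF assms], of "tau s w"] by force
  ultimately show False by simp
qed

lemma tau_pos:
  assumes "good_path w" "dies s w" "0 < s" shows "0 < tau s w"
proof -
  have "tau s w \<noteq> 0" using at_tau[OF assms(1,2)] assms by (auto simp: good_path_def)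
  with tau_nonneg[OF assms(1,2)] assms show ?thesis by simp
qed

text \<open>Whether the level is passed before a time \<open>a \<le> K\<close> can be read off the
  path stopped at \<open>K\<close>. This is the source of all instances of
  \<open>adapted\<close>.\<close>

lemma dies_tau_stop_iff:
  assumes "a \<le> K"
  shows "dies s (stop K w) \<and> tau s (stop K w) < a \<longleftrightarrow> dies s w \<and> tau s w < a"
proof -
  have "dies s v \<and> tau s v < a \<longleftrightarrow> (\<exists>t\<ge>0. t < a \<and> v t < - s)" for v
    using tau_less_iff[of s v a] by (auto simp: dies_def)
  moreover have "(\<exists>t\<ge>0. t < a \<and> stop K w t < - s) \<longleftrightarrow> (\<exists>t\<ge>0. t < a \<and> w t < - s)"
    using assms by (intro ex_cong) (auto simp: stop_def min_def)
  ultimately show ?thesis by blast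
qed

lemma tau_stop:
  assumes "dies s w" "tau s w < K"
  shows "dies s (stop K w)" "tau s (stop K w) = tau s w"
proof -
  show d: "dies s (stop K w)" using dies_tau_stop_iff[of K K s w] assms by auto
  have l: "tau s (stop K w) < K" using dies_tau_stop_iff[of K K s w] assms by auto
  show "tau s (stop K w) = tau s w"
  proof (rule eq_by_less_iff)
    show "tau s (stop K w) < a \<longleftrightarrow> tau s w < a" for a
    proof (cases "a \<le> K")
      case True then show ?thesis using dies_tau_stop_iff[OF True, of s w] d assms by simp
    next
      case False then show ?thesis using assms l by linarith
    qed
  qed
qed

lemma efun_tau_stop:
  assumes "dies s w" "tau s w < K"
  shows "efun {0..<tau s (stop K w)} (stop K w) = efun {0..<tau s w} w"
  unfolding tau_stop[OF assms] by (rule efun_cong) (use assms in \<open>auto simp: stop_def min_def\<close>)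

section \<open>The exponential functional under splitting and shifting\<close>

lemma cadlag_measurable:
  assumes "cadlag w" shows "(\<lambda>t. w (max 0 t)) \<in> borel_measurable lborel"
proof -
  have "(\<lambda>t. (restrict w {0..}, t)) \<in> measurable lborel (skorokhod_space \<Otimes>\<^sub>M lborel)"
    using restrict_in_space_skorokhod[OF assms] by simp
  from measurable_compose[OF this measurable_path_eval] show ?thesis by (simp add: comp_def)
qed

lemma efun_Un:
  assumes "cadlag w" and S: "S \<subseteq> {0..}" "T \<subseteq> {0..}" "S \<inter> T = {}" and [measurable]: "S \<in> sets borel" "T \<in> sets borel"
  shows "efun (S \<union> T) w = efun S w + efun T w"
proof -
  note * = efun_eq_max[of _ w]
  have [measurable]: "(\<lambda>t. ennreal (exp (- w (max 0 t)))) \<in> borel_measurable lborel"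
    using cadlag_measurable[OF assms(1)] by measurable
  have "(\<integral>\<^sup>+t\<in>S \<union> T. ennreal (exp (- w (max 0 t))) \<partial>lborel) =
      (\<integral>\<^sup>+t\<in>S. ennreal (exp (- w (max 0 t))) \<partial>lborel) + (\<integral>\<^sup>+t\<in>T. ennreal (exp (- w (max 0 t))) \<partial>lborel)"
    using S(3) by (intro nn_integral_disjoint_pair) measurable
  then show ?thesis using S by (simp only: * Un_least)
qed

lemma efun_shift:
  assumes w: "cadlag w" and K: "0 \<le> K" and S: "S \<subseteq> {0..}" and [measurable]: "S \<in> sets borel"
  shows "efun ((+) K ` S) w = ennreal (exp (- w K)) * efun S (shift K w)"
proof -
  have [measurable]: "(\<lambda>t. ennreal (exp (- w (max 0 t)))) \<in> borel_measurable borel"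
    using cadlag_measurable[OF w] by measurable
  have [measurable]: "(\<lambda>t. ennreal (exp (- shift K w (max 0 t)))) \<in> borel_measurable borel"
    using cadlag_measurable[of "shift K w"] cadlag_shift[OF w K] by (simp add: space_skorokhod)
  have im: "t \<in> (+) K ` S \<longleftrightarrow> t - K \<in> S" for t by force
  have [measurable]: "(+) K ` S \<in> sets borel"
  proof -
    have "(+) K ` S = (\<lambda>t. t - K) -` S \<inter> space borel" using im by auto
    also have "\<dots> \<in> sets borel" by (rule measurable_sets[of _ borel borel]) measurable
    finally show ?thesis .
  qed
  have "efun ((+) K ` S) w = (\<integral>\<^sup>+t. ennreal (exp (- w (max 0 t))) * indicator ((+) K ` S) t \<partial>lborel)"
    unfolding efun_def by (intro nn_integral_cong) (use S K in \<open>auto split: split_indicator simp: max_def\<close>)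
  also have "\<dots> = (\<integral>\<^sup>+t. ennreal (exp (- w (max 0 (K + 1 * t)))) * indicator ((+) K ` S) (K + 1 * t) \<partial>lborel)"
    by (subst nn_integral_real_affine[where c = 1 and t = K]) auto
  also have "\<dots> = (\<integral>\<^sup>+t. ennreal (exp (- w K)) * (ennreal (exp (- shift K w (max 0 t))) * indicator S t) \<partial>lborel)"
    using S K by (intro nn_integral_cong)
      (auto split: split_indicator simp: shift_def ennreal_mult[symmetric] exp_add[symmetric] im max_def)
  also have "\<dots> = ennreal (exp (- w K)) * (\<integral>\<^sup>+t. ennreal (exp (- shift K w (max 0 t))) * indicator S t \<partial>lborel)"
    by (rule nn_integral_cmult) measurable
  also have "(\<integral>\<^sup>+t. ennreal (exp (- shift K w (max 0 t))) * indicator S t \<partial>lborel) = efun S (shift K w)"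
    unfolding efun_def by (intro nn_integral_cong) (use S in \<open>auto split: split_indicator simp: max_def\<close>)
  finally show ?thesis .
qed

text \<open>The factor \<open>exp s\<close> comes from restarting at height \<open>- s\<close>. For
  tails there is only an inequality, because the tail of the remainder is taken over times after
  \<open>tau s w + T\<close>, a subset of those after \<open>T\<close>.\<close>

lemma
  assumes w: "good_path w" and s: "0 \<le> s" and d: "dies s w"
  shows efun_split_tau: "efun {0..} w = efun {0..<tau s w} w + ennreal (exp s) * efun {0..} (shift (tau s w) w)"
    and efun_shift_tau: "\<And>T. 0 \<le> T \<Longrightarrow> ennreal (exp s) * efun {T..} (shift (tau s w) w) \<le> efun {T..} w"
proof -
  have c: "cadlag w" using w by (simp add: good_path_def)
  note t0 = tau_nonneg[OF w d s]
  have *: "efun ((+) (tau s w) ` S) w = ennreal (exp s) * efun S (shift (tau s w) w)"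
    if "S \<subseteq> {0..}" "S \<in> sets borel" for S
    using efun_shift[OF c t0 that] by (simp add: at_tau[OF w d s])
  have a: "(+) (tau s w) ` {T..} = {tau s w + T..}" for T by simp
  have "efun ({0..<tau s w} \<union> {tau s w..}) w = efun {0..<tau s w} w + efun {tau s w..} w"
    by (rule efun_Un[OF c]) (use t0 in auto)
  moreover have "{0..<tau s w} \<union> {tau s w..} = {0..}" using t0 by auto
  ultimately show "efun {0..} w = efun {0..<tau s w} w + ennreal (exp s) * efun {0..} (shift (tau s w) w)"
    using *[of "{0..}"] by simp
  show "ennreal (exp s) * efun {T..} (shift (tau s w) w) \<le> efun {T..} w" if "0 \<le> T" for T
    using *[of "{T..}"] that t0 efun_mono_set[of "{tau s w + T..}" "{T..}" w] by simp
qed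

text \<open>Before the passage the path is at least \<open>- s\<close>. Together with
  \<open>efun_ge\<close>, which needs an upper bound on the path, this makes the integral up to the
  passage comparable to the passage time.\<close>

lemma efun_tau_le:
  assumes w: "good_path w" and s: "0 \<le> s" and d: "dies s w"
  shows "efun {0..<tau s w} w \<le> ennreal (exp s * tau s w)"
proof -
  have "efun {0..<tau s w} w \<le> (\<integral>\<^sup>+t\<in>{0..<tau s w}. ennreal (exp s) \<partial>lborel)"
    unfolding efun_def using before_tau[OF w d s]
    by (intro nn_integral_mono) (auto split: split_indicator simp: minus_le_iff)
  also have "\<dots> = ennreal (exp s) * ennreal (tau s w)"
    using tau_nonneg[OF w d s] by (simp add: nn_integral_cmult_indicator)
  finally show ?thesis using tau_nonneg[OF w d s] by (simp add: ennreal_mult)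
qed

lemma efun_ge:
  assumes "0 \<le> T" "\<And>t. 0 \<le> t \<Longrightarrow> t < T \<Longrightarrow> w t \<le> a"
  shows "ennreal (exp (- a) * T) \<le> efun {0..<T} w"
proof -
  have "ennreal (exp (- a) * T) = (\<integral>\<^sup>+t\<in>{0..<T}. ennreal (exp (- a)) \<partial>lborel)"
    using assms(1) by (simp add: nn_integral_cmult_indicator ennreal_mult)
  also have "\<dots> \<le> efun {0..<T} w"
    unfolding efun_def using assms(2) by (intro nn_integral_mono) (auto split: split_indicator)
  finally show ?thesis .
qed

text \<open>A generating \<open>\<pi>\<close>-system whose indicators are limits of continuous functions of finitely many coordinates.\<close>

definition boxes :: "(real \<Rightarrow> real) set set" where
  "boxes = {{w \<in> space skorokhod_space. \<forall>j\<in>J. w j \<le> a j} | J a. finite J \<and> J \<subseteq> {0..}}"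

lemma boxesI: "finite J \<Longrightarrow> J \<subseteq> {0..} \<Longrightarrow> {w \<in> space skorokhod_space. \<forall>j\<in>J. w j \<le> a j} \<in> boxes"
  by (auto simp: boxes_def)

lemma boxes_subset_sets: "boxes \<subseteq> sets skorokhod_space"
proof
  fix A assume "A \<in> boxes"
  then obtain J a where J: "finite J" "J \<subseteq> {0..}" and A: "A = {w \<in> space skorokhod_space. \<forall>j\<in>J. w j \<le> a j}"
    by (auto simp: boxes_def)
  have "Measurable.pred skorokhod_space (\<lambda>w. w j \<le> a j)" if "j \<in> J" for j
  proof -
    have [measurable]: "(\<lambda>w. w j) \<in> borel_measurable skorokhod_space"
      using J that by (intro measurable_skorokhod_eval) auto
    show ?thesis by measurable
  qed
  then have "Measurable.pred skorokhod_space (\<lambda>w. \<forall>j\<in>J. w j \<le> a j)"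
    using J by (intro pred_intros_finite) auto
  then show "A \<in> sets skorokhod_space" by (simp add: A pred_def)
qed

lemma Int_stable_boxes: "Int_stable boxes"
proof (rule Int_stableI)
  fix A B assume "A \<in> boxes" "B \<in> boxes"
  then obtain J a I b where J: "finite J" "J \<subseteq> {0..}" and A: "A = {w \<in> space skorokhod_space. \<forall>j\<in>J. w j \<le> a j}"
    and I: "finite I" "I \<subseteq> {0..}" and B: "B = {w \<in> space skorokhod_space. \<forall>j\<in>I. w j \<le> b j}"
    unfolding boxes_def by blast
  define c where "c j = (if j \<in> I \<and> j \<in> J then min (a j) (b j) else if j \<in> I then b j else a j)" for j
  have "A \<inter> B = {w \<in> space skorokhod_space. \<forall>j\<in>I \<union> J. w j \<le> c j}"
    unfolding A B c_def by (auto split: if_splits)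
  also have "\<dots> \<in> boxes" using I J by (intro boxesI) auto
  finally show "A \<inter> B \<in> boxes" .
qed

lemma sets_skorokhod_eq: "sets skorokhod_space = sigma_sets (space skorokhod_space) boxes"
proof
  let ?S = "sigma (space skorokhod_space) boxes"
  have sub: "boxes \<subseteq> Pow (space skorokhod_space)" by (auto simp: boxes_def)
  have "(\<lambda>w. w) \<in> measurable ?S skorokhod_space"
  proof (rule measurable_skorokhodI)
    show "(\<lambda>w. w t) \<in> borel_measurable ?S" if "0 \<le> t" for t
    proof (rule borel_measurableI_le)
      fix y
      have "{w \<in> space skorokhod_space. w t \<le> y} = {w \<in> space skorokhod_space. \<forall>j\<in>{t}. w j \<le> y}" by simp
      also have "\<dots> \<in> boxes" using that by (intro boxesI[of "{t}" "\<lambda>_. y"]) auto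
      finally show "{w \<in> space ?S. w t \<le> y} \<in> sets ?S" using sub by (simp add: sigma_sets.Basic)
    qed
  qed (use sub in auto)
  from measurable_sets[OF this] show "sets skorokhod_space \<subseteq> sigma_sets (space skorokhod_space) boxes"
    using sub sets.sets_into_space[of _ skorokhod_space] by (auto simp: Int_absorb2)
  show "sigma_sets (space skorokhod_space) boxes \<subseteq> sets skorokhod_space"
    using boxes_subset_sets by (rule sets.sigma_sets_subset)
qed

lemma measure_eq_boxes:
  assumes "sets P = sets skorokhod_space" "sets Q = sets skorokhod_space" "finite_measure P"
    and "\<And>A. A \<in> boxes \<Longrightarrow> emeasure P A = emeasure Q A"
  shows "P = Q"
proof (rule measure_eqI_generator_eq[OF Int_stable_boxes, of "space skorokhod_space" P Q "\<lambda>_. space skorokhod_space"])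
  interpret finite_measure P by fact
  show "boxes \<subseteq> Pow (space skorokhod_space)" by (auto simp: boxes_def)
  show "range (\<lambda>_::nat. space skorokhod_space) \<subseteq> boxes" using boxesI[of "{}"] by auto
  show "emeasure P (space skorokhod_space) \<noteq> \<infinity>" using emeasure_finite by simp
qed (use assms in \<open>auto simp: sets_skorokhod_eq\<close>)

section \<open>The Markov property\<close>

text \<open>A continuous majorant of the indicator of \<open>{..0}\<close>; for \<open>m > 0\<close>
  it vanishes from \<open>1 / m\<close> on.\<close>

definition ramp :: "real \<Rightarrow> real \<Rightarrow> real" where
  "ramp m x = max 0 (min 1 (1 - m * x))"

lemma ramp_bounds: "0 \<le> ramp m x" "ramp m x \<le> 1"
  by (auto simp: ramp_def)

lemma ramp_nonpos: "0 \<le> m \<Longrightarrow> x \<le> 0 \<Longrightarrow> ramp m x = 1"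
  by (simp add: ramp_def mult_nonneg_nonpos)

lemma ramp_measurable [measurable]: "ramp m \<in> borel_measurable borel"
  unfolding ramp_def[abs_def] by measurable

lemma ramp_tendsto: "(f \<longlongrightarrow> l) F \<Longrightarrow> ((\<lambda>x. ramp m (f x)) \<longlongrightarrow> ramp m l) F"
  unfolding ramp_def by (intro tendsto_intros)

lemma ramp_eq_0: "1 \<le> m * x \<Longrightarrow> ramp m x = 0"
  by (simp add: ramp_def)

lemma ramp_tendsto_indicator: "(\<lambda>n. ramp (real n) x) \<longlonglongrightarrow> indicator {..0} x"
proof (cases "x \<le> 0")
  case True then show ?thesis by (simp add: ramp_nonpos)
next
  case False
  then obtain N :: nat where N: "1 < real N * x" using ex_less_of_nat_mult[of x 1] by auto
  have "eventually (\<lambda>n. ramp (real n) x = 0) sequentially"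
    unfolding eventually_sequentially
  proof (intro exI allI impI)
    fix n assume "N \<le> n"
    then have "real N * x \<le> real n * x" using False by (intro mult_right_mono) auto
    with N show "ramp (real n) x = 0" by (intro ramp_eq_0) linarith
  qed
  then show ?thesis using False by (simp add: tendsto_eventually)
qed

text \<open>The hypotheses of the theorem with their almost sure path properties required for every
  outcome, so that pathwise arguments meet no null sets. The last assumption is the form in which
  unbounded variation is used. \<open>spectrally_positive_modification\<close> provides such a
  version of the process.\<close>

locale spectrally_positive_up = prob_space M for M :: "'a measure" +
  fixes Z :: "real \<Rightarrow> 'a \<Rightarrow> real"
  assumes Z_measurable: "0 \<le> t \<Longrightarrow> Z t \<in> borel_measurable M"
    and Z_good: "\<omega> \<in> space M \<Longrightarrow> good_path (\<lambda>t. Z t \<omega>)"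
    and Z_drift: "\<omega> \<in> space M \<Longrightarrow> filterlim (\<lambda>t. Z t \<omega>) at_top at_top"
    and Z_indep: "0 \<le> u 0 \<Longrightarrow> mono_on {..n} u \<Longrightarrow>
      indep_vars (\<lambda>_. borel) (\<lambda>i \<omega>. Z (u (Suc i)) \<omega> - Z (u i) \<omega>) {..<n::nat}"
    and Z_stationary: "0 \<le> s \<Longrightarrow> 0 \<le> h \<Longrightarrow>
      distr M borel (\<lambda>\<omega>. Z (s + h) \<omega> - Z s \<omega>) = distr M borel (Z h)"
    and Z_dies: "prob {\<omega> \<in> space M. dies 0 (\<lambda>t. Z t \<omega>)} > 0"
begin

definition path :: "'a \<Rightarrow> real \<Rightarrow> real" where
  "path \<omega> = (\<lambda>t\<in>{0..}. Z t \<omega>)"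

lemma path_eval [simp]: "0 \<le> t \<Longrightarrow> path \<omega> t = Z t \<omega>"
  by (simp add: path_def)

lemma Z_0: "\<omega> \<in> space M \<Longrightarrow> Z 0 \<omega> = 0"
  using Z_good by (simp add: good_path_def)

lemma path_in_space: "\<omega> \<in> space M \<Longrightarrow> path \<omega> \<in> space skorokhod_space"
  unfolding path_def using Z_good by (intro restrict_in_space_skorokhod) (simp add: good_path_def)

lemma path_good: assumes "\<omega> \<in> space M" shows "good_path (path \<omega>)"
proof -
  have "no_negative_jumps (path \<omega>)"
    by (subst no_negative_jumps_cong[of _ "\<lambda>t. Z t \<omega>"]) (use Z_good[OF assms] in \<open>auto simp: good_path_def\<close>)
  then show ?thesis using path_in_space[OF assms] Z_0[OF assms] by (simp add: good_path_def space_skorokhod)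
qed

lemma path_cadlag: "\<omega> \<in> space M \<Longrightarrow> cadlag (path \<omega>)"
  using path_good by (simp add: good_path_def)

lemma path_measurable [measurable]: "path \<in> measurable M skorokhod_space"
  by (rule measurable_skorokhodI) (auto simp: path_in_space Z_measurable)

lemma stop_path_measurable [measurable]: "0 \<le> K \<Longrightarrow> (\<lambda>\<omega>. stop K (path \<omega>)) \<in> measurable M skorokhod_space"
  by (rule measurable_skorokhodI) (auto simp: stop_def path_cadlag Z_measurable intro: cadlag_stop[unfolded stop_def])

lemma shift_path_measurable [measurable]: "0 \<le> K \<Longrightarrow> (\<lambda>\<omega>. shift K (path \<omega>)) \<in> measurable M skorokhod_space"
proof (rule measurable_skorokhodI)
  assume K: "0 \<le> K"
  show "(\<lambda>\<omega>. shift K (path \<omega>) t) \<in> borel_measurable M" if "0 \<le> t" for t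
    using that K Z_measurable[of K] Z_measurable[of "K + t"] by (simp add: shift_def)
qed (auto intro: cadlag_shift path_cadlag)

text \<open>Lists finitely many times in the format of the independence assumption, which speaks of
  increments along a monotone sequence.\<close>

lemma enumerate_times:
  assumes "finite J" "J \<subseteq> {0::real..}"
  shows "\<exists>u n. u 0 = 0 \<and> mono u \<and> 0 < n \<and> u ` {..n::nat} = insert 0 J"
proof -
  define xs where "xs = sorted_list_of_set (insert 0 J)"
  have xs: "set xs = insert 0 J" "sorted xs" using assms unfolding xs_def by (simp_all del: sorted_list_of_set_insert_remove)
  then have ne: "xs \<noteq> []" by auto
  define l where "l = length xs - 1"
  \<comment> \<open>Capping the index keeps the sequence monotone on all naturals. The last entry is
    repeated once, so that there is always at least one increment and the product of their laws is
    over a nonempty index set.\<close>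
  define u where "u i = xs ! min i l" for i
  have l: "l < length xs" using ne by (simp add: l_def)
  have "mono u" unfolding u_def by (intro monoI sorted_nth_mono[OF xs(2)]) (use l in auto)
  have img: "u ` {..Suc l} = set xs"
  proof -
    have "{..l} = {..<length xs}" using l by (auto simp: l_def)
    then have "set xs = (!) xs ` {..l}" by (auto simp: set_conv_nth image_iff)
    also have "\<dots> = u ` {..Suc l}" by (auto simp: u_def image_iff min_def intro: bexI[of _ "l"] le_SucI)
    finally show ?thesis ..
  qed
  have "u 0 \<le> 0"
  proof -
    obtain i where "u i = 0" using img xs by (metis image_iff insertI1)
    then show ?thesis using \<open>mono u\<close> by (metis monoD le0)
  qed
  moreover have "0 \<le> u 0" using img xs assms by (metis atLeast_iff atMost_iff imageI insert_iff le0 order_refl subsetD)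
  ultimately show ?thesis using \<open>mono u\<close> img xs by (intro exI[of _ u] exI[of _ "Suc l"]) auto
qed

lemma increments_distr:
  assumes u: "u 0 = 0" "mono u" and K: "0 \<le> K" and n: "0 < (n::nat)"
  shows "distr M (\<Pi>\<^sub>M i\<in>{..<n}. borel) (\<lambda>\<omega>. \<lambda>i\<in>{..<n}. Z (K + u (Suc i)) \<omega> - Z (K + u i) \<omega>) =
    (\<Pi>\<^sub>M i\<in>{..<n}. distr M borel (Z (u (Suc i) - u i)))"
proof -
  have u0: "0 \<le> u i" for i using monoD[OF u(2), of 0 i] u(1) by simp
  have "indep_vars (\<lambda>_. borel) (\<lambda>i \<omega>. Z (K + u (Suc i)) \<omega> - Z (K + u i) \<omega>) {..<n}"
    by (rule Z_indep[of "\<lambda>i. K + u i"]) (use u K in \<open>auto simp: mono_on_def mono_def\<close>)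
  then have "distr M (\<Pi>\<^sub>M i\<in>{..<n}. borel) (\<lambda>\<omega>. \<lambda>i\<in>{..<n}. Z (K + u (Suc i)) \<omega> - Z (K + u i) \<omega>) =
    (\<Pi>\<^sub>M i\<in>{..<n}. distr M borel (\<lambda>\<omega>. Z (K + u (Suc i)) \<omega> - Z (K + u i) \<omega>))"
    by (subst (asm) indep_vars_iff_distr_eq_PiM') (use n K u0 in \<open>auto intro!: borel_measurable_diff Z_measurable\<close>)
  also have "\<dots> = (\<Pi>\<^sub>M i\<in>{..<n}. distr M borel (Z (u (Suc i) - u i)))"
  proof (rule PiM_cong)
    fix i
    have "0 \<le> u (Suc i) - u i" using monoD[OF u(2), of i "Suc i"] by simp
    from Z_stationary[of "K + u i", OF _ this]
    show "distr M borel (\<lambda>\<omega>. Z (K + u (Suc i)) \<omega> - Z (K + u i) \<omega>) = distr M borel (Z (u (Suc i) - u i))"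
      using K u0[of i] by simp
  qed simp
  finally show ?thesis .
qed

text \<open>A box is a condition on partial sums of increments along one time grid, and the joint
  law of these increments does not depend on \<open>K\<close>.\<close>

lemma shift_law:
  assumes K: "0 \<le> K"
  shows "distr M skorokhod_space (\<lambda>\<omega>. shift K (path \<omega>)) = distr M skorokhod_space path"
proof (rule measure_eq_boxes)
  show "finite_measure (distr M skorokhod_space (\<lambda>\<omega>. shift K (path \<omega>)))"
    using K by (intro finite_measure_distr) measurable
  fix A assume A: "A \<in> boxes"
  then have [measurable]: "A \<in> sets skorokhod_space" using boxes_subset_sets by auto
  obtain J a where J: "finite J" "J \<subseteq> {0..}" and Aeq: "A = {w \<in> space skorokhod_space. \<forall>j\<in>J. w j \<le> a j}"
    using A by (auto simp: boxes_def)
  obtain u n where u: "u 0 = 0" "mono u" "0 < n" "u ` {..n::nat} = insert 0 J"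
    using enumerate_times[OF J] by blast
  have u0: "0 \<le> u i" for i using monoD[OF u(2), of 0 i] u(1) by simp
  have "\<forall>j\<in>J. \<exists>i. i \<le> n \<and> u i = j" using u(4) by (metis atMost_iff image_iff insertI2)
  then obtain c where c: "\<And>j. j \<in> J \<Longrightarrow> c j \<le> n \<and> u (c j) = j" by metis
  define B where "B = {x \<in> space (\<Pi>\<^sub>M i\<in>{..<n}. borel :: real measure). \<forall>j\<in>J. (\<Sum>k<c j. x k) \<le> a j}"
  have Bm: "B \<in> sets (\<Pi>\<^sub>M i\<in>{..<n}. borel)"
  proof -
    have "Measurable.pred (\<Pi>\<^sub>M i\<in>{..<n}. borel :: real measure) (\<lambda>x. \<forall>j\<in>J. (\<Sum>k<c j. x k) \<le> a j)"
    proof (rule pred_intros_finite(3)[OF J(1)])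
      fix j assume "j \<in> J"
      have [measurable]: "(\<lambda>x. \<Sum>k<c j. x k) \<in> borel_measurable (\<Pi>\<^sub>M i\<in>{..<n}. borel :: real measure)"
        by (rule borel_measurable_sum) (use c[OF \<open>j \<in> J\<close>] in \<open>auto intro!: measurable_component_singleton\<close>)
      show "Measurable.pred (\<Pi>\<^sub>M i\<in>{..<n}. borel) (\<lambda>x. (\<Sum>k<c j. x k) \<le> a j)" by measurable
    qed
    then show ?thesis by (simp add: B_def pred_def)
  qed
  have main: "emeasure M {\<omega> \<in> space M. \<forall>j\<in>J. Z (K + j) \<omega> - Z K \<omega> \<le> a j} =
      emeasure (\<Pi>\<^sub>M i\<in>{..<n}. distr M borel (Z (u (Suc i) - u i))) B" if K: "0 \<le> K" for K
  proof -
    let ?f = "\<lambda>\<omega>. \<lambda>i\<in>{..<n}. Z (K + u (Suc i)) \<omega> - Z (K + u i) \<omega>"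
    have fm: "?f \<in> measurable M (\<Pi>\<^sub>M i\<in>{..<n}. borel)"
      using K u0 by (intro measurable_restrict borel_measurable_diff Z_measurable) auto
    have "?f -` B \<inter> space M = {\<omega> \<in> space M. \<forall>j\<in>J. Z (K + j) \<omega> - Z K \<omega> \<le> a j}"
    proof -
      have "(\<Sum>k<c j. ?f \<omega> k) = Z (K + j) \<omega> - Z K \<omega>" if "j \<in> J" for j \<omega>
      proof -
        have "(\<Sum>k<c j. ?f \<omega> k) = (\<Sum>k<c j. Z (K + u (Suc k)) \<omega> - Z (K + u k) \<omega>)"
          using c[OF that] by (intro sum.cong) auto
        also have "\<dots> = Z (K + u (c j)) \<omega> - Z (K + u 0) \<omega>" by (rule sum_lessThan_telescope)
        finally show ?thesis using c[OF that] u(1) by simp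
      qed
      then show ?thesis using measurable_space[OF fm] by (auto simp: B_def)
    qed
    then show ?thesis using emeasure_distr[OF fm Bm] increments_distr[OF u(1,2) K u(3)] by simp
  qed
  have "emeasure (distr M skorokhod_space (\<lambda>\<omega>. shift K (path \<omega>))) A =
      emeasure M {\<omega> \<in> space M. \<forall>j\<in>J. Z (K + j) \<omega> - Z K \<omega> \<le> a j}"
  proof (subst emeasure_distr)
    have "(\<lambda>\<omega>. shift K (path \<omega>)) -` A \<inter> space M = {\<omega> \<in> space M. \<forall>j\<in>J. Z (K + j) \<omega> - Z K \<omega> \<le> a j}"
      using J(2) K cadlag_shift[OF path_cadlag K] by (auto simp: Aeq shift_def subset_eq)
    then show "emeasure M ((\<lambda>\<omega>. shift K (path \<omega>)) -` A \<inter> space M) =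
      emeasure M {\<omega> \<in> space M. \<forall>j\<in>J. Z (K + j) \<omega> - Z K \<omega> \<le> a j}" by simp
  qed (use K in measurable)
  also have "\<dots> = emeasure M {\<omega> \<in> space M. \<forall>j\<in>J. Z (0 + j) \<omega> - Z 0 \<omega> \<le> a j}"
    using main[OF K] main[of 0] by simp
  also have "{\<omega> \<in> space M. \<forall>j\<in>J. Z (0 + j) \<omega> - Z 0 \<omega> \<le> a j} = path -` A \<inter> space M"
    using J(2) path_in_space by (auto simp: Aeq Z_0 subset_eq)
  also have "emeasure M \<dots> = emeasure (distr M skorokhod_space path) A" by (simp add: emeasure_distr)
  finally show "emeasure (distr M skorokhod_space (\<lambda>\<omega>. shift K (path \<omega>))) A = emeasure (distr M skorokhod_space path) A" .
qed auto

text \<open>One grid is laid through all the times, with \<open>K\<close> at index \<open>m\<close>.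
  The stopped path is a function of the increments before \<open>m\<close>, the shifted path of
  those from \<open>m\<close> on, and the two blocks are independent.\<close>

lemma prob_stop_shift_boxes:
  assumes K: "0 \<le> K" and I: "finite I" "I \<subseteq> {0..}" and J: "finite J" "J \<subseteq> {0..}"
  shows "prob {\<omega> \<in> space M. (\<forall>i\<in>I. Z (min i K) \<omega> \<le> a i) \<and> (\<forall>j\<in>J. Z (K + j) \<omega> - Z K \<omega> \<le> b j)} =
    prob {\<omega> \<in> space M. \<forall>i\<in>I. Z (min i K) \<omega> \<le> a i} * prob {\<omega> \<in> space M. \<forall>j\<in>J. Z (K + j) \<omega> - Z K \<omega> \<le> b j}"
proof -
  \<comment> \<open>Inserting \<open>K\<close>, and capping all other times at it, makes it the last
    point of the first grid.\<close>
  let ?I = "insert K ((\<lambda>i. min i K) ` I)"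
  have "finite ?I" "?I \<subseteq> {0..}" using I K by auto
  from enumerate_times[OF this] obtain v m where v: "v 0 = 0" "mono v" "0 < m" "v ` {..m::nat} = insert 0 ?I"
    by (elim exE conjE)
  obtain v' l where v': "v' 0 = 0" "mono v'" "0 < l" "v' ` {..l::nat} = insert 0 J"
    using enumerate_times[OF J] by blast
  have v0: "0 \<le> v i" for i using monoD[OF v(2), of 0 i] v(1) by simp
  have v'0: "0 \<le> v' i" for i using monoD[OF v'(2), of 0 i] v'(1) by simp
  have vm: "v m = K"
  proof (rule antisym)
    have "v m \<in> insert 0 ?I" using v(4) by (metis atMost_iff imageI order_refl)
    then show "v m \<le> K" using K by auto
    have "K \<in> v ` {..m}" using v(4) by simp
    then show "K \<le> v m" using v(2) by (auto dest: monoD)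
  qed
  have "\<forall>i\<in>I. \<exists>k. k \<le> m \<and> v k = min i K" using v(4) by (metis atMost_iff image_iff insertI2 imageI)
  then obtain c where c: "\<And>i. i \<in> I \<Longrightarrow> c i \<le> m \<and> v (c i) = min i K" by metis
  have "\<forall>j\<in>J. \<exists>k. k \<le> l \<and> v' k = j" using v'(4) by (metis atMost_iff image_iff insertI2)
  then obtain d where d: "\<And>j. j \<in> J \<Longrightarrow> d j \<le> l \<and> v' (d j) = j" by metis
  define u where "u i = (if i \<le> m then v i else K + v' (i - m))" for i
  have u1: "u i = v i" if "i \<le> m" for i using that by (simp add: u_def)
  have u2: "u (m + i) = K + v' i" for i using vm v'(1) by (simp add: u_def)
  have "mono u"
  proof (rule monoI)
    fix i j :: nat assume ij: "i \<le> j"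
    consider "j \<le> m" | "i \<le> m" "m < j" | "m < i" by linarith
    then show "u i \<le> u j"
    proof cases
      case 2
      have "v i \<le> K" using monoD[OF v(2), of i m] 2 vm by simp
      then show ?thesis using 2 v'0[of "j - m"] by (simp add: u_def)
    qed (use ij v(2) v'(2) in \<open>auto simp: u_def mono_def\<close>)
  qed
  have u0: "0 \<le> u i" for i using v0 v'0 K by (simp add: u_def)
  let ?X = "\<lambda>i \<omega>. Z (u (Suc i)) \<omega> - Z (u i) \<omega>"
  have "indep_vars (\<lambda>_. borel) ?X {..<m + l}"
    by (rule Z_indep) (use u0 \<open>mono u\<close> in \<open>auto simp: mono_on_def mono_def\<close>)
  then have ind: "indep_var (\<Pi>\<^sub>M i\<in>{..<m}. borel) (\<lambda>\<omega>. \<lambda>i\<in>{..<m}. ?X i \<omega>)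
      (\<Pi>\<^sub>M i\<in>{m..<m + l}. borel) (\<lambda>\<omega>. \<lambda>i\<in>{m..<m + l}. ?X i \<omega>)"
    by (rule indep_var_restrict) auto
  define A where "A = {x \<in> space (\<Pi>\<^sub>M i\<in>{..<m}. borel :: real measure). \<forall>i\<in>I. (\<Sum>k<c i. x k) \<le> a i}"
  define B where "B = {x \<in> space (\<Pi>\<^sub>M i\<in>{m..<m + l}. borel :: real measure). \<forall>j\<in>J. (\<Sum>k=m..<m + d j. x k) \<le> b j}"
  have Am: "A \<in> sets (\<Pi>\<^sub>M i\<in>{..<m}. borel)"
  proof -
    have "Measurable.pred (\<Pi>\<^sub>M i\<in>{..<m}. borel :: real measure) (\<lambda>x. \<forall>i\<in>I. (\<Sum>k<c i. x k) \<le> a i)"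
    proof (rule pred_intros_finite(3)[OF I(1)])
      fix i assume "i \<in> I"
      have [measurable]: "(\<lambda>x. \<Sum>k<c i. x k) \<in> borel_measurable (\<Pi>\<^sub>M i\<in>{..<m}. borel :: real measure)"
        by (rule borel_measurable_sum) (use c[OF \<open>i \<in> I\<close>] in \<open>auto intro!: measurable_component_singleton\<close>)
      show "Measurable.pred (\<Pi>\<^sub>M i\<in>{..<m}. borel) (\<lambda>x. (\<Sum>k<c i. x k) \<le> a i)" by measurable
    qed
    then show ?thesis by (simp add: A_def pred_def)
  qed
  have Bm: "B \<in> sets (\<Pi>\<^sub>M i\<in>{m..<m + l}. borel)"
  proof -
    have "Measurable.pred (\<Pi>\<^sub>M i\<in>{m..<m + l}. borel :: real measure) (\<lambda>x. \<forall>j\<in>J. (\<Sum>k=m..<m + d j. x k) \<le> b j)"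
    proof (rule pred_intros_finite(3)[OF J(1)])
      fix j assume "j \<in> J"
      have [measurable]: "(\<lambda>x. \<Sum>k=m..<m + d j. x k) \<in> borel_measurable (\<Pi>\<^sub>M i\<in>{m..<m + l}. borel :: real measure)"
        by (rule borel_measurable_sum) (use d[OF \<open>j \<in> J\<close>] in \<open>auto intro!: measurable_component_singleton\<close>)
      show "Measurable.pred (\<Pi>\<^sub>M i\<in>{m..<m + l}. borel) (\<lambda>x. (\<Sum>k=m..<m + d j. x k) \<le> b j)" by measurable
    qed
    then show ?thesis by (simp add: B_def pred_def)
  qed
  have Aeq: "(\<lambda>i\<in>{..<m}. ?X i \<omega>) \<in> A \<longleftrightarrow> (\<forall>i\<in>I. Z (min i K) \<omega> \<le> a i)" if "\<omega> \<in> space M" for \<omega>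
  proof -
    have "(\<Sum>k<c i. (\<lambda>i\<in>{..<m}. ?X i \<omega>) k) = Z (min i K) \<omega>" if "i \<in> I" for i
    proof -
      have "(\<Sum>k<c i. (\<lambda>i\<in>{..<m}. ?X i \<omega>) k) = (\<Sum>k<c i. ?X k \<omega>)"
        using c[OF that] by (intro sum.cong) auto
      also have "\<dots> = Z (u (c i)) \<omega> - Z (u 0) \<omega>" by (rule sum_lessThan_telescope)
      finally show ?thesis using c[OF that] v(1) \<open>\<omega> \<in> space M\<close> by (simp add: u1 Z_0)
    qed
    then show ?thesis by (auto simp: A_def space_PiM)
  qed
  have Beq: "(\<lambda>i\<in>{m..<m + l}. ?X i \<omega>) \<in> B \<longleftrightarrow> (\<forall>j\<in>J. Z (K + j) \<omega> - Z K \<omega> \<le> b j)" for \<omega>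
  proof -
    have "(\<Sum>k=m..<m + d j. (\<lambda>i\<in>{m..<m + l}. ?X i \<omega>) k) = Z (K + j) \<omega> - Z K \<omega>" if "j \<in> J" for j
    proof -
      have "(\<Sum>k=m..<m + d j. (\<lambda>i\<in>{m..<m + l}. ?X i \<omega>) k) = (\<Sum>k=m..<m + d j. ?X k \<omega>)"
        using d[OF that] by (intro sum.cong) auto
      also have "\<dots> = Z (u (m + d j)) \<omega> - Z (u m) \<omega>" by (rule sum_Suc_diff') simp
      finally show ?thesis using d[OF that] v'(1) vm by (simp add: u2 u1)
    qed
    then show ?thesis by (auto simp: B_def space_PiM)
  qed
  have "(\<lambda>x. (\<lambda>i\<in>{..<m}. ?X i x, \<lambda>i\<in>{m..<m + l}. ?X i x)) -` (A \<times> B) \<inter> space M =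
      {\<omega> \<in> space M. (\<forall>i\<in>I. Z (min i K) \<omega> \<le> a i) \<and> (\<forall>j\<in>J. Z (K + j) \<omega> - Z K \<omega> \<le> b j)}"
    using Aeq Beq by auto
  moreover have "(\<lambda>\<omega>. \<lambda>i\<in>{..<m}. ?X i \<omega>) -` A \<inter> space M = {\<omega> \<in> space M. \<forall>i\<in>I. Z (min i K) \<omega> \<le> a i}"
    using Aeq by auto
  moreover have "(\<lambda>\<omega>. \<lambda>i\<in>{m..<m + l}. ?X i \<omega>) -` B \<inter> space M = {\<omega> \<in> space M. \<forall>j\<in>J. Z (K + j) \<omega> - Z K \<omega> \<le> b j}"
    using Beq by auto
  ultimately show ?thesis using indep_varD[OF ind Am Bm] by simp
qed

text \<open>The product formula on boxes is independence of two intersection-stable generators,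
  which extends to the generated \<sigma>-algebras.\<close>

lemma stop_shift_indep:
  assumes K: "0 \<le> K"
  shows "indep_var skorokhod_space (\<lambda>\<omega>. stop K (path \<omega>)) skorokhod_space (\<lambda>\<omega>. shift K (path \<omega>))"
proof -
  let ?X = "\<lambda>\<omega>. stop K (path \<omega>)" and ?Y = "\<lambda>\<omega>. shift K (path \<omega>)"
  have Xm [measurable]: "?X \<in> measurable M skorokhod_space" and Ym [measurable]: "?Y \<in> measurable M skorokhod_space"
    using K by measurable
  have stable: "Int_stable {f -` A \<inter> space M |A. A \<in> boxes}" for f
  proof (rule Int_stableI)
    fix A B assume "A \<in> {f -` A \<inter> space M |A. A \<in> boxes}" "B \<in> {f -` A \<inter> space M |A. A \<in> boxes}"
    then obtain a b where "A = f -` a \<inter> space M" "B = f -` b \<inter> space M" "a \<in> boxes" "b \<in> boxes" by auto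
    then show "A \<inter> B \<in> {f -` A \<inter> space M |A. A \<in> boxes}"
      using Int_stable_boxes by (auto simp: Int_stable_def intro!: exI[of _ "a \<inter> b"])
  qed
  have sig: "sigma_sets (space M) {f -` A \<inter> space M |A. A \<in> sets skorokhod_space} =
      sigma_sets (space M) {f -` A \<inter> space M |A. A \<in> boxes}" if "f \<in> measurable M skorokhod_space" for f
  proof -
    have f: "f \<in> space M \<rightarrow> space skorokhod_space" using that by (auto dest: measurable_space)
    show ?thesis unfolding sets_skorokhod_eq sigma_sets_vimage_commute[OF f]
      by (rule sigma_sets_sigma_sets_eq) auto
  qed
  have "indep_set {?X -` A \<inter> space M |A. A \<in> boxes} {?Y -` A \<inter> space M |A. A \<in> boxes}"
  proof (rule indep_setI)
    have bm: "A \<in> sets skorokhod_space" if "A \<in> boxes" for A using that boxes_subset_sets by auto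
    show "{?X -` A \<inter> space M |A. A \<in> boxes} \<subseteq> events" "{?Y -` A \<inter> space M |A. A \<in> boxes} \<subseteq> events"
      using bm measurable_sets[OF Xm] measurable_sets[OF Ym] by auto
    fix A B assume "A \<in> {?X -` A \<inter> space M |A. A \<in> boxes}" "B \<in> {?Y -` A \<inter> space M |A. A \<in> boxes}"
    then obtain I a J b where I: "finite I" "I \<subseteq> {0..}" and J: "finite J" "J \<subseteq> {0..}"
      and A: "A = ?X -` {w \<in> space skorokhod_space. \<forall>i\<in>I. w i \<le> a i} \<inter> space M"
      and B: "B = ?Y -` {w \<in> space skorokhod_space. \<forall>j\<in>J. w j \<le> b j} \<inter> space M"
      unfolding boxes_def by blast
    have A': "A = {\<omega> \<in> space M. \<forall>i\<in>I. Z (min i K) \<omega> \<le> a i}"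
      unfolding A using I K cadlag_stop[OF path_cadlag K] by (auto simp: stop_def subset_eq)
    have B': "B = {\<omega> \<in> space M. \<forall>j\<in>J. Z (K + j) \<omega> - Z K \<omega> \<le> b j}"
      unfolding B using J K cadlag_shift[OF path_cadlag K] by (auto simp: shift_def subset_eq)
    have "A \<inter> B = {\<omega> \<in> space M. (\<forall>i\<in>I. Z (min i K) \<omega> \<le> a i) \<and> (\<forall>j\<in>J. Z (K + j) \<omega> - Z K \<omega> \<le> b j)}"
      unfolding A' B' by auto
    then show "prob (A \<inter> B) = prob A * prob B"
      using prob_stop_shift_boxes[OF K I J] by (simp add: A' B')
  qed
  from indep_set_sigma_sets[OF this stable stable] show ?thesis
    unfolding indep_var_eq using Xm Ym sig[OF Xm] sig[OF Ym] by simp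
qed

text \<open>The future after \<open>K\<close> may be replaced by an independent copy of the whole
  path. The joint form serves \<open>mgf_kap\<close>, where the level to be passed depends on the
  past.\<close>

lemma markov_fixed_time_joint:
  fixes H :: "(real \<Rightarrow> real) \<times> (real \<Rightarrow> real) \<Rightarrow> ennreal"
  assumes K: "0 \<le> K" and [measurable]: "H \<in> borel_measurable (skorokhod_space \<Otimes>\<^sub>M skorokhod_space)"
  shows "(\<integral>\<^sup>+\<omega>. H (stop K (path \<omega>), shift K (path \<omega>)) \<partial>M) =
    (\<integral>\<^sup>+\<omega>. (\<integral>\<^sup>+\<omega>'. H (stop K (path \<omega>), path \<omega>') \<partial>M) \<partial>M)"
proof -
  let ?X = "\<lambda>\<omega>. stop K (path \<omega>)" and ?Y = "\<lambda>\<omega>. shift K (path \<omega>)"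
  let ?D = "skorokhod_space"
  have [measurable]: "?X \<in> measurable M ?D" "?Y \<in> measurable M ?D" using K by measurable
  have eq: "distr M ?D ?X \<Otimes>\<^sub>M distr M ?D ?Y = distr M (?D \<Otimes>\<^sub>M ?D) (\<lambda>x. (?X x, ?Y x))"
    using stop_shift_indep[OF K] by (simp add: indep_var_distribution_eq)
  interpret Y: prob_space "distr M ?D ?Y" by (intro prob_space_distr) measurable
  have "(\<integral>\<^sup>+\<omega>. H (?X \<omega>, ?Y \<omega>) \<partial>M) = (\<integral>\<^sup>+p. H p \<partial>distr M (?D \<Otimes>\<^sub>M ?D) (\<lambda>x. (?X x, ?Y x)))"
    by (subst nn_integral_distr) auto
  also have "\<dots> = (\<integral>\<^sup>+x. \<integral>\<^sup>+y. H (x, y) \<partial>distr M ?D ?Y \<partial>distr M ?D ?X)"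
    unfolding eq[symmetric] by (subst Y.nn_integral_fst[symmetric]) auto
  also have "\<dots> = (\<integral>\<^sup>+\<omega>. (\<integral>\<^sup>+y. H (?X \<omega>, y) \<partial>distr M ?D ?Y) \<partial>M)"
    by (subst nn_integral_distr) (auto intro: Y.borel_measurable_nn_integral)
  also have "\<dots> = (\<integral>\<^sup>+\<omega>. (\<integral>\<^sup>+\<omega>'. H (?X \<omega>, path \<omega>') \<partial>M) \<partial>M)"
    unfolding shift_law[OF K]
  proof (rule nn_integral_cong)
    fix \<omega> assume "\<omega> \<in> space M"
    then have [measurable]: "?X \<omega> \<in> space ?D" using cadlag_stop[OF path_cadlag K] by simp
    show "(\<integral>\<^sup>+y. H (?X \<omega>, y) \<partial>distr M ?D path) = (\<integral>\<^sup>+\<omega>'. H (?X \<omega>, path \<omega>') \<partial>M)"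
      by (subst nn_integral_distr) auto
  qed
  finally show ?thesis .
qed

lemma markov_fixed_time:
  fixes F G :: "(real \<Rightarrow> real) \<Rightarrow> ennreal"
  assumes K: "0 \<le> K" and [measurable]: "F \<in> borel_measurable skorokhod_space" "G \<in> borel_measurable skorokhod_space"
  shows "(\<integral>\<^sup>+\<omega>. F (stop K (path \<omega>)) * G (shift K (path \<omega>)) \<partial>M) =
    (\<integral>\<^sup>+\<omega>. F (stop K (path \<omega>)) \<partial>M) * (\<integral>\<^sup>+\<omega>. G (path \<omega>) \<partial>M)"
proof -
  have [measurable]: "(\<lambda>\<omega>. stop K (path \<omega>)) \<in> measurable M skorokhod_space" using K by measurable
  show ?thesis
    using markov_fixed_time_joint[OF K, of "\<lambda>p. F (fst p) * G (snd p)"]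
    by (simp add: nn_integral_cmult nn_integral_multc)
qed

end

section \<open>The strong Markov property at passage times\<close>

lemma measurable_shift_at:
  assumes g[measurable]: "g \<in> borel_measurable skorokhod_space" and g0: "\<And>w. 0 \<le> g w"
  shows "(\<lambda>w. shift (g w) w) \<in> measurable skorokhod_space skorokhod_space"
proof (rule measurable_skorokhodI)
  show "(\<lambda>w. shift (g w) w t) \<in> borel_measurable skorokhod_space" if t: "0 \<le> t" for t
  proof -
    have *: "(\<lambda>w. w (max 0 (g w + r))) \<in> borel_measurable skorokhod_space" for r
      using measurable_compose[OF _ measurable_path_eval, of "\<lambda>w. (w, g w + r)" skorokhod_space] by simp
    show ?thesis using *[of t] *[of 0] t g0 by (simp add: shift_def max_absorb2)
  qed
  show "shift (g w) w \<in> space skorokhod_space" if "w \<in> space skorokhod_space" for w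
    using that g0 by (intro cadlag_shift) (auto simp: space_skorokhod)
qed

text \<open>
  A functional depends only on the path up to \<open>tau s\<close> if stopping the path at a later time does not
  change it (Galmarini's test); no filtration is needed.
\<close>

definition adapted :: "real \<Rightarrow> ((real \<Rightarrow> real) \<Rightarrow> 'c) \<Rightarrow> bool" where
  "adapted s F \<longleftrightarrow> (\<forall>w K. dies s w \<and> tau s w < K \<longrightarrow> F (stop K w) = F w)"

context spectrally_positive_up begin

text \<open>Split according to the grid cell \<open>A k\<close> that contains the passage time. On
  it the random grid time is the fixed time \<open>q (Suc k)\<close>, and both the cell and
  \<open>F\<close> depend only on the path stopped there, so the Markov property at fixed times
  applies to each cell.\<close>

lemma strong_markov_discrete:
  fixes F G :: "(real \<Rightarrow> real) \<Rightarrow> ennreal"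
  assumes s: "0 \<le> s" and ad: "adapted s F"
    and [measurable]: "F \<in> borel_measurable skorokhod_space" "G \<in> borel_measurable skorokhod_space"
  shows "(\<integral>\<^sup>+\<omega>. F (path \<omega>) * indicator {w. dies s w} (path \<omega>) * G (shift (grid_up n (tau s (path \<omega>))) (path \<omega>)) \<partial>M) =
    (\<integral>\<^sup>+\<omega>. F (path \<omega>) * indicator {w. dies s w} (path \<omega>) \<partial>M) * (\<integral>\<^sup>+\<omega>. G (path \<omega>) \<partial>M)"
proof -
  define q where "q k = real k / real (Suc n)" for k
  have q0: "0 \<le> q k" for k by (simp add: q_def)
  define A where "A k = {w. dies s w \<and> q k \<le> tau s w \<and> tau s w < q (Suc k)}" for k
  have [measurable]: "Measurable.pred skorokhod_space (\<lambda>w. w \<in> A k)" for k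
    unfolding A_def by simp
  have sh [measurable]: "(\<lambda>\<omega>. shift (q (Suc k)) (path \<omega>)) \<in> measurable M skorokhod_space" for k
    using q0 by measurable
  have qle: "q k \<le> q (Suc k)" for k by (simp add: q_def divide_right_mono)
  have A_stop: "stop (q (Suc k)) w \<in> A k \<longleftrightarrow> w \<in> A k" for k w
    using dies_tau_stop_iff[OF qle, of s k w] dies_tau_stop_iff[of "q (Suc k)" "q (Suc k)" s w]
    by (auto simp: A_def not_less[symmetric])
  have A_tau: "k = nat \<lfloor>tau s w * real (Suc n)\<rfloor>" if "w \<in> A k" for k w
  proof -
    have "real k \<le> tau s w * real (Suc n)" "tau s w * real (Suc n) < real k + 1"
      using that by (auto simp: A_def q_def divide_le_eq less_divide_eq)
    then have "\<lfloor>tau s w * real (Suc n)\<rfloor> = int k" by linarith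
    then show ?thesis by simp
  qed
  have disj: "disjoint_family A"
    unfolding disjoint_family_on_def using A_tau by (metis disjoint_iff)
  have cover: "\<exists>k. path \<omega> \<in> A k" if "\<omega> \<in> space M" "dies s (path \<omega>)" for \<omega>
  proof -
    let ?t = "tau s (path \<omega>)"
    have "0 \<le> ?t * real (Suc n)" using tau_nonneg[OF path_good[OF that(1)] that(2) s] by simp
    then have "real (nat \<lfloor>?t * real (Suc n)\<rfloor>) = of_int \<lfloor>?t * real (Suc n)\<rfloor>" by simp
    then have "real (nat \<lfloor>?t * real (Suc n)\<rfloor>) \<le> ?t * real (Suc n)"
      "?t * real (Suc n) < real (nat \<lfloor>?t * real (Suc n)\<rfloor>) + 1" by linarith+
    then have "path \<omega> \<in> A (nat \<lfloor>?t * real (Suc n)\<rfloor>)"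
      using that(2) by (simp add: A_def q_def divide_le_eq less_divide_eq) linarith
    then show ?thesis ..
  qed
  have sumA: "(\<Sum>k. f k * indicator (A k) (path \<omega>)) = h * indicator {w. dies s w} (path \<omega>)"
    if "\<omega> \<in> space M" "\<And>k. path \<omega> \<in> A k \<Longrightarrow> f k = h" for f :: "nat \<Rightarrow> ennreal" and h \<omega>
  proof (cases "dies s (path \<omega>)")
    case True
    from cover[OF that(1) True] obtain k where k: "path \<omega> \<in> A k" ..
    then show ?thesis using suminf_cmult_indicator[OF disj k, of f] that(2)[OF k] True by simp
  next
    case False then show ?thesis by (simp add: A_def)
  qed
  have "(\<integral>\<^sup>+\<omega>. F (path \<omega>) * indicator {w. dies s w} (path \<omega>) * G (shift (grid_up n (tau s (path \<omega>))) (path \<omega>)) \<partial>M) =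
    (\<integral>\<^sup>+\<omega>. (\<Sum>k. (F (stop (q (Suc k)) (path \<omega>)) * indicator (A k) (stop (q (Suc k)) (path \<omega>))) * G (shift (q (Suc k)) (path \<omega>))) \<partial>M)"
  proof (rule nn_integral_cong)
    fix \<omega> assume w: "\<omega> \<in> space M"
    have "(\<Sum>k. (F (stop (q (Suc k)) (path \<omega>)) * G (shift (q (Suc k)) (path \<omega>))) * indicator (A k) (path \<omega>)) =
      (F (path \<omega>) * G (shift (grid_up n (tau s (path \<omega>))) (path \<omega>))) * indicator {w. dies s w} (path \<omega>)"
    proof (rule sumA[OF w])
      fix k assume k: "path \<omega> \<in> A k"
      have "F (stop (q (Suc k)) (path \<omega>)) = F (path \<omega>)" using ad k by (simp add: adapted_def A_def)
      moreover have "q (Suc k) = grid_up n (tau s (path \<omega>))" using A_tau[OF k] by (simp add: q_def grid_up_def)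
      ultimately show "F (stop (q (Suc k)) (path \<omega>)) * G (shift (q (Suc k)) (path \<omega>)) =
        F (path \<omega>) * G (shift (grid_up n (tau s (path \<omega>))) (path \<omega>))" by simp
    qed
    then show "F (path \<omega>) * indicator {w. dies s w} (path \<omega>) * G (shift (grid_up n (tau s (path \<omega>))) (path \<omega>)) =
      (\<Sum>k. (F (stop (q (Suc k)) (path \<omega>)) * indicator (A k) (stop (q (Suc k)) (path \<omega>))) * G (shift (q (Suc k)) (path \<omega>)))"
      by (simp add: indicator_def A_stop ac_simps)
  qed
  also have "\<dots> = (\<Sum>k. \<integral>\<^sup>+\<omega>. (F (stop (q (Suc k)) (path \<omega>)) * indicator (A k) (stop (q (Suc k)) (path \<omega>))) * G (shift (q (Suc k)) (path \<omega>)) \<partial>M)"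
    using q0 by (intro nn_integral_suminf) measurable
  also have "\<dots> = (\<Sum>k. (\<integral>\<^sup>+\<omega>. F (stop (q (Suc k)) (path \<omega>)) * indicator (A k) (stop (q (Suc k)) (path \<omega>)) \<partial>M) * (\<integral>\<^sup>+\<omega>. G (path \<omega>) \<partial>M))"
    by (intro suminf_cong markov_fixed_time[where F = "\<lambda>w. F w * indicator (A _) w"] q0) measurable
  also have "\<dots> = (\<Sum>k. \<integral>\<^sup>+\<omega>. F (stop (q (Suc k)) (path \<omega>)) * indicator (A k) (stop (q (Suc k)) (path \<omega>)) \<partial>M) * (\<integral>\<^sup>+\<omega>. G (path \<omega>) \<partial>M)"
    by (rule ennreal_suminf_multc)
  also have "(\<Sum>k. \<integral>\<^sup>+\<omega>. F (stop (q (Suc k)) (path \<omega>)) * indicator (A k) (stop (q (Suc k)) (path \<omega>)) \<partial>M) =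
     (\<integral>\<^sup>+\<omega>. (\<Sum>k. F (stop (q (Suc k)) (path \<omega>)) * indicator (A k) (stop (q (Suc k)) (path \<omega>))) \<partial>M)"
    using q0 by (intro nn_integral_suminf[symmetric]) measurable
  also have "\<dots> = (\<integral>\<^sup>+\<omega>. F (path \<omega>) * indicator {w. dies s w} (path \<omega>) \<partial>M)"
  proof (rule nn_integral_cong)
    fix \<omega> assume w: "\<omega> \<in> space M"
    have "(\<Sum>k. F (stop (q (Suc k)) (path \<omega>)) * indicator (A k) (path \<omega>)) = F (path \<omega>) * indicator {w. dies s w} (path \<omega>)"
      by (rule sumA[OF w]) (use ad in \<open>simp add: adapted_def A_def\<close>)
    then show "(\<Sum>k. F (stop (q (Suc k)) (path \<omega>)) * indicator (A k) (stop (q (Suc k)) (path \<omega>))) =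
        F (path \<omega>) * indicator {w. dies s w} (path \<omega>)"
      by (simp add: indicator_def A_stop)
  qed
  finally show ?thesis .
qed

text \<open>The grid times decrease to the passage time, but the limit needs a functional that is
  continuous along right-continuous paths. Products of ramps of finitely many coordinates are; they
  converge to indicators of boxes, and these determine a finite measure. The bound on
  \<open>F\<close> supplies the dominating function.\<close>

lemma strong_markov:
  fixes F G :: "(real \<Rightarrow> real) \<Rightarrow> ennreal"
  assumes s: "0 \<le> s" and ad: "adapted s F" and F1: "\<And>w. F w \<le> 1"
    and Fm [measurable]: "F \<in> borel_measurable skorokhod_space" and Gm [measurable]: "G \<in> borel_measurable skorokhod_space"
  shows "(\<integral>\<^sup>+\<omega>. F (path \<omega>) * indicator {w. dies s w} (path \<omega>) * G (shift (tau s (path \<omega>)) (path \<omega>)) \<partial>M) =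
    (\<integral>\<^sup>+\<omega>. F (path \<omega>) * indicator {w. dies s w} (path \<omega>) \<partial>M) * (\<integral>\<^sup>+\<omega>. G (path \<omega>) \<partial>M)"
proof -
  define E where "E \<omega> = F (path \<omega>) * indicator {w. dies s w} (path \<omega>)" for \<omega>
  \<comment> \<open>Where the level is never passed, \<open>tau\<close> may be negative; clipping
    makes the shift meaningful everywhere, and \<open>E\<close> vanishes on those paths.\<close>
  define T where "T w = max 0 (tau s w)" for w
  have [measurable]: "T \<in> borel_measurable skorokhod_space" unfolding T_def[abs_def] by measurable
  have [measurable]: "E \<in> borel_measurable M" unfolding E_def[abs_def] by measurable
  have sh [measurable]: "(\<lambda>w. shift (T w) w) \<in> measurable skorokhod_space skorokhod_space"
    by (rule measurable_shift_at) (auto simp: T_def)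
  have shu [measurable]: "(\<lambda>w. shift (grid_up n (tau s w)) w) \<in> measurable skorokhod_space skorokhod_space" for n
    by (rule measurable_shift_at) (auto simp: grid_up_nonneg)
  have E1: "E \<omega> \<le> 1" for \<omega> unfolding E_def using F1 by (auto split: split_indicator)
  have Efin: "E \<omega> < \<top>" for \<omega> using E1[of \<omega>] by (rule le_less_trans) simp
  have E0: "E \<omega> = 0" if "\<not> dies s (path \<omega>)" for \<omega> using that by (simp add: E_def)
  have Tt: "T (path \<omega>) = tau s (path \<omega>)" if "\<omega> \<in> space M" "dies s (path \<omega>)" for \<omega>
    using tau_nonneg[OF path_good[OF that(1)] that(2) s] by (simp add: T_def)
  define c where "c = (\<integral>\<^sup>+\<omega>. E \<omega> \<partial>M)"
  have "c \<le> (\<integral>\<^sup>+\<omega>. 1 \<partial>M)" unfolding c_def by (rule nn_integral_mono) (rule E1)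
  then have c1: "c \<le> 1" by (simp add: emeasure_space_1)
  then have cfin: "c < \<top>" by (rule le_less_trans) simp
  have one: "(\<integral>\<^sup>+\<omega>. 1 \<partial>M) < \<infinity>" by (simp add: emeasure_space_1)
  have box: "(\<integral>\<^sup>+\<omega>. E \<omega> * indicator A (shift (T (path \<omega>)) (path \<omega>)) \<partial>M) = c * (\<integral>\<^sup>+\<omega>. indicator A (path \<omega>) \<partial>M)"
    if A: "A \<in> boxes" for A
  proof -
    obtain J b where J: "finite J" "J \<subseteq> {0..}" and Aeq: "A = {w \<in> space skorokhod_space. \<forall>j\<in>J. w j \<le> b j}"
      using A by (auto simp: boxes_def)
    define G where "G m w = ennreal (\<Prod>j\<in>J. ramp (real m) (w j - b j))" for m :: nat and w
    have [measurable]: "G m \<in> borel_measurable skorokhod_space" for m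
      unfolding G_def[abs_def] using J
      by (intro measurable_compose[OF _ measurable_ennreal] borel_measurable_prod measurable_compose[OF _ ramp_measurable]
          borel_measurable_diff measurable_skorokhod_eval) auto
    have G1: "G m w \<le> 1" for m w
      unfolding G_def using prod_le_1[of J "\<lambda>j. ramp (real m) (w j - b j)"] by (simp add: ramp_bounds)
    have EG1: "E \<omega> * G m w \<le> 1" for m w \<omega> using mult_mono[OF E1 G1] by simp
    have lim1: "(\<integral>\<^sup>+\<omega>. E \<omega> * G m (shift (T (path \<omega>)) (path \<omega>)) \<partial>M) = c * (\<integral>\<^sup>+\<omega>. G m (path \<omega>) \<partial>M)" for m
    proof -
      have "(\<lambda>n. \<integral>\<^sup>+\<omega>. E \<omega> * G m (shift (grid_up n (tau s (path \<omega>))) (path \<omega>)) \<partial>M) \<longlonglongrightarrow>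
          (\<integral>\<^sup>+\<omega>. E \<omega> * G m (shift (T (path \<omega>)) (path \<omega>)) \<partial>M)"
      proof (rule nn_integral_dominated_convergence[where w = "\<lambda>_. 1", OF _ _ _ _ one])
        show "AE \<omega> in M. (\<lambda>n. E \<omega> * G m (shift (grid_up n (tau s (path \<omega>))) (path \<omega>))) \<longlonglongrightarrow> E \<omega> * G m (shift (T (path \<omega>)) (path \<omega>))"
        proof (rule AE_I2)
          fix \<omega> assume w: "\<omega> \<in> space M"
          show "(\<lambda>n. E \<omega> * G m (shift (grid_up n (tau s (path \<omega>))) (path \<omega>))) \<longlonglongrightarrow> E \<omega> * G m (shift (T (path \<omega>)) (path \<omega>))"
          proof (cases "dies s (path \<omega>)")
            case False then show ?thesis by (simp add: E0)
          next
            case True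
            let ?t = "tau s (path \<omega>)"
            have t0: "0 \<le> ?t" by (rule tau_nonneg[OF path_good[OF w] True s])
            have c: "cadlag (path \<omega>)" by (rule path_cadlag[OF w])
            note up = grid_up_at_right[OF t0]
            have "(\<lambda>n. path \<omega> (grid_up n (tau s (path \<omega>)) + j)) \<longlonglongrightarrow> path \<omega> (?t + j)" if "0 \<le> j" for j
            proof -
              have "filterlim (\<lambda>n. j + grid_up n (tau s (path \<omega>))) (at_right (j + ?t)) sequentially"
                by (rule filterlim_compose[OF filterlim_plus_at_right up])
              from filterlim_compose[OF cadlag_right[OF c, of "j + ?t"] this] that t0
              show ?thesis by (simp add: add.commute)
            qed
            from this this[of 0] have "(\<lambda>n. shift (grid_up n (tau s (path \<omega>))) (path \<omega>) j) \<longlonglongrightarrow> shift (T (path \<omega>)) (path \<omega>) j"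
              if "j \<in> J" for j
              using that J(2) Tt[OF w True] by (auto simp: shift_def intro!: tendsto_diff)
            then have "(\<lambda>n. G m (shift (grid_up n (tau s (path \<omega>))) (path \<omega>))) \<longlonglongrightarrow> G m (shift (T (path \<omega>)) (path \<omega>))"
              unfolding G_def by (intro tendsto_ennrealI tendsto_prod ramp_tendsto tendsto_diff tendsto_const)
            then show ?thesis by (intro ennreal_tendsto_cmult) (use Efin in auto)
          qed
        qed
      qed (use EG1 in auto)
      moreover have "(\<integral>\<^sup>+\<omega>. E \<omega> * G m (shift (grid_up n (tau s (path \<omega>))) (path \<omega>)) \<partial>M) = c * (\<integral>\<^sup>+\<omega>. G m (path \<omega>) \<partial>M)" for n
        unfolding E_def c_def by (rule strong_markov_discrete[OF s ad]) measurable
      ultimately show ?thesis by (simp add: LIMSEQ_const_iff)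
    qed
    have Glim: "(\<lambda>m. G m w) \<longlonglongrightarrow> indicator A w" if "w \<in> space skorokhod_space" for w
    proof -
      have "(\<lambda>m. G m w) \<longlonglongrightarrow> ennreal (\<Prod>j\<in>J. indicator {..0} (w j - b j))"
        unfolding G_def by (intro tendsto_ennrealI tendsto_prod ramp_tendsto_indicator)
      also have "(\<Prod>j\<in>J. indicator {..0} (w j - b j) :: real) = indicator A w"
        using that J(1) by (auto simp: Aeq indicator_def)
      finally show ?thesis by (simp add: ennreal_indicator)
    qed
    have [measurable]: "A \<in> sets skorokhod_space" using A boxes_subset_sets by auto
    have "(\<lambda>m. \<integral>\<^sup>+\<omega>. E \<omega> * G m (shift (T (path \<omega>)) (path \<omega>)) \<partial>M) \<longlonglongrightarrow>
        (\<integral>\<^sup>+\<omega>. E \<omega> * indicator A (shift (T (path \<omega>)) (path \<omega>)) \<partial>M)"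
    proof (rule nn_integral_dominated_convergence[where w = "\<lambda>_. 1", OF _ _ _ _ one])
      show "AE \<omega> in M. (\<lambda>m. E \<omega> * G m (shift (T (path \<omega>)) (path \<omega>))) \<longlonglongrightarrow> E \<omega> * indicator A (shift (T (path \<omega>)) (path \<omega>))"
        using Efin measurable_space[OF sh] path_in_space
        by (intro AE_I2 ennreal_tendsto_cmult Glim) auto
    qed (use EG1 in auto)
    moreover have "(\<lambda>m. c * (\<integral>\<^sup>+\<omega>. G m (path \<omega>) \<partial>M)) \<longlonglongrightarrow> c * (\<integral>\<^sup>+\<omega>. indicator A (path \<omega>) \<partial>M)"
    proof (rule ennreal_tendsto_cmult[OF cfin])
      show "(\<lambda>m. \<integral>\<^sup>+\<omega>. G m (path \<omega>) \<partial>M) \<longlonglongrightarrow> (\<integral>\<^sup>+\<omega>. indicator A (path \<omega>) \<partial>M)"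
      proof (rule nn_integral_dominated_convergence[where w = "\<lambda>_. 1", OF _ _ _ _ one])
        show "AE \<omega> in M. (\<lambda>m. G m (path \<omega>)) \<longlonglongrightarrow> indicator A (path \<omega>)"
          using path_in_space by (intro AE_I2 Glim)
      qed (use G1 in auto)
    qed
    ultimately show ?thesis unfolding lim1 by (rule LIMSEQ_unique)
  qed
  \<comment> \<open>Both sides of the claim, as functions of \<open>G\<close>, are integrals against
    finite measures; it remains to see that these agree on boxes.\<close>
  let ?P = "distr (density M E) skorokhod_space (\<lambda>\<omega>. shift (T (path \<omega>)) (path \<omega>))"
  let ?Q = "density (distr M skorokhod_space path) (\<lambda>_. c)"
  have "?P = ?Q"
  proof (rule measure_eq_boxes)
    show "finite_measure ?P"
    proof (rule finite_measure.finite_measure_distr)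
      show "finite_measure (density M E)"
        by (rule finite_measureI) (use cfin in \<open>simp add: emeasure_density c_def[symmetric] cong: nn_integral_cong\<close>)
    qed measurable
    fix A assume A: "A \<in> boxes"
    then have [measurable]: "A \<in> sets skorokhod_space" using boxes_subset_sets by auto
    have "emeasure ?P A = (\<integral>\<^sup>+\<omega>. E \<omega> * indicator A (shift (T (path \<omega>)) (path \<omega>)) \<partial>M)"
      by (subst nn_integral_indicator[symmetric], simp)
         (subst nn_integral_distr, simp_all add: nn_integral_density)
    also note box[OF A]
    also have "(\<integral>\<^sup>+\<omega>. indicator A (path \<omega>) \<partial>M) = emeasure (distr M skorokhod_space path) A"
      by (subst nn_integral_indicator[symmetric], simp) (subst nn_integral_distr, simp_all)
    also have "c * \<dots> = emeasure ?Q A"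
      by (simp add: emeasure_density nn_integral_distr nn_integral_cmult)
    finally show "emeasure ?P A = emeasure ?Q A" .
  qed auto
  have "(\<integral>\<^sup>+\<omega>. E \<omega> * G (shift (tau s (path \<omega>)) (path \<omega>)) \<partial>M) = (\<integral>\<^sup>+\<omega>. E \<omega> * G (shift (T (path \<omega>)) (path \<omega>)) \<partial>M)"
    by (rule nn_integral_cong) (metis E0 Tt mult_zero_left)
  also have "\<dots> = (\<integral>\<^sup>+w. G w \<partial>?P)"
    by (simp add: nn_integral_distr nn_integral_density)
  also have "\<dots> = (\<integral>\<^sup>+w. G w \<partial>?Q)" using \<open>?P = ?Q\<close> by simp
  also have "\<dots> = c * (\<integral>\<^sup>+\<omega>. G (path \<omega>) \<partial>M)"
    by (simp add: nn_integral_density nn_integral_distr nn_integral_cmult)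
  finally show ?thesis unfolding E_def c_def .
qed

end

section \<open>Passage times, exponential moments and the constant \<open>\<kappa>\<close>\<close>

text \<open>A positive infimum leaves a margin \<open>x / (n + 1)\<close>, whereas
  \<open>\<not> dies x\<close> alone would allow the infimum to be 0. Hence the union over levels
  strictly below \<open>x\<close>.\<close>

lemma stays_positive_eq:
  fixes Z :: "real \<Rightarrow> 'a \<Rightarrow> real"
  assumes x: "0 < x"
  shows "stays_positive M Z x = (\<Union>n. {\<omega> \<in> space M. \<not> dies (x - x / real (Suc n)) (\<lambda>t\<in>{0..}. Z t \<omega>)})"
proof (intro set_eqI iffI)
  fix \<omega> assume "\<omega> \<in> stays_positive M Z x"
  then have w: "\<omega> \<in> space M" and i: "0 < (INF t\<in>{0..}. ereal (x + Z t \<omega>))" by (auto simp: stays_positive_def)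
  obtain e where e: "0 < ereal e" "ereal e < (INF t\<in>{0..}. ereal (x + Z t \<omega>))"
    using ereal_dense2[OF i] by auto
  have le: "e \<le> x + Z t \<omega>" if "0 \<le> t" for t
  proof -
    have "(INF t\<in>{0..}. ereal (x + Z t \<omega>)) \<le> ereal (x + Z t \<omega>)" using that by (intro INF_lower) auto
    with e(2) have "ereal e < ereal (x + Z t \<omega>)" by (rule less_le_trans)
    then show ?thesis by simp
  qed
  obtain n where n: "x / e < real (Suc n)" using reals_Archimedean2 by (meson less_Suc_eq of_nat_less_iff order_less_trans lessI)
  then have "x / real (Suc n) < e" using e x by (simp add: divide_less_eq mult.commute)
  then have "\<not> dies (x - x / real (Suc n)) (\<lambda>t\<in>{0..}. Z t \<omega>)" using le by (force simp: dies_def)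
  then show "\<omega> \<in> (\<Union>n. {\<omega> \<in> space M. \<not> dies (x - x / real (Suc n)) (\<lambda>t\<in>{0..}. Z t \<omega>)})" using w by auto
next
  fix \<omega> assume "\<omega> \<in> (\<Union>n. {\<omega> \<in> space M. \<not> dies (x - x / real (Suc n)) (\<lambda>t\<in>{0..}. Z t \<omega>)})"
  then obtain n where w: "\<omega> \<in> space M" and n: "\<not> dies (x - x / real (Suc n)) (\<lambda>t\<in>{0..}. Z t \<omega>)" by auto
  have "ereal (x / real (Suc n)) \<le> (INF t\<in>{0..}. ereal (x + Z t \<omega>))"
    using n by (intro INF_greatest) (force simp: dies_def not_less)
  moreover have "0 < ereal (x / real (Suc n))" using x by simp
  ultimately have "0 < (INF t\<in>{0..}. ereal (x + Z t \<omega>))" by (rule less_le_trans[rotated])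
  then show "\<omega> \<in> stays_positive M Z x" using w by (simp add: stays_positive_def)
qed

context spectrally_positive_up begin

definition lap :: "real \<Rightarrow> real \<Rightarrow> real" where
  "lap q s = (\<integral>\<omega>. indicator {w. dies s w} (path \<omega>) * exp (- q * tau s (path \<omega>)) \<partial>M)"

text \<open>Built on passage strictly below the level; \<open>passage_exponent_eq\<close> shows that
  it is \<Phi>, which is defined through the hitting time of the level.\<close>

definition phi :: "real \<Rightarrow> real" where
  "phi q = - ln (lap q 1)"

lemma tau_path_nonneg: "\<omega> \<in> space M \<Longrightarrow> dies s (path \<omega>) \<Longrightarrow> 0 \<le> s \<Longrightarrow> 0 \<le> tau s (path \<omega>)"
  by (rule tau_nonneg[OF path_good])

lemma lap_integrable:
  assumes "0 \<le> q" "0 \<le> s"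
  shows "integrable M (\<lambda>\<omega>. indicator {w. dies s w} (path \<omega>) * exp (- q * tau s (path \<omega>)))"
proof (rule integrable_const_bound[where B = 1])
  show "AE \<omega> in M. norm (indicator {w. dies s w} (path \<omega>) * exp (- q * tau s (path \<omega>))) \<le> 1"
    using tau_path_nonneg assms by (intro AE_I2) (auto split: split_indicator)
qed measurable

lemma nn_lap:
  assumes "0 \<le> q" "0 \<le> s"
  shows "(\<integral>\<^sup>+\<omega>. indicator {w. dies s w} (path \<omega>) * ennreal (exp (- q * tau s (path \<omega>))) \<partial>M) = ennreal (lap q s)"
  unfolding lap_def
  by (subst nn_integral_eq_integral[symmetric, OF lap_integrable[OF assms]])
    (auto intro!: nn_integral_cong simp: ennreal_mult ennreal_indicator[symmetric])

lemma lap_nonneg: "0 \<le> lap q s"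
  unfolding lap_def by (rule integral_nonneg_AE) auto

lemma lap_le_1:
  assumes "0 \<le> q" "0 \<le> s" shows "lap q s \<le> 1"
proof -
  have "lap q s \<le> (\<integral>\<omega>. 1 \<partial>M)" unfolding lap_def
    by (rule integral_mono[OF lap_integrable[OF assms]])
      (use tau_path_nonneg assms in \<open>auto split: split_indicator\<close>)
  then show ?thesis by (simp add: prob_space)
qed

text \<open>The strong Markov property at level \<open>s\<close>, with passage times and passage
  events splitting as in \<open>tau_add\<close> and \<open>dies_add\<close>.\<close>

lemma lap_add:
  assumes q: "0 \<le> q" and s: "0 \<le> s" and r: "0 \<le> r"
  shows "lap q (s + r) = lap q s * lap q r"
proof -
  \<comment> \<open>The minimum is inactive where the level is passed, as the passage time is
    nonnegative there; it gives the bound by 1 on all paths that \<open>strong_markov\<close> asks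
    for.\<close>
  define F where "F w = ennreal (min 1 (exp (- q * tau s w)))" for w
  define G where "G w = indicator {w. dies r w} w * ennreal (exp (- q * tau r w))" for w
  have [measurable]: "F \<in> borel_measurable skorokhod_space" unfolding F_def[abs_def] by measurable
  have [measurable]: "G \<in> borel_measurable skorokhod_space" unfolding G_def[abs_def] by measurable
  have "ennreal (lap q (s + r)) =
      (\<integral>\<^sup>+\<omega>. F (path \<omega>) * indicator {w. dies s w} (path \<omega>) * G (shift (tau s (path \<omega>)) (path \<omega>)) \<partial>M)"
    unfolding nn_lap[OF q add_nonneg_nonneg[OF s r], symmetric]
  proof (rule nn_integral_cong)
    fix \<omega> assume w: "\<omega> \<in> space M"
    note g = path_good[OF w]
    show "indicator {w. dies (s + r) w} (path \<omega>) * ennreal (exp (- q * tau (s + r) (path \<omega>))) =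
        F (path \<omega>) * indicator {w. dies s w} (path \<omega>) * G (shift (tau s (path \<omega>)) (path \<omega>))"
    proof (cases "dies (s + r) (path \<omega>)")
      case True
      then have d: "dies s (path \<omega>)" "dies r (shift (tau s (path \<omega>)) (path \<omega>))"
        using dies_add[OF g s r] by auto
      have "exp (- q * tau s (path \<omega>)) \<le> 1" using q tau_path_nonneg[OF w d(1) s] by simp
      then show ?thesis using True d tau_add[OF g s r True]
        by (simp add: F_def G_def ennreal_mult[symmetric] exp_add[symmetric] algebra_simps min_absorb2)
    next
      case False
      then show ?thesis using dies_add[OF g s r] by (auto simp: G_def split: split_indicator)
    qed
  qed
  also have "\<dots> = (\<integral>\<^sup>+\<omega>. F (path \<omega>) * indicator {w. dies s w} (path \<omega>) \<partial>M) * (\<integral>\<^sup>+\<omega>. G (path \<omega>) \<partial>M)"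
  proof (rule strong_markov[OF s])
    show "adapted s F" by (simp add: adapted_def F_def tau_stop)
    show "F w \<le> 1" for w unfolding F_def by simp
  qed measurable
  also have "(\<integral>\<^sup>+\<omega>. F (path \<omega>) * indicator {w. dies s w} (path \<omega>) \<partial>M) = ennreal (lap q s)"
    unfolding nn_lap[OF q s, symmetric]
    by (rule nn_integral_cong)
      (use tau_path_nonneg[OF _ _ s] q in \<open>auto simp: F_def min_absorb2 split: split_indicator\<close>)
  also have "(\<integral>\<^sup>+\<omega>. G (path \<omega>) \<partial>M) = ennreal (lap q r)"
    unfolding nn_lap[OF q r, symmetric] G_def ..
  finally show ?thesis by (simp add: ennreal_mult[symmetric] lap_nonneg)
qed

text \<open>A zero at one level would, by multiplicativity, give zeros at arbitrarily often halved
  levels. Then almost surely no level however small would be passed, against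
  \<open>Z_dies\<close>.\<close>

lemma lap_pos:
  assumes q: "0 \<le> q" and s: "0 \<le> s" shows "0 < lap q s"
proof (rule ccontr)
  assume "\<not> 0 < lap q s"
  \<comment> \<open>Going to \<open>s + 1\<close> ensures that a positive level is halved.\<close>
  then have z: "lap q (s + 1) = 0" using lap_add[OF q s, of 1] lap_nonneg[of q s] by simp
  have half: "lap q ((s + 1) / 2 ^ n) = 0" for n :: nat
  proof (induction n)
    case (Suc n)
    have "lap q ((s + 1) / 2 ^ Suc n + (s + 1) / 2 ^ Suc n) = lap q ((s + 1) / 2 ^ Suc n) * lap q ((s + 1) / 2 ^ Suc n)"
      using q s by (intro lap_add) auto
    moreover have "(s + 1) / 2 ^ Suc n + (s + 1) / 2 ^ Suc n = (s + 1) / 2 ^ n" by (simp add: field_simps)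
    ultimately show ?case using Suc by simp
  qed (simp add: z)
  have "AE \<omega> in M. \<not> dies ((s + 1) / 2 ^ n) (path \<omega>)" for n :: nat
  proof -
    have "(\<integral>\<^sup>+\<omega>. indicator {w. dies ((s + 1) / 2 ^ n) w} (path \<omega>) * ennreal (exp (- q * tau ((s + 1) / 2 ^ n) (path \<omega>))) \<partial>M) = 0"
      using nn_lap[OF q, of "(s + 1) / 2 ^ n"] half[of n] s by simp
    then have "AE \<omega> in M. indicator {w. dies ((s + 1) / 2 ^ n) w} (path \<omega>) * ennreal (exp (- q * tau ((s + 1) / 2 ^ n) (path \<omega>))) = 0"
      by (subst (asm) nn_integral_0_iff_AE) auto
    then show ?thesis by eventually_elim (auto split: split_indicator_asm)
  qed
  then have "AE \<omega> in M. \<forall>n. \<not> dies ((s + 1) / 2 ^ n) (path \<omega>)" by (simp add: AE_all_countable)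
  then have "AE \<omega> in M. \<omega> \<notin> {\<omega> \<in> space M. dies 0 (\<lambda>t. Z t \<omega>)}"
  proof eventually_elim
    case (elim \<omega>)
    show ?case
    proof
      assume "\<omega> \<in> {\<omega> \<in> space M. dies 0 (\<lambda>t. Z t \<omega>)}"
      then obtain t where t: "0 \<le> t" "Z t \<omega> < 0" by (auto simp: dies_def)
      obtain n where n: "(s + 1) / - Z t \<omega> < 2 ^ n" using real_arch_pow[of 2] by auto
      then have "(s + 1) / 2 ^ n < - Z t \<omega>" using t s by (simp add: field_simps)
      then have "dies ((s + 1) / 2 ^ n) (path \<omega>)" using t by (auto simp: dies_def intro!: exI[of _ t])
      with elim show False by blast
    qed
  qed
  moreover have "{\<omega> \<in> space M. dies 0 (\<lambda>t. Z t \<omega>)} = {\<omega> \<in> space M. dies 0 (path \<omega>)}"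
    by (auto simp: dies_def)
  moreover have "{\<omega> \<in> space M. dies 0 (path \<omega>)} \<in> events" by measurable
  ultimately have "prob {\<omega> \<in> space M. dies 0 (\<lambda>t. Z t \<omega>)} = 0"
    by (simp add: prob_eq_0)
  with Z_dies show False by simp
qed

text \<open>Cauchy's functional equation for the logarithm, which is bounded above by 0. At level 0
  the value is idempotent and positive, hence 1.\<close>

lemma lap_exp:
  assumes q: "0 \<le> q" and s: "0 \<le> s" shows "lap q s = exp (- s * phi q)"
proof (cases "s = 0")
  case True
  have "lap q 0 = lap q 0 * lap q 0" using lap_add[OF q, of 0 0] by simp
  then show ?thesis using lap_pos[OF q, of 0] True by simp
next
  case False
  then have s: "0 < s" using s by simp
  have "ln (lap q s) = s * ln (lap q 1)"
  proof (rule additive_bounded_above_linear[where B = 0, OF _ _ s])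
    show "ln (lap q (s + t)) = ln (lap q s) + ln (lap q t)" if "0 < s" "0 < t" for s t
      using that lap_add[OF q, of s t] lap_pos[OF q, of s] lap_pos[OF q, of t] by (simp add: ln_mult)
    show "ln (lap q t) \<le> 0" if "0 < t" "t \<le> 1" for t
      using that lap_le_1[OF q, of t] lap_pos[OF q, of t] by simp
  qed
  then have "lap q s = exp (s * ln (lap q 1))" using lap_pos[OF q, of s] s by (metis exp_ln less_imp_le)
  then show ?thesis by (simp add: phi_def)
qed

lemma phi_nonneg: "0 \<le> q \<Longrightarrow> 0 \<le> phi q"
  using lap_le_1[of q 1] lap_pos[of q 1] by (simp add: phi_def)

lemma phi_mono:
  assumes "0 \<le> p" "p \<le> q" shows "phi p \<le> phi q"
proof -
  have "lap q 1 \<le> lap p 1"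
    unfolding lap_def
    by (rule integral_mono[OF lap_integrable lap_integrable])
      (use assms tau_path_nonneg[of _ 1] in \<open>auto split: split_indicator simp: mult_right_mono\<close>)
  then show ?thesis using lap_pos[of q 1] lap_pos[of p 1] assms by (simp add: phi_def)
qed

text \<open>Passing level 1 takes positive time and has positive probability, so a positive
  \<open>q\<close> strictly lowers the transform. The gap makes early passages of remote levels
  negligible in \<open>mgf_kap\<close>.\<close>

lemma phi_strict:
  assumes q: "0 < q" shows "phi 0 < phi q"
proof -
  have "lap q 1 \<noteq> lap 0 1"
  proof
    assume eq: "lap q 1 = lap 0 1"
    let ?f = "\<lambda>q \<omega>. indicator {w. dies 1 w} (path \<omega>) * exp (- q * tau 1 (path \<omega>)) :: real"
    have i: "integrable M (?f 0)" "integrable M (?f q)"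
      using lap_integrable[of 0 1] lap_integrable[of q 1] q by auto
    have "(\<integral>\<omega>. ?f 0 \<omega> - ?f q \<omega> \<partial>M) = lap 0 1 - lap q 1"
      unfolding lap_def by (rule Bochner_Integration.integral_diff[OF i])
    then have "(\<integral>\<omega>. ?f 0 \<omega> - ?f q \<omega> \<partial>M) = 0" using eq by simp
    moreover have "AE \<omega> in M. 0 \<le> ?f 0 \<omega> - ?f q \<omega>"
      using q tau_path_nonneg[of _ 1] by (intro AE_I2) (auto split: split_indicator)
    ultimately have "AE \<omega> in M. ?f 0 \<omega> - ?f q \<omega> = 0"
      using integral_nonneg_eq_0_iff_AE[OF Bochner_Integration.integrable_diff[OF i]] by simp
    then have "AE \<omega> in M. ?f 0 \<omega> = 0"
    proof (rule AE_mp, intro AE_I2 impI)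
      fix \<omega> assume w: "\<omega> \<in> space M" and e: "?f 0 \<omega> - ?f q \<omega> = 0"
      show "?f 0 \<omega> = 0"
      proof (cases "dies 1 (path \<omega>)")
        case True
        have "0 < tau 1 (path \<omega>)" by (rule tau_pos[OF path_good[OF w] True]) simp
        then show ?thesis using e q True by (auto simp: mult_less_0_iff)
      qed auto
    qed
    then have "lap 0 1 = 0" unfolding lap_def by (rule integral_eq_zero_AE)
    with lap_pos[of 0 1] show False by simp
  qed
  moreover have "lap q 1 = exp (- phi q)" "lap 0 1 = exp (- phi 0)"
    using lap_exp[of q 1] lap_exp[of 0 1] q by auto
  ultimately show ?thesis using phi_mono[of 0 q] q by simp
qed

lemma phi_at_top: "filterlim phi at_top at_top"
  unfolding filterlim_at_top
proof
  fix B
  let ?f = "\<lambda>q \<omega>. indicator {w. dies 1 w} (path \<omega>) * exp (- q * tau 1 (path \<omega>)) :: real"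
  have "(\<lambda>n. \<integral>\<omega>. ?f (real n) \<omega> \<partial>M) \<longlonglongrightarrow> (\<integral>\<omega>. 0 \<partial>M)"
  proof (rule integral_dominated_convergence[where w = "\<lambda>_. 1"])
    show "AE \<omega> in M. (\<lambda>n. ?f (real n) \<omega>) \<longlonglongrightarrow> 0"
    proof (rule AE_I2)
      fix \<omega> assume w: "\<omega> \<in> space M"
      show "(\<lambda>n. ?f (real n) \<omega>) \<longlonglongrightarrow> 0"
      proof (cases "dies 1 (path \<omega>)")
        case True
        have "0 < tau 1 (path \<omega>)" by (rule tau_pos[OF path_good[OF w] True]) simp
        then have "(\<lambda>n. exp (- real n * tau 1 (path \<omega>))) \<longlonglongrightarrow> 0"
          by (intro filterlim_compose[OF exp_at_bot])
            (auto simp: filterlim_uminus_at_bot intro!: filterlim_at_top_mult_tendsto_pos[OF tendsto_const _ filterlim_real_sequentially] filterlim_tendsto_pos_mult_at_top)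
        then show ?thesis using True by simp
      qed simp
    qed
    show "AE \<omega> in M. norm (?f (real n) \<omega>) \<le> 1" for n
      using tau_path_nonneg[of _ 1] by (intro AE_I2) (auto split: split_indicator)
  qed auto
  then have "(\<lambda>n. lap (real n) 1) \<longlonglongrightarrow> 0" by (simp add: lap_def)
  then have "eventually (\<lambda>n. lap (real n) 1 < exp (- B)) sequentially"
    by (rule order_tendstoD) simp
  then obtain n where "lap (real n) 1 < exp (- B)" by (auto simp: eventually_sequentially)
  then have "B \<le> phi (real n)" using lap_exp[of "real n" 1] by simp
  then show "eventually (\<lambda>q. B \<le> phi q) at_top"
    unfolding eventually_at_top_linorder
    by (intro exI[of _ "real n"] allI impI) (meson phi_mono of_nat_0_le_iff order_trans)
qed

text \<open>This is \<open>E[X powr \<theta>] \<le> (E X) powr \<theta>\<close> for the discounted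
  passage indicator \<open>X\<close>, obtained by integrating Young's inequality with weight
  \<open>m = E X\<close>. It replaces \<open>phi (\<theta> / x)\<close> by
  \<open>\<theta> * phi (1 / x)\<close>, a loss of a factor close to 1.\<close>

lemma phi_scale:
  assumes th: "0 < \<theta>" "\<theta> < 1" and q: "0 \<le> q"
  shows "\<theta> * phi q \<le> phi (\<theta> * q)"
proof -
  let ?f = "\<lambda>q \<omega>. indicator {w. dies 1 w} (path \<omega>) * exp (- q * tau 1 (path \<omega>)) :: real"
  define m where "m = lap q 1"
  have m: "0 < m" unfolding m_def using q by (intro lap_pos) auto
  have i: "integrable M (?f q)" "integrable M (?f (\<theta> * q))"
    using lap_integrable[of q 1] lap_integrable[of "\<theta> * q" 1] q th by auto
  have "lap (\<theta> * q) 1 * m powr (1 - \<theta>) = (\<integral>\<omega>. ?f (\<theta> * q) \<omega> * m powr (1 - \<theta>) \<partial>M)"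
    unfolding lap_def by simp
  also have "\<dots> \<le> (\<integral>\<omega>. \<theta> * ?f q \<omega> + (1 - \<theta>) * m \<partial>M)"
  proof (rule integral_mono)
    show "integrable M (\<lambda>\<omega>. ?f (\<theta> * q) \<omega> * m powr (1 - \<theta>))" using i(2) by simp
    show "integrable M (\<lambda>\<omega>. \<theta> * ?f q \<omega> + (1 - \<theta>) * m)" using i(1) by simp
    fix \<omega>
    show "?f (\<theta> * q) \<omega> * m powr (1 - \<theta>) \<le> \<theta> * ?f q \<omega> + (1 - \<theta>) * m"
    proof (cases "dies 1 (path \<omega>)")
      case True
      have "exp (- (\<theta> * q) * tau 1 (path \<omega>)) = exp (- q * tau 1 (path \<omega>)) powr \<theta>"
        by (simp add: powr_def algebra_simps)
      then show ?thesis
        using Youngs_inequality_0[of \<theta> "1 - \<theta>" "exp (- q * tau 1 (path \<omega>))" m] th m True by simp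
    qed (use th m in auto)
  qed
  also have "\<dots> = \<theta> * lap q 1 + (1 - \<theta>) * m"
    unfolding lap_def using i(1) by (simp add: prob_space)
  also have "\<dots> = m powr \<theta> * m powr (1 - \<theta>)"
    using m by (simp add: m_def[symmetric] powr_add[symmetric] algebra_simps)
  finally have "lap (\<theta> * q) 1 \<le> m powr \<theta>" using m by simp
  then have "ln (lap (\<theta> * q) 1) \<le> \<theta> * ln m"
    using m lap_pos[of "\<theta> * q" 1] th q by (metis ln_le_cancel_iff ln_powr mult_nonneg_nonneg less_imp_le powr_gt_zero zero_le_one less_numeral_extra(3))
  then show ?thesis by (simp add: phi_def m_def)
qed

lemma path_bounded_below:
  assumes w: "\<omega> \<in> space M" shows "\<exists>B. \<forall>t\<ge>0. - B \<le> Z t \<omega>"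
proof -
  have "eventually (\<lambda>t. 0 \<le> Z t \<omega>) at_top"
    using Z_drift[OF w] by (simp add: filterlim_at_top)
  then obtain T where T: "\<And>t. T \<le> t \<Longrightarrow> 0 \<le> Z t \<omega>" by (auto simp: eventually_at_top_linorder)
  obtain B where B: "\<And>t. t \<in> {0..T} \<Longrightarrow> \<bar>path \<omega> t\<bar> \<le> B"
    using cadlag_bounded_on_compact[OF path_cadlag[OF w]] by blast
  have "- \<bar>B\<bar> \<le> Z t \<omega>" if "0 \<le> t" for t
  proof (cases "T \<le> t")
    case True
    show ?thesis using T[OF True] by simp
  next
    case False
    then show ?thesis using B[of t] that by simp
  qed
  then show ?thesis by blast
qed

definition kap :: real where "kap = phi 0"

lemma prob_dies: "0 \<le> s \<Longrightarrow> prob {\<omega> \<in> space M. dies s (path \<omega>)} = exp (- kap * s)"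
proof -
  assume s: "0 \<le> s"
  have "lap 0 s = (\<integral>\<omega>. indicator {\<omega> \<in> space M. dies s (path \<omega>)} \<omega> \<partial>M)"
    unfolding lap_def by (intro Bochner_Integration.integral_cong) (auto split: split_indicator)
  also have "\<dots> = prob {\<omega> \<in> space M. dies s (path \<omega>)}" by simp
  finally show ?thesis using lap_exp[of 0 s] s by (simp add: kap_def mult.commute)
qed

lemma prob_not_dies: "0 \<le> s \<Longrightarrow> prob {\<omega> \<in> space M. \<not> dies s (path \<omega>)} = 1 - exp (- kap * s)"
  using prob_neg[of "\<lambda>\<omega>. dies s (path \<omega>)"] prob_dies[of s] by simp

text \<open>With \<open>kap = 0\<close> every level would be passed almost surely, but a
  right-continuous path with left limits that drifts to infinity is bounded below.\<close>

lemma kap_pos: "0 < kap"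
proof (rule ccontr)
  assume "\<not> 0 < kap"
  then have "kap = 0" using phi_nonneg[of 0] by (simp add: kap_def)
  then have "prob {\<omega> \<in> space M. dies (real n) (path \<omega>)} = 1" for n :: nat using prob_dies[of "real n"] by simp
  then have "AE \<omega> in M. dies (real n) (path \<omega>)" for n :: nat
    by (subst (asm) prob_Collect_eq_1) measurable
  then have "AE \<omega> in M. \<forall>n. dies (real n) (path \<omega>)" by (simp add: AE_all_countable)
  then have "AE \<omega> in M. False"
  proof (rule AE_mp, intro AE_I2 impI)
    fix \<omega> assume w: "\<omega> \<in> space M" and d: "\<forall>n. dies (real n) (path \<omega>)"
    obtain B where B: "\<And>t. 0 \<le> t \<Longrightarrow> - B \<le> Z t \<omega>" using path_bounded_below[OF w] by blast
    obtain n :: nat where "B < real n" using reals_Archimedean2 by blast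
    moreover from d have "dies (real n) (path \<omega>)" by blast
    then obtain t where "0 \<le> t" "path \<omega> t < - real n" by (auto simp: dies_def)
    ultimately show False using B[of t] by simp
  qed
  then show False by simp
qed

text \<open>The hitting time of \<open>- 1\<close> is at most \<open>tau 1\<close>, where the path
  equals \<open>- 1\<close>, and at least \<open>tau s\<close> for each \<open>s < 1\<close>.
  Continuity of \<open>lap q\<close> in the level closes the gap as \<open>s\<close> increases to
  1.\<close>

lemma passage_exponent_eq:
  assumes q: "0 \<le> q"
  shows "passage_exponent M (\<lambda>t \<omega>. - Z t \<omega>) q = phi q"
proof -
  define H where "H = hitting_time (\<lambda>t \<omega>. - Z t \<omega>) 1"
  define h where "h \<omega> = (if H \<omega> = \<infinity> then 0 else ennreal (exp (- q * real_of_ereal (H \<omega>))))" for \<omega>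
  have H0: "0 \<le> H \<omega>" for \<omega> unfolding H_def hitting_time_def by (rule Inf_greatest) auto
  have lower: "ennreal (lap q 1) \<le> (\<integral>\<^sup>+\<omega>. h \<omega> \<partial>M)"
    unfolding nn_lap[OF q zero_le_one, symmetric]
  proof (rule nn_integral_mono)
    fix \<omega> assume w: "\<omega> \<in> space M"
    show "indicator {w. dies 1 w} (path \<omega>) * ennreal (exp (- q * tau 1 (path \<omega>))) \<le> h \<omega>"
    proof (cases "dies 1 (path \<omega>)")
      case True
      have t0: "0 \<le> tau 1 (path \<omega>)" using tau_path_nonneg[OF w True] by simp
      have "Z (tau 1 (path \<omega>)) \<omega> = - 1" using at_tau[OF path_good[OF w] True] t0 by simp
      then have le: "H \<omega> \<le> ereal (tau 1 (path \<omega>))"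
        unfolding H_def hitting_time_def using t0 by (intro Inf_lower) auto
      then have "H \<omega> \<noteq> \<infinity>" by auto
      moreover from this H0[of \<omega>] obtain r where r: "H \<omega> = ereal r" by (cases "H \<omega>") auto
      ultimately show ?thesis using le q True by (simp add: h_def mult_left_mono)
    qed simp
  qed
  have upper: "(\<integral>\<^sup>+\<omega>. h \<omega> \<partial>M) \<le> ennreal (lap q s)" if s: "0 \<le> s" "s < 1" for s
    unfolding nn_lap[OF q s(1), symmetric]
  proof (rule nn_integral_mono)
    fix \<omega> assume w: "\<omega> \<in> space M"
    show "h \<omega> \<le> indicator {w. dies s w} (path \<omega>) * ennreal (exp (- q * tau s (path \<omega>)))"
    proof (cases "H \<omega> = \<infinity>")
      case False
      have "{ereal t |t. 0 \<le> t \<and> - Z t \<omega> = 1} \<noteq> {}"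
      proof
        assume e: "{ereal t |t. 0 \<le> t \<and> - Z t \<omega> = 1} = {}"
        show False using False unfolding H_def hitting_time_def e by (simp add: top_ereal_def)
      qed
      then obtain t where t: "0 \<le> t" "- Z t \<omega> = 1" by auto
      then have d: "dies s (path \<omega>)" using s by (auto simp: dies_def intro!: exI[of _ t])
      have "ereal (tau s (path \<omega>)) \<le> H \<omega>"
        unfolding H_def hitting_time_def
      proof (rule Inf_greatest, clarify)
        fix t assume t: "0 \<le> t" "- Z t \<omega> = 1"
        show "ereal (tau s (path \<omega>)) \<le> ereal t"
          using before_tau[OF path_good[OF w] d s(1), of t] t s by force
      qed
      moreover from H0[of \<omega>] False obtain r where r: "H \<omega> = ereal r" by (cases "H \<omega>") auto
      ultimately show ?thesis using q d by (simp add: h_def mult_left_mono)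
    qed (simp add: h_def)
  qed
  have "(\<integral>\<^sup>+\<omega>. h \<omega> \<partial>M) \<le> ennreal (lap q 1)"
  proof (rule tendsto_lowerbound)
    have "((\<lambda>s. exp (- s * phi q)) \<longlongrightarrow> exp (- 1 * phi q)) (at_left 1)" by (intro tendsto_intros)
    moreover have "eventually (\<lambda>s. exp (- s * phi q) = lap q s) (at_left 1)"
      using lap_exp[OF q] by (auto simp: eventually_at_left_field intro!: exI[of _ 0])
    ultimately have "((\<lambda>s. lap q s) \<longlongrightarrow> lap q 1) (at_left 1)"
      using lap_exp[OF q zero_le_one] by (simp add: filterlim_cong tendsto_cong)
    then show "((\<lambda>s. ennreal (lap q s)) \<longlongrightarrow> ennreal (lap q 1)) (at_left 1)" by (rule tendsto_ennrealI)
    show "eventually (\<lambda>s. (\<integral>\<^sup>+\<omega>. h \<omega> \<partial>M) \<le> ennreal (lap q s)) (at_left 1)"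
      using upper by (auto simp: eventually_at_left_field intro!: exI[of _ 0])
  qed simp
  with lower have "(\<integral>\<^sup>+\<omega>. h \<omega> \<partial>M) = ennreal (lap q 1)" by simp
  then show ?thesis
    unfolding passage_exponent_def phi_def H_def[symmetric] h_def[symmetric] by (simp add: lap_nonneg)
qed

text \<open>Staying positive is contained in never passing \<open>x\<close>, and both have the same
  probability because the passage probability is continuous in the level. The events thus agree up
  to a null set.\<close>

lemma
  assumes x: "0 < x"
  shows stays_positive_events: "stays_positive M Z x \<in> events"
    and prob_stays_positive: "prob (stays_positive M Z x) = 1 - exp (- kap * x)"
    and AE_stays_positive: "AE \<omega> in M. \<omega> \<in> stays_positive M Z x \<longleftrightarrow> \<not> dies x (path \<omega>)"
proof -
  show ev: "stays_positive M Z x \<in> events" unfolding stays_positive_eq[OF x, of M Z, folded path_def] by measurable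
  have sub: "stays_positive M Z x \<subseteq> {\<omega> \<in> space M. \<not> dies x (path \<omega>)}"
  proof -
    have "\<not> dies x w" if "\<not> dies (x - x / real (Suc n)) w" for w n
      using that dies_antimono[of "x - x / real (Suc n)" x w] x by auto
    then show ?thesis unfolding stays_positive_eq[OF x, of M Z, folded path_def] by blast
  qed
  have ev': "{\<omega> \<in> space M. \<not> dies x (path \<omega>)} \<in> events" by measurable
  have le: "1 - exp (- kap * (x - x / real (Suc n))) \<le> prob (stays_positive M Z x)" for n
  proof -
    have "x / real (Suc n) \<le> x" using x by (simp add: divide_le_eq)
    then have "1 - exp (- kap * (x - x / real (Suc n))) = prob {\<omega> \<in> space M. \<not> dies (x - x / real (Suc n)) (path \<omega>)}"
      using prob_not_dies[of "x - x / real (Suc n)"] by simp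
    also have "\<dots> \<le> prob (stays_positive M Z x)"
      by (rule finite_measure_mono[OF _ ev]) (auto simp: stays_positive_eq[OF x, of M Z, folded path_def])
    finally show ?thesis .
  qed
  have "(\<lambda>n. 1 - exp (- kap * (x - x * (1 / real (Suc n))))) \<longlonglongrightarrow> 1 - exp (- kap * (x - x * 0))"
    by (intro tendsto_intros LIMSEQ_Suc lim_1_over_n)
  then have "1 - exp (- kap * x) \<le> prob (stays_positive M Z x)"
    using le by (intro LIMSEQ_le_const2[of "\<lambda>n. 1 - exp (- kap * (x - x * (1 / real (Suc n))))"]) auto
  moreover have "prob (stays_positive M Z x) \<le> 1 - exp (- kap * x)"
    using finite_measure_mono[OF sub ev'] prob_not_dies[of x] x by simp
  ultimately show p: "prob (stays_positive M Z x) = 1 - exp (- kap * x)" by simp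
  have "prob ({\<omega> \<in> space M. \<not> dies x (path \<omega>)} - stays_positive M Z x) = 0"
    using finite_measure_Diff[OF ev' ev sub] p prob_not_dies[of x] x by simp
  then have "AE \<omega> in M. \<omega> \<notin> {\<omega> \<in> space M. \<not> dies x (path \<omega>)} - stays_positive M Z x"
    using ev ev' by (subst (asm) prob_eq_0) auto
  then show "AE \<omega> in M. \<omega> \<in> stays_positive M Z x \<longleftrightarrow> \<not> dies x (path \<omega>)"
    using AE_space by eventually_elim (use sub in auto)
qed

end

text \<open>With \<open>m\<close> the weighted mean, apply \<open>ln z \<le> z - 1\<close> at
  \<open>x / m\<close> and \<open>1 / m\<close>; the weighted sum of the right sides is 0. Equality
  overall forces equality in both, hence \<open>x = m = 1\<close>. The equality case provides the
  strict convexity in \<open>mgf_less_1\<close>.\<close>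

lemma weighted_am_gm_eq:
  fixes x :: real
  assumes th: "0 < \<theta>" "\<theta> < 1" and x: "0 < x"
  shows "x powr \<theta> \<le> \<theta> * x + (1 - \<theta>)" "x powr \<theta> = \<theta> * x + (1 - \<theta>) \<Longrightarrow> x = 1"
proof -
  define m where "m = \<theta> * x + (1 - \<theta>)"
  have m: "0 < m" unfolding m_def using th x by (simp add: add_pos_pos)
  have l1: "ln (x / m) \<le> x / m - 1" using x m by (intro ln_le_minus_one) auto
  have l2: "ln (1 / m) \<le> 1 / m - 1" using m by (intro ln_le_minus_one) auto
  have sum: "\<theta> * (x / m - 1) + (1 - \<theta>) * (1 / m - 1) = 0"
    using m by (simp add: field_simps) (simp add: m_def algebra_simps)
  have e: "\<theta> * ln (x / m) + (1 - \<theta>) * ln (1 / m) = \<theta> * ln x - ln m"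
    using x m by (simp add: ln_div algebra_simps)
  have t1: "\<theta> * ln (x / m) \<le> \<theta> * (x / m - 1)" using l1 th by (intro mult_left_mono) auto
  have t2: "(1 - \<theta>) * ln (1 / m) \<le> (1 - \<theta>) * (1 / m - 1)" using l2 th by (intro mult_left_mono) auto
  have "\<theta> * ln x \<le> ln m" using t1 t2 sum e by linarith
  then have "exp (\<theta> * ln x) \<le> m" using m by (metis exp_le_cancel_iff exp_ln)
  then show "x powr \<theta> \<le> \<theta> * x + (1 - \<theta>)" using x by (simp add: powr_def m_def)
  assume "x powr \<theta> = \<theta> * x + (1 - \<theta>)"
  then have "\<theta> * ln x = ln m" using x by (metis m_def ln_powr)
  then have "(1 - \<theta>) * ln (1 / m) = (1 - \<theta>) * (1 / m - 1)" "\<theta> * ln (x / m) = \<theta> * (x / m - 1)"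
    using t1 t2 sum e by linarith+
  then have "ln (1 / m) = 1 / m - 1" "ln (x / m) = x / m - 1" using th by auto
  then have "1 / m = 1" "x / m = 1" using m x ln_eq_minus_one[of "1 / m"] ln_eq_minus_one[of "x / m"] by auto
  then show "x = 1" using m by simp
qed

text \<open>The level is read off the first path, so passage by the second has to be measurable
  jointly.\<close>

lemma measurable_shift_dies:
  assumes t: "0 \<le> t"
  shows "Measurable.pred (skorokhod_space \<Otimes>\<^sub>M skorokhod_space) (\<lambda>p. dies (y + fst p t) (snd p))"
proof -
  have "Measurable.pred (skorokhod_space \<Otimes>\<^sub>M skorokhod_space) (\<lambda>p. \<exists>r\<in>\<rat>. 0 \<le> r \<and> snd p r < - (y + fst p t))"
  proof (rule sets_countable_ex_rat)
    fix r :: real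
    show "Measurable.pred (skorokhod_space \<Otimes>\<^sub>M skorokhod_space) (\<lambda>p. 0 \<le> r \<and> snd p r < - (y + fst p t))"
    proof (cases "0 \<le> r")
      case True
      have [measurable]: "(\<lambda>p. snd p r) \<in> borel_measurable (skorokhod_space \<Otimes>\<^sub>M skorokhod_space)"
        "(\<lambda>p. fst p t) \<in> borel_measurable (skorokhod_space \<Otimes>\<^sub>M skorokhod_space)"
        using measurable_compose[OF measurable_snd measurable_skorokhod_eval[OF True]]
          measurable_compose[OF measurable_fst measurable_skorokhod_eval[OF t]] by auto
      show ?thesis by measurable
    qed simp
  qed
  moreover have "dies (y + fst p t) (snd p) \<longleftrightarrow> (\<exists>r\<in>\<rat>. 0 \<le> r \<and> snd p r < - (y + fst p t))"
    if "p \<in> space (skorokhod_space \<Otimes>\<^sub>M skorokhod_space)" for p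
  proof -
    have "cadlag (snd p)" using that by (auto simp: space_pair_measure space_skorokhod)
    then show ?thesis unfolding dies_def by (meson cadlag_approx_less less_imp_le order_trans lt_ex gt_ex)
  qed
  ultimately show ?thesis by (subst measurable_cong) auto
qed

section \<open>Exponential moments and the zero of the Laplace exponent\<close>

context spectrally_positive_up begin

text \<open>Markov's inequality for the discounted passage indicator.\<close>

lemma prob_tau_less:
  assumes q: "0 \<le> q" and y: "0 \<le> y"
  shows "prob {\<omega> \<in> space M. dies y (path \<omega>) \<and> tau y (path \<omega>) < t} \<le> exp (q * t - y * phi q)"
proof -
  have "prob {\<omega> \<in> space M. dies y (path \<omega>) \<and> tau y (path \<omega>) < t} =
      (\<integral>\<omega>. indicator {\<omega> \<in> space M. dies y (path \<omega>) \<and> tau y (path \<omega>) < t} \<omega> \<partial>M)" by simp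
  also have "\<dots> \<le> (\<integral>\<omega>. exp (q * t) * (indicator {w. dies y w} (path \<omega>) * exp (- q * tau y (path \<omega>))) \<partial>M)"
  proof (rule integral_mono)
    show "integrable M (indicat_real {\<omega> \<in> space M. dies y (path \<omega>) \<and> tau y (path \<omega>) < t})"
      by (intro integrable_real_indicator) (auto simp: emeasure_eq_measure)
    show "integrable M (\<lambda>\<omega>. exp (q * t) * (indicator {w. dies y w} (path \<omega>) * exp (- q * tau y (path \<omega>))))"
      using lap_integrable[OF q y] by simp
    show "indicat_real {\<omega> \<in> space M. dies y (path \<omega>) \<and> tau y (path \<omega>) < t} \<omega>
        \<le> exp (q * t) * (indicator {w. dies y w} (path \<omega>) * exp (- q * tau y (path \<omega>)))" for \<omega>
      using q by (auto split: split_indicator simp: exp_add[symmetric] mult_left_mono)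
  qed
  also have "\<dots> = exp (q * t) * lap q y" by (simp add: lap_def)
  also have "\<dots> = exp (q * t - y * phi q)" by (simp add: lap_exp[OF q y] exp_add[symmetric])
  finally show ?thesis .
qed

lemma prob_Z_less:
  assumes q: "0 \<le> q" and y: "0 \<le> y" and t: "0 \<le> t" "t < T"
  shows "prob {\<omega> \<in> space M. Z t \<omega> < - y} \<le> exp (q * T - y * phi q)"
proof -
  have "prob {\<omega> \<in> space M. Z t \<omega> < - y} \<le> prob {\<omega> \<in> space M. dies y (path \<omega>) \<and> tau y (path \<omega>) < T}"
  proof (rule finite_measure_mono)
    show "{\<omega> \<in> space M. Z t \<omega> < - y} \<subseteq> {\<omega> \<in> space M. dies y (path \<omega>) \<and> tau y (path \<omega>) < T}"
    proof clarify
      fix \<omega> assume "Z t \<omega> < - y"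
      then have "\<exists>u\<ge>0. u < T \<and> path \<omega> u < - y" using t by (intro exI[of _ t]) auto
      moreover from this have "dies y (path \<omega>)" by (auto simp: dies_def)
      ultimately show "dies y (path \<omega>) \<and> tau y (path \<omega>) < T" using tau_less_iff by blast
    qed
  qed measurable
  also have "\<dots> \<le> exp (q * T - y * phi q)" by (rule prob_tau_less[OF q y])
  finally show ?thesis .
qed

text \<open>Being below \<open>- n\<close> before time \<open>T\<close> requires a passage of level
  \<open>n\<close> before \<open>T\<close>, of probability at most
  \<open>exp (q * T - n * phi q)\<close>. As \<open>phi\<close> is unbounded, \<open>q\<close> can
  be taken with \<open>phi q \<ge> l + 1\<close>, and the sum over \<open>n\<close> becomes
  geometric with ratio \<open>exp (- 1)\<close>.\<close>

lemma exp_moment_bound: "\<exists>B. \<forall>t\<ge>0. t < T \<longrightarrow> (\<integral>\<^sup>+\<omega>. ennreal (exp (- l * Z t \<omega>)) \<partial>M) \<le> ennreal B" if l: "0 \<le> l"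
proof -
  obtain q where q: "0 \<le> q" "l + 1 \<le> phi q"
    using phi_at_top[unfolded filterlim_at_top, rule_format, of "l + 1"]
    by (auto simp: eventually_at_top_linorder) (metis linorder_linear order_refl order_trans phi_mono)
  define S where "S = (\<Sum>n. exp (- 1) ^ n :: real)"
  have sm: "summable (\<lambda>n. exp (- 1) ^ n :: real)" by (rule summable_geometric) simp
  have "(\<integral>\<^sup>+\<omega>. ennreal (exp (- l * Z t \<omega>)) \<partial>M) \<le> ennreal (1 + exp (l + q * T) * S)" if t: "0 \<le> t" "t < T" for t
  proof -
    have [measurable]: "Z t \<in> borel_measurable M" using t by (intro Z_measurable)
    define A where "A n = {\<omega> \<in> space M. Z t \<omega> < - real n}" for n
    have [measurable]: "A n \<in> events" for n unfolding A_def by measurable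
    have "(\<integral>\<^sup>+\<omega>. ennreal (exp (- l * Z t \<omega>)) \<partial>M) \<le> (\<integral>\<^sup>+\<omega>. 1 + (\<Sum>n. ennreal (exp (l * (real n + 1))) * indicator (A n) \<omega>) \<partial>M)"
    proof (rule nn_integral_mono)
      fix \<omega> assume w: "\<omega> \<in> space M"
      show "ennreal (exp (- l * Z t \<omega>)) \<le> 1 + (\<Sum>n. ennreal (exp (l * (real n + 1))) * indicator (A n) \<omega>)"
      proof (cases "0 \<le> Z t \<omega>")
        case True
        then have "exp (- l * Z t \<omega>) \<le> 1" using l by simp
        then have "ennreal (exp (- l * Z t \<omega>)) \<le> 1" by simp
        then show ?thesis by (rule order_trans) simp
      next
        case False
        \<comment> \<open>The integer with \<open>n < - Z t \<le> n + 1\<close>.\<close>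
        define n where "n = nat (\<lceil>- Z t \<omega>\<rceil> - 1)"
        have "real n = of_int \<lceil>- Z t \<omega>\<rceil> - 1" using False unfolding n_def by simp
        then have n: "Z t \<omega> < - real n" "- Z t \<omega> \<le> real n + 1" by linarith+
        have "ennreal (exp (- l * Z t \<omega>)) \<le> ennreal (exp (l * (real n + 1))) * indicator (A n) \<omega>"
          using n w l mult_left_mono[OF n(2) l] by (auto simp: A_def intro!: ennreal_leI)
        also have "\<dots> \<le> (\<Sum>n. ennreal (exp (l * (real n + 1))) * indicator (A n) \<omega>)"
        proof -
          define f where "f n = ennreal (exp (l * (real n + 1))) * indicator (A n) \<omega>" for n
          have "sum f {n} \<le> suminf f" by (rule sum_le_suminf) auto
          then have "f n \<le> suminf f" by simp
          then show ?thesis unfolding f_def .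
        qed
        also have "\<dots> \<le> 1 + \<dots>" by simp
        finally show ?thesis .
      qed
    qed
    also have "\<dots> = 1 + (\<Sum>n. ennreal (exp (l * (real n + 1))) * emeasure M (A n))"
      by (subst nn_integral_add) (auto simp: nn_integral_suminf nn_integral_cmult_indicator emeasure_space_1)
    also have "\<dots> \<le> 1 + (\<Sum>n. ennreal (exp (l + q * T) * exp (- 1) ^ n))"
    proof (intro add_left_mono suminf_le allI)
      fix n
      have "ennreal (exp (l * (real n + 1))) * emeasure M (A n) = ennreal (exp (l * (real n + 1)) * prob (A n))"
        by (simp add: emeasure_eq_measure ennreal_mult)
      also have "\<dots> \<le> ennreal (exp (l * (real n + 1)) * exp (q * T - real n * phi q))"
        using prob_Z_less[OF q(1) _ t, of "real n"] by (intro ennreal_leI mult_left_mono) (auto simp: A_def)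
      also have "\<dots> \<le> ennreal (exp (l + q * T) * exp (- 1) ^ n)"
      proof (rule ennreal_leI)
        have "real n * (l + 1) \<le> real n * phi q" using q by (intro mult_left_mono) auto
        then show "exp (l * (real n + 1)) * exp (q * T - real n * phi q) \<le> exp (l + q * T) * exp (- 1) ^ n"
          by (simp add: exp_add[symmetric] exp_of_nat_mult[symmetric] algebra_simps)
      qed
      finally show "ennreal (exp (l * (real n + 1))) * emeasure M (A n) \<le> ennreal (exp (l + q * T) * exp (- 1) ^ n)" .
    qed auto
    also have "(\<Sum>n. ennreal (exp (l + q * T) * exp (- 1) ^ n)) = ennreal (exp (l + q * T) * S)"
      unfolding S_def using sm by (subst suminf_ennreal2) (auto simp: suminf_mult)
    also have "1 + ennreal (exp (l + q * T) * S) = ennreal (1 + exp (l + q * T) * S)"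
      using sm by (subst ennreal_plus) (auto simp: S_def intro!: suminf_nonneg mult_nonneg_nonneg)
    finally show ?thesis .
  qed
  then show ?thesis by blast
qed

definition mgf :: "real \<Rightarrow> real \<Rightarrow> real" where
  "mgf l t = (\<integral>\<omega>. exp (- l * Z t \<omega>) \<partial>M)"

lemma exp_Z_integrable:
  assumes "0 \<le> l" "0 \<le> t" shows "integrable M (\<lambda>\<omega>. exp (- l * Z t \<omega>))"
proof (rule integrableI_nonneg)
  show "(\<lambda>\<omega>. exp (- l * Z t \<omega>)) \<in> borel_measurable M" using Z_measurable[OF assms(2)] by measurable
  show "(\<integral>\<^sup>+\<omega>. ennreal (exp (- l * Z t \<omega>)) \<partial>M) < \<infinity>"
  proof -
    obtain B where "\<forall>u\<ge>0. u < t + 1 \<longrightarrow> (\<integral>\<^sup>+\<omega>. ennreal (exp (- l * Z u \<omega>)) \<partial>M) \<le> ennreal B"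
      using exp_moment_bound[OF assms(1), of "t + 1"] by blast
    with assms(2) have "(\<integral>\<^sup>+\<omega>. ennreal (exp (- l * Z t \<omega>)) \<partial>M) \<le> ennreal B" by simp
    then show ?thesis by (rule le_less_trans) simp
  qed
qed simp

lemma nn_mgf: "0 \<le> l \<Longrightarrow> 0 \<le> t \<Longrightarrow> (\<integral>\<^sup>+\<omega>. ennreal (exp (- l * Z t \<omega>)) \<partial>M) = ennreal (mgf l t)"
  unfolding mgf_def by (rule nn_integral_eq_integral[OF exp_Z_integrable]) auto

lemma mgf_pos: "0 \<le> l \<Longrightarrow> 0 \<le> t \<Longrightarrow> 0 < mgf l t"
proof (rule ccontr)
  assume l: "0 \<le> l" and t: "0 \<le> t" and n: "\<not> 0 < mgf l t"
  have "0 \<le> mgf l t" unfolding mgf_def by simp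
  with n have "mgf l t = 0" by simp
  then have "(\<integral>\<omega>. exp (- l * Z t \<omega>) \<partial>M) = 0" unfolding mgf_def .
  then have "AE \<omega> in M. exp (- l * Z t \<omega>) = 0"
    using integral_nonneg_eq_0_iff_AE[OF exp_Z_integrable[OF l t]] by simp
  then show False by simp
qed

lemma mgf_add:
  assumes l: "0 \<le> l" and s: "0 \<le> s" and t: "0 \<le> t"
  shows "mgf l (s + t) = mgf l s * mgf l t"
proof -
  define F where "F r w = ennreal (exp (- l * w r))" for r :: real and w
  have [measurable]: "F r \<in> borel_measurable skorokhod_space" if "0 \<le> r" for r
    using measurable_skorokhod_eval[OF that] unfolding F_def[abs_def] by measurable
  have "ennreal (mgf l (s + t)) = (\<integral>\<^sup>+\<omega>. F s (stop s (path \<omega>)) * F t (shift s (path \<omega>)) \<partial>M)"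
    unfolding nn_mgf[OF l add_nonneg_nonneg[OF s t], symmetric] using s t
    by (intro nn_integral_cong)
      (auto simp: F_def stop_def shift_def ennreal_mult[symmetric] exp_add[symmetric] algebra_simps)
  also have "\<dots> = (\<integral>\<^sup>+\<omega>. F s (stop s (path \<omega>)) \<partial>M) * (\<integral>\<^sup>+\<omega>. F t (path \<omega>) \<partial>M)"
    using s t by (intro markov_fixed_time) auto
  also have "\<dots> = ennreal (mgf l s) * ennreal (mgf l t)"
    unfolding nn_mgf[OF l s, symmetric] nn_mgf[OF l t, symmetric] using s t by (simp add: F_def stop_def)
  finally show ?thesis using mgf_pos[OF l] s t by (simp add: ennreal_mult[symmetric] less_imp_le)
qed

text \<open>Cauchy's functional equation once more; the upper bound on short times is the reason why
  \<open>exp_moment_bound\<close> is uniform in \<open>t\<close>.\<close>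

lemma mgf_exp:
  assumes l: "0 \<le> l" and t: "0 \<le> t" shows "mgf l t = exp (t * ln (mgf l 1))"
proof (cases "t = 0")
  case True
  have "mgf l 0 = mgf l 0 * mgf l 0" using mgf_add[OF l, of 0 0] by simp
  then show ?thesis using mgf_pos[OF l, of 0] True by simp
next
  case False
  then have t: "0 < t" using t by simp
  obtain B where B: "\<And>t. 0 \<le> t \<Longrightarrow> t < 2 \<Longrightarrow> (\<integral>\<^sup>+\<omega>. ennreal (exp (- l * Z t \<omega>)) \<partial>M) \<le> ennreal B"
    using exp_moment_bound[OF l, of 2] by blast
  have "ln (mgf l t) = t * ln (mgf l 1)"
  proof (rule additive_bounded_above_linear[OF _ _ t])
    show "ln (mgf l (s + t)) = ln (mgf l s) + ln (mgf l t)" if "0 < s" "0 < t" for s t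
      using that mgf_add[OF l, of s t] mgf_pos[OF l, of s] mgf_pos[OF l, of t] by (simp add: ln_mult)
    show "ln (mgf l t) \<le> ln B" if "0 < t" "t \<le> 1" for t
    proof -
      have "ennreal (mgf l t) \<le> ennreal B" using B[of t] that nn_mgf[OF l, of t] by simp
      then have "mgf l t \<le> B" using mgf_pos[OF l, of t] that
        by (metis ennreal_le_iff2 less_imp_le not_le order_less_le_trans)
      then show ?thesis using mgf_pos[OF l, of t] that by simp
    qed
  qed
  then show ?thesis using mgf_pos[OF l, of t] t by (metis exp_ln less_imp_le)
qed

lemma laplace_exponent_eq:
  assumes l: "0 \<le> l" shows "laplace_exponent M (\<lambda>t \<omega>. - Z t \<omega>) l = ln (mgf l 1)"
  unfolding laplace_exponent_def
proof (rule the_equality)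
  have m: "(\<integral>\<omega>. exp (l * - Z t \<omega>) \<partial>M) = mgf l t" for t by (simp add: mgf_def)
  show "\<forall>t\<ge>0. (\<integral>\<omega>. exp (l * - Z t \<omega>) \<partial>M) = exp (t * ln (mgf l 1))"
    unfolding m using mgf_exp[OF l] by blast
  fix \<psi> assume "\<forall>t\<ge>0. (\<integral>\<omega>. exp (l * - Z t \<omega>) \<partial>M) = exp (t * \<psi>)"
  then have "mgf l 1 = exp \<psi>" unfolding m by (auto dest: spec[of _ 1])
  then show "\<psi> = ln (mgf l 1)" by simp
qed

text \<open>
  \<open>min 1 (exp (- kap * (y + Z t)))\<close> is the conditional probability, given the path up to time \<open>t\<close>,
  that the path goes below \<open>- y\<close> after time \<open>t\<close>.
\<close>

lemma mgf_kap:
  assumes t: "0 \<le> t" shows "mgf kap t = 1"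
proof -
  have [measurable]: "Z t \<in> borel_measurable M" using t by (rule Z_measurable)
  define h where "h z = min 1 (exp (- kap * z))" for z
  have hint: "integrable M (\<lambda>\<omega>. h (y + Z t \<omega>))" for y
    unfolding h_def by (rule integrable_const_bound[where B = 1]) auto
  have main: "(\<integral>\<omega>. h (y + Z t \<omega>) \<partial>M) = prob {\<omega> \<in> space M. dies (y + Z t \<omega>) (shift t (path \<omega>))}" if y: "0 \<le> y" for y
  proof -
    let ?A = "{p \<in> space (skorokhod_space \<Otimes>\<^sub>M skorokhod_space). dies (y + fst p t) (snd p)}"
    have [measurable]: "?A \<in> sets (skorokhod_space \<Otimes>\<^sub>M skorokhod_space)"
      using measurable_shift_dies[OF t] by (simp add: pred_def)
    have in1: "stop t (path \<omega>) \<in> space skorokhod_space" "shift t (path \<omega>) \<in> space skorokhod_space" if "\<omega> \<in> space M" for \<omega>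
      using cadlag_stop[OF path_cadlag[OF that] t] cadlag_shift[OF path_cadlag[OF that] t] by auto
    have [measurable]: "(\<lambda>\<omega>. (stop t (path \<omega>), shift t (path \<omega>))) \<in> measurable M (skorokhod_space \<Otimes>\<^sub>M skorokhod_space)"
      using t by measurable
    have ev: "{\<omega> \<in> space M. dies (y + Z t \<omega>) (shift t (path \<omega>))} \<in> events"
    proof -
      have "{\<omega> \<in> space M. dies (y + Z t \<omega>) (shift t (path \<omega>))} = (\<lambda>\<omega>. (stop t (path \<omega>), shift t (path \<omega>))) -` ?A \<inter> space M"
        using in1 t by (auto simp: stop_def space_pair_measure)
      also have "\<dots> \<in> events" by measurable
      finally show ?thesis .
    qed
    have "ennreal (prob {\<omega> \<in> space M. dies (y + Z t \<omega>) (shift t (path \<omega>))}) =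
        (\<integral>\<^sup>+\<omega>. indicator {\<omega> \<in> space M. dies (y + Z t \<omega>) (shift t (path \<omega>))} \<omega> \<partial>M)"
      using ev by (simp add: emeasure_eq_measure)
    also have "\<dots> = (\<integral>\<^sup>+\<omega>. indicator ?A (stop t (path \<omega>), shift t (path \<omega>)) \<partial>M)"
      using in1 t by (intro nn_integral_cong) (auto simp: stop_def space_pair_measure split: split_indicator)
    also have "\<dots> = (\<integral>\<^sup>+\<omega>. (\<integral>\<^sup>+\<omega>'. indicator ?A (stop t (path \<omega>), path \<omega>') \<partial>M) \<partial>M)"
      by (rule markov_fixed_time_joint[OF t]) measurable
    also have "\<dots> = (\<integral>\<^sup>+\<omega>. ennreal (h (y + Z t \<omega>)) \<partial>M)"
    proof (rule nn_integral_cong)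
      fix \<omega> assume w: "\<omega> \<in> space M"
      let ?z = "y + Z t \<omega>"
      have "(\<integral>\<^sup>+\<omega>'. indicator ?A (stop t (path \<omega>), path \<omega>') \<partial>M) = (\<integral>\<^sup>+\<omega>'. indicator {\<omega>' \<in> space M. dies ?z (path \<omega>')} \<omega>' \<partial>M)"
        using in1[OF w] path_in_space t by (intro nn_integral_cong) (auto simp: stop_def space_pair_measure split: split_indicator)
      also have "\<dots> = emeasure M {\<omega>' \<in> space M. dies ?z (path \<omega>')}"
        by (rule nn_integral_indicator) measurable
      also have "\<dots> = ennreal (prob {\<omega>' \<in> space M. dies ?z (path \<omega>')})" by (rule emeasure_eq_measure)
      also have "prob {\<omega>' \<in> space M. dies ?z (path \<omega>')} = h ?z"
      proof (cases "0 \<le> ?z")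
        case True then show ?thesis using prob_dies[OF True] kap_pos by (simp add: h_def min_absorb2)
      next
        case False
        then have "{\<omega>' \<in> space M. dies ?z (path \<omega>')} = space M"
          by (auto simp: dies_def Z_0 intro!: exI[of _ 0])
        moreover have "1 \<le> exp (- kap * ?z)" using False kap_pos by (simp add: mult_nonneg_nonpos)
        ultimately show ?thesis by (simp add: h_def prob_space)
      qed
      finally show "(\<integral>\<^sup>+\<omega>'. indicator ?A (stop t (path \<omega>), path \<omega>') \<partial>M) = ennreal (h ?z)" .
    qed
    also have "\<dots> = ennreal (\<integral>\<omega>. h (y + Z t \<omega>) \<partial>M)"
      by (rule nn_integral_eq_integral[OF hint]) (auto simp: h_def)
    finally have "prob {\<omega> \<in> space M. dies (y + Z t \<omega>) (shift t (path \<omega>))} = (\<integral>\<omega>. h (y + Z t \<omega>) \<partial>M)"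
      by (subst (asm) ennreal_inj) (auto simp: h_def intro!: integral_nonneg_AE)
    then show ?thesis by simp
  qed
  \<comment> \<open>Going below \<open>- y\<close> after time \<open>t\<close> is in particular
    going below \<open>- y\<close>.\<close>
  have upper: "(\<integral>\<omega>. h (y + Z t \<omega>) \<partial>M) \<le> exp (- kap * y)" if y: "0 \<le> y" for y
  proof -
    have "prob {\<omega> \<in> space M. dies (y + Z t \<omega>) (shift t (path \<omega>))} \<le> prob {\<omega> \<in> space M. dies y (path \<omega>)}"
    proof (rule finite_measure_mono)
      show "{\<omega> \<in> space M. dies (y + Z t \<omega>) (shift t (path \<omega>))} \<subseteq> {\<omega> \<in> space M. dies y (path \<omega>)}"
      proof clarify
        fix \<omega> assume "dies (y + Z t \<omega>) (shift t (path \<omega>))"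
        then obtain u where "0 \<le> u" "shift t (path \<omega>) u < - (y + Z t \<omega>)" by (auto simp: dies_def)
        then show "dies y (path \<omega>)" using t by (auto simp: dies_def shift_def intro!: exI[of _ "t + u"])
      qed
    qed measurable
    then show ?thesis using main[OF y] prob_dies[OF y] by simp
  qed
  \<comment> \<open>Conversely, a passage below \<open>- y\<close> that does not occur before
    \<open>t + 1\<close> occurs after \<open>t\<close>. The excluded part is of order
    \<open>exp (- y * phi 1)\<close>, negligible against \<open>exp (- kap * y)\<close> since
    \<open>kap < phi 1\<close>.\<close>
  have lower: "exp (- kap * y) - exp (1 * (t + 1) - y * phi 1) \<le> (\<integral>\<omega>. h (y + Z t \<omega>) \<partial>M)" if y: "0 \<le> y" for y
  proof -
    let ?B = "{\<omega> \<in> space M. dies (y + Z t \<omega>) (shift t (path \<omega>))}"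
    let ?C = "{\<omega> \<in> space M. dies y (path \<omega>) \<and> tau y (path \<omega>) < t + 1}"
    have Cev: "?C \<in> events" by measurable
    have "prob {\<omega> \<in> space M. dies y (path \<omega>)} - prob ?C \<le> prob ({\<omega> \<in> space M. dies y (path \<omega>)} - ?C)"
      by (subst finite_measure_Diff) auto
    also have "\<dots> \<le> prob ?B"
    proof (cases "?B \<in> events")
      case True
      show ?thesis
      proof (rule finite_measure_mono[OF _ True], rule subsetI)
        fix \<omega> assume "\<omega> \<in> {\<omega> \<in> space M. dies y (path \<omega>)} - ?C"
        then have w: "\<omega> \<in> space M" and d: "dies y (path \<omega>)" and n: "\<not> tau y (path \<omega>) < t + 1" by auto
        obtain u where u: "0 \<le> u" "path \<omega> u < - y" using d by (auto simp: dies_def)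
        have "t + 1 \<le> u" using n d u tau_less_iff[OF d, of "t + 1"] by force
        then have "dies (y + Z t \<omega>) (shift t (path \<omega>))" using u t
          by (auto simp: dies_def shift_def intro!: exI[of _ "u - t"])
        then show "\<omega> \<in> ?B" using w by simp
      qed
    next
      case False
      have "?B = (\<lambda>\<omega>. (stop t (path \<omega>), shift t (path \<omega>))) -`
          {p \<in> space (skorokhod_space \<Otimes>\<^sub>M skorokhod_space). dies (y + fst p t) (snd p)} \<inter> space M"
        using t cadlag_stop[OF path_cadlag t] cadlag_shift[OF path_cadlag t] by (auto simp: stop_def space_pair_measure)
      also have "\<dots> \<in> events"
        by (rule measurable_sets[of _ _ "skorokhod_space \<Otimes>\<^sub>M skorokhod_space"])
          (use t measurable_shift_dies[OF t] in \<open>auto simp: pred_def\<close>)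
      finally show ?thesis using False by simp
    qed
    finally show ?thesis
      using main[OF y] prob_dies[OF y] prob_tau_less[OF zero_le_one y, of "t + 1"] by simp
  qed
  \<comment> \<open>With \<open>y = n\<close> and the factor \<open>exp (kap * n)\<close>, the
    truncated integrands become eventually equal to \<open>exp (- kap * Z t)\<close> as
    \<open>n\<close> grows, while both bounds on their expectations tend to 1.\<close>
  define g where "g n \<omega> = min (exp (kap * real n)) (exp (- kap * Z t \<omega>))" for n \<omega>
  have gh: "(\<integral>\<omega>. g n \<omega> \<partial>M) = exp (kap * real n) * (\<integral>\<omega>. h (real n + Z t \<omega>) \<partial>M)" for n
  proof -
    have "g n \<omega> = exp (kap * real n) * h (real n + Z t \<omega>)" for \<omega>
      by (simp add: g_def h_def min_mult_distrib_left exp_add[symmetric] algebra_simps)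
    then show ?thesis by simp
  qed
  have "(\<lambda>n. \<integral>\<omega>. g n \<omega> \<partial>M) \<longlonglongrightarrow> (\<integral>\<omega>. exp (- kap * Z t \<omega>) \<partial>M)"
  proof (rule integral_dominated_convergence[where w = "\<lambda>\<omega>. exp (- kap * Z t \<omega>)"])
    show "integrable M (\<lambda>\<omega>. exp (- kap * Z t \<omega>))" using exp_Z_integrable[of kap t] kap_pos t by simp
    show "AE \<omega> in M. (\<lambda>n. g n \<omega>) \<longlonglongrightarrow> exp (- kap * Z t \<omega>)"
    proof (rule AE_I2, rule tendsto_eventually)
      fix \<omega>
      obtain N :: nat where N: "- Z t \<omega> < real N" using reals_Archimedean2 by blast
      show "eventually (\<lambda>n. g n \<omega> = exp (- kap * Z t \<omega>)) sequentially"
        unfolding eventually_sequentially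
      proof (intro exI allI impI)
        fix n assume "N \<le> n"
        then have "- Z t \<omega> \<le> real n" using N by linarith
        then have "kap * (- Z t \<omega>) \<le> kap * real n" using kap_pos by (intro mult_left_mono) auto
        then show "g n \<omega> = exp (- kap * Z t \<omega>)" unfolding g_def by (intro min_absorb2) simp
      qed
    qed
  qed (auto simp: g_def)
  then have lim: "(\<lambda>n. \<integral>\<omega>. g n \<omega> \<partial>M) \<longlonglongrightarrow> mgf kap t" by (simp add: mgf_def)
  have ub: "(\<integral>\<omega>. g n \<omega> \<partial>M) \<le> 1" for n
  proof -
    have "(\<integral>\<omega>. g n \<omega> \<partial>M) \<le> exp (kap * real n) * exp (- kap * real n)"
      unfolding gh using upper[of "real n"] by (intro mult_left_mono) auto
    then show ?thesis by (simp add: exp_add[symmetric])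
  qed
  have lb: "1 - exp (t + 1) * exp (- (phi 1 - kap)) ^ n \<le> (\<integral>\<omega>. g n \<omega> \<partial>M)" for n
  proof -
    have "exp (kap * real n) * (exp (- kap * real n) - exp (1 * (t + 1) - real n * phi 1)) \<le> (\<integral>\<omega>. g n \<omega> \<partial>M)"
      unfolding gh using lower[of "real n"] by (intro mult_left_mono) auto
    moreover have "exp (kap * real n) * (exp (- kap * real n) - exp (1 * (t + 1) - real n * phi 1)) =
        1 - exp (t + 1) * exp (- (phi 1 - kap)) ^ n"
      by (simp add: right_diff_distrib exp_add[symmetric] exp_of_nat_mult[symmetric] algebra_simps)
    ultimately show ?thesis by simp
  qed
  have "0 < phi 1 - kap" using phi_strict[of 1] by (simp add: kap_def)
  then have "(\<lambda>n. 1 - exp (t + 1) * exp (- (phi 1 - kap)) ^ n) \<longlonglongrightarrow> 1 - exp (t + 1) * 0"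
    by (intro tendsto_intros LIMSEQ_power_zero) simp
  then have "1 \<le> mgf kap t" using LIMSEQ_le[OF _ lim] lb by auto
  moreover have "mgf kap t \<le> 1" using lim ub by (intro LIMSEQ_le_const2) auto
  ultimately show ?thesis by simp
qed

text \<open>Otherwise, by stationarity, the process would vanish at all integer times and could not
  drift to infinity.\<close>

lemma Z_1_not_0: "\<not> (AE \<omega> in M. Z 1 \<omega> = 0)"
proof
  assume a: "AE \<omega> in M. Z 1 \<omega> = 0"
  have inc: "AE \<omega> in M. Z (real n + 1) \<omega> - Z (real n) \<omega> = 0" for n :: nat
  proof -
    have [measurable]: "Z 1 \<in> borel_measurable M" "Z (real n) \<in> borel_measurable M" "Z (real n + 1) \<in> borel_measurable M"
      by (auto intro: Z_measurable)
    have "AE x in distr M borel (Z 1). x = 0" using a by (subst AE_distr_iff) auto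
    moreover have "distr M borel (\<lambda>\<omega>. Z (real n + 1) \<omega> - Z (real n) \<omega>) = distr M borel (Z 1)"
      by (rule Z_stationary) auto
    ultimately have "AE x in distr M borel (\<lambda>\<omega>. Z (real n + 1) \<omega> - Z (real n) \<omega>). x = 0"
      by (simp only:)
    then show ?thesis by (subst (asm) AE_distr_iff) auto
  qed
  then have "AE \<omega> in M. \<forall>n. Z (real n + 1) \<omega> - Z (real n) \<omega> = 0" by (simp add: AE_all_countable)
  then have "AE \<omega> in M. False"
  proof (rule AE_mp, intro AE_I2 impI)
    fix \<omega> assume w: "\<omega> \<in> space M" and e: "\<forall>n. Z (real n + 1) \<omega> - Z (real n) \<omega> = 0"
    have z: "Z (real n) \<omega> = 0" for n :: nat
    proof (induction n)
      case (Suc n)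
      then show ?case using e by (auto simp: add.commute dest!: spec[of _ n])
    qed (simp add: Z_0[OF w])
    have "filterlim (\<lambda>n. Z (real n) \<omega>) at_top sequentially"
      by (rule filterlim_compose[OF Z_drift[OF w] filterlim_real_sequentially])
    then have "eventually (\<lambda>n. 1 \<le> Z (real n) \<omega>) sequentially" by (simp add: filterlim_at_top)
    then show False by (simp add: z)
  qed
  then show False by simp
qed

text \<open>For \<open>\<theta> = a / b\<close>, the weighted mean inequality bounds
  \<open>exp (- a * Z 1)\<close> by an expression of expectation 1. Equality would force
  \<open>Z 1 = 0\<close> almost surely. This gives both the uniqueness of the zero and a negative
  exponent below it.\<close>

lemma mgf_less_1:
  assumes a: "0 < a" "a < b" and b: "mgf b 1 = 1" shows "mgf a 1 < 1"
proof -
  define \<theta> where "\<theta> = a / b"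
  have th: "0 < \<theta>" "\<theta> < 1" using a by (auto simp: \<theta>_def)
  have e: "exp (- a * z) = exp (- b * z) powr \<theta>" for z using a by (simp add: powr_def \<theta>_def)
  have ia: "integrable M (\<lambda>\<omega>. exp (- a * Z 1 \<omega>))" and ib: "integrable M (\<lambda>\<omega>. exp (- b * Z 1 \<omega>))"
    using exp_Z_integrable a by auto
  have id: "integrable M (\<lambda>\<omega>. (\<theta> * exp (- b * Z 1 \<omega>) + (1 - \<theta>)) - exp (- a * Z 1 \<omega>))"
    using ia ib by (intro Bochner_Integration.integrable_diff Bochner_Integration.integrable_add) auto
  have nonneg: "0 \<le> (\<theta> * exp (- b * z) + (1 - \<theta>)) - exp (- a * z)" for z
    using weighted_am_gm_eq(1)[OF th, of "exp (- b * z)"] e[of z] by simp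
  have val: "(\<integral>\<omega>. (\<theta> * exp (- b * Z 1 \<omega>) + (1 - \<theta>)) - exp (- a * Z 1 \<omega>) \<partial>M) = \<theta> * mgf b 1 + (1 - \<theta>) - mgf a 1"
    using ia ib by (simp add: mgf_def prob_space)
  have "0 \<le> \<theta> * mgf b 1 + (1 - \<theta>) - mgf a 1"
    unfolding val[symmetric] by (rule integral_nonneg_AE) (use nonneg in auto)
  then have le: "mgf a 1 \<le> 1" by (simp add: b)
  have "mgf a 1 \<noteq> 1"
  proof
    assume "mgf a 1 = 1"
    then have "(\<integral>\<omega>. (\<theta> * exp (- b * Z 1 \<omega>) + (1 - \<theta>)) - exp (- a * Z 1 \<omega>) \<partial>M) = 0"
      unfolding val by (simp add: b)
    then have "AE \<omega> in M. (\<theta> * exp (- b * Z 1 \<omega>) + (1 - \<theta>)) - exp (- a * Z 1 \<omega>) = 0"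
      using integral_nonneg_eq_0_iff_AE[OF id] nonneg by simp
    then have "AE \<omega> in M. Z 1 \<omega> = 0"
    proof eventually_elim
      case (elim \<omega>)
      then have "exp (- b * Z 1 \<omega>) = 1"
        using weighted_am_gm_eq(2)[OF th, of "exp (- b * Z 1 \<omega>)"] e[of "Z 1 \<omega>"] by simp
      then show ?case using a by simp
    qed
    with Z_1_not_0 show False by simp
  qed
  with le show ?thesis by simp
qed

text \<open>Of two distinct positive zeros the smaller would contradict \<open>mgf_less_1\<close>
  applied to the larger.\<close>

lemma nontrivial_zero_eq: "nontrivial_zero (laplace_exponent M (\<lambda>t \<omega>. - Z t \<omega>)) = kap"
  unfolding nontrivial_zero_def
proof (rule the_equality)
  show "0 < kap \<and> laplace_exponent M (\<lambda>t \<omega>. - Z t \<omega>) kap = 0"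
    using kap_pos mgf_kap[of 1] laplace_exponent_eq[of kap] by simp
  fix k assume k: "0 < k \<and> laplace_exponent M (\<lambda>t \<omega>. - Z t \<omega>) k = 0"
  then have "ln (mgf k 1) = 0" using laplace_exponent_eq[of k] by simp
  then have "mgf k 1 = 1" using mgf_pos[of k 1] k by simp
  then show "k = kap"
    using mgf_less_1[of k kap] mgf_less_1[of kap k] mgf_kap[of 1] kap_pos k
    by (cases k kap rule: linorder_cases) auto
qed

text \<open>For \<open>0 < l < kap\<close> the mean of \<open>exp (- l * Z t)\<close> decays
  exponentially, so the integral of \<open>exp (- l * Z)\<close> is almost surely finite. As
  \<open>Z\<close> is bounded below on each path and \<open>l \<le> 1\<close>,
  \<open>exp (- Z)\<close> is at most a random constant times \<open>exp (- l * Z)\<close>.\<close>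

lemma efun_finite: "AE \<omega> in M. efun {0..} (path \<omega>) < \<infinity>"
proof -
  define l where "l = min 1 (kap / 2)"
  have l: "0 < l" "l < kap" "l \<le> 1" using kap_pos by (auto simp: l_def)
  have "mgf l 1 < 1" using mgf_less_1[OF l(1,2)] mgf_kap[of 1] by simp
  then have c: "ln (mgf l 1) < 0" using mgf_pos[of l 1] l by simp
  define c where "c = - ln (mgf l 1)"
  have c: "0 < c" using c by (simp add: c_def)
  have m [measurable]: "(\<lambda>p. ennreal (exp (- l * path (fst p) (max 0 (snd p)))) * indicator {0..} (snd p)) \<in> borel_measurable (M \<Otimes>\<^sub>M lborel)"
  proof -
    have "(\<lambda>p. (path (fst p), snd p)) \<in> measurable (M \<Otimes>\<^sub>M lborel) (skorokhod_space \<Otimes>\<^sub>M lborel)" by measurable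
    from measurable_compose[OF this measurable_path_eval]
    have [measurable]: "(\<lambda>p. path (fst p) (max 0 (snd p))) \<in> borel_measurable (M \<Otimes>\<^sub>M lborel)" by simp
    show ?thesis by measurable
  qed
  interpret pair_sigma_finite M lborel ..
  let ?g = "\<lambda>\<omega>. \<integral>\<^sup>+t. ennreal (exp (- l * path \<omega> (max 0 t))) * indicator {0..} t \<partial>lborel"
  have gm: "?g \<in> borel_measurable M" using lborel.borel_measurable_nn_integral_fst[OF m] by simp
  have "(\<integral>\<^sup>+\<omega>. ?g \<omega> \<partial>M) = (\<integral>\<^sup>+t. (\<integral>\<^sup>+\<omega>. ennreal (exp (- l * path \<omega> (max 0 t))) * indicator {0..} t \<partial>M) \<partial>lborel)"
    using Fubini'[of "\<lambda>\<omega> t. ennreal (exp (- l * path \<omega> (max 0 t))) * indicator {0..} t"] m by (simp add: case_prod_beta')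
  also have "\<dots> = (\<integral>\<^sup>+t. ennreal (exp (- c * t)) * indicator {0..} t \<partial>lborel)"
  proof (rule nn_integral_cong)
    fix t :: real
    show "(\<integral>\<^sup>+\<omega>. ennreal (exp (- l * path \<omega> (max 0 t))) * indicator {0..} t \<partial>M) = ennreal (exp (- c * t)) * indicator {0..} t"
    proof (cases "0 \<le> t")
      case True
      then have "(\<integral>\<^sup>+\<omega>. ennreal (exp (- l * path \<omega> (max 0 t))) * indicator {0..} t \<partial>M) = ennreal (mgf l t)"
        using l nn_mgf[of l t] by (simp add: max_absorb2)
      then show ?thesis using mgf_exp[of l t] l True by (simp add: c_def mult.commute)
    qed simp
  qed
  also have "\<dots> < \<infinity>"
  proof -
    have "(\<integral>\<^sup>+t. ennreal (exp (- c * t)) * indicator {0..} t \<partial>lborel) = ennreal (0 - (- (1 / c) * exp (- c * 0)))"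
    proof (rule nn_integral_FTC_atLeast[where F = "\<lambda>t. - (1 / c) * exp (- c * t)" and T = 0])
      show "((\<lambda>t. - (1 / c) * exp (- c * t)) has_real_derivative exp (- c * t)) (at t)" for t
        using c by (auto intro!: derivative_eq_intros)
      show "((\<lambda>t. - (1 / c) * exp (- c * t)) \<longlongrightarrow> 0) at_top"
      proof -
        have "filterlim (\<lambda>t. - c * t) at_bot at_top"
          using c by (simp add: filterlim_uminus_at_bot filterlim_tendsto_pos_mult_at_top[OF tendsto_const _ filterlim_ident])
        from tendsto_mult[OF tendsto_const filterlim_compose[OF exp_at_bot this], of "- (1 / c)"] show ?thesis by simp
      qed
    qed auto
    then show ?thesis by simp
  qed
  finally have "AE \<omega> in M. ?g \<omega> \<noteq> \<infinity>" by (intro nn_integral_PInf_AE[OF gm]) simp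
  then show ?thesis
  proof (rule AE_mp, intro AE_I2 impI)
    fix \<omega> assume w: "\<omega> \<in> space M" and g: "?g \<omega> \<noteq> \<infinity>"
    obtain B where B: "\<And>t. 0 \<le> t \<Longrightarrow> - B \<le> Z t \<omega>" using path_bounded_below[OF w] by blast
    have "efun {0..} (path \<omega>) \<le> (\<integral>\<^sup>+t. ennreal (exp ((1 - l) * B)) * (ennreal (exp (- l * path \<omega> (max 0 t))) * indicator {0..} t) \<partial>lborel)"
      unfolding efun_def
    proof (rule nn_integral_mono)
      fix t :: real
      show "ennreal (exp (- path \<omega> t)) * indicator {0..} t \<le>
          ennreal (exp ((1 - l) * B)) * (ennreal (exp (- l * path \<omega> (max 0 t))) * indicator {0..} t)"
      proof (cases "0 \<le> t")
        case True
        have "(1 - l) * (- Z t \<omega>) \<le> (1 - l) * B" using B[OF True] l by (intro mult_left_mono) auto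
        then have "exp (- Z t \<omega>) \<le> exp ((1 - l) * B) * exp (- l * Z t \<omega>)"
          by (simp add: exp_add[symmetric] algebra_simps)
        then show ?thesis using True by (simp add: max_absorb2 ennreal_mult[symmetric] ennreal_leI)
      qed simp
    qed
    also have "\<dots> = ennreal (exp ((1 - l) * B)) * ?g \<omega>"
      by (rule nn_integral_cmult) (use cadlag_measurable[OF path_cadlag[OF w]] in measurable)
    also have "\<dots> < \<infinity>" using g by (simp add: ennreal_mult_less_top less_top)
    finally show "efun {0..} (path \<omega>) < \<infinity>" .
  qed
qed

lemma prob_efun_tail:
  assumes eta: "0 < \<eta>"
  shows "(\<lambda>n. prob {\<omega> \<in> space M. ennreal \<eta> < efun {real n..} (path \<omega>)}) \<longlonglongrightarrow> 0"
proof -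
  let ?A = "\<lambda>n. {\<omega> \<in> space M. ennreal \<eta> < efun {real n..} (path \<omega>)}"
  have [measurable]: "?A n \<in> events" for n by measurable
  have "(\<lambda>n. \<integral>\<omega>. indicator (?A n) \<omega> \<partial>M) \<longlonglongrightarrow> (\<integral>\<omega>. 0 \<partial>M :: real)"
  proof (rule integral_dominated_convergence[where w = "\<lambda>_. 1"])
    show "AE \<omega> in M. (\<lambda>n. indicat_real (?A n) \<omega>) \<longlonglongrightarrow> 0"
      using efun_finite AE_space
    proof eventually_elim
      case (elim \<omega>)
      have m: "(\<lambda>t. path \<omega> (max 0 t)) \<in> borel_measurable lborel" by (rule cadlag_measurable[OF path_cadlag[OF elim(2)]])
      have e: "efun {real n..} (path \<omega>) = (\<integral>\<^sup>+t. ennreal (exp (- path \<omega> (max 0 t))) * indicator {real n..} t \<partial>lborel)" for n :: nat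
        by (rule efun_eq_max) auto
      have "(\<lambda>n. \<integral>\<^sup>+t. ennreal (exp (- path \<omega> (max 0 t))) * indicator {real n..} t \<partial>lborel) \<longlonglongrightarrow> (\<integral>\<^sup>+t. 0 \<partial>(lborel :: real measure))"
      proof (rule nn_integral_dominated_convergence[where w = "\<lambda>t. ennreal (exp (- path \<omega> (max 0 t))) * indicator {real 0..} t"])
        show "(\<integral>\<^sup>+t. ennreal (exp (- path \<omega> (max 0 t))) * indicator {real 0..} t \<partial>lborel) < \<infinity>"
          using elim(1) e[of 0] by simp
        show "AE t in lborel. (\<lambda>n. ennreal (exp (- path \<omega> (max 0 t))) * indicator {real n..} t) \<longlonglongrightarrow> 0"
        proof (rule AE_I2, rule tendsto_eventually)
          fix t :: real
          obtain N :: nat where "t < real N" using reals_Archimedean2 by blast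
          then show "eventually (\<lambda>n. ennreal (exp (- path \<omega> (max 0 t))) * indicator {real n..} t = 0) sequentially"
            unfolding eventually_sequentially by (intro exI[of _ N]) auto
        qed
        show "AE t in lborel. ennreal (exp (- path \<omega> (max 0 t))) * indicator {real n..} t \<le>
          ennreal (exp (- path \<omega> (max 0 t))) * indicator {real 0..} t" for n
          by (intro AE_I2) (auto split: split_indicator)
      qed (use m in measurable)
      then have "(\<lambda>n. efun {real n..} (path \<omega>)) \<longlonglongrightarrow> 0" unfolding e by simp
      then have "eventually (\<lambda>n. efun {real n..} (path \<omega>) < ennreal \<eta>) sequentially"
        using eta by (intro order_tendstoD(2)) auto
      then have "eventually (\<lambda>n. indicat_real (?A n) \<omega> = 0) sequentially"
        by eventually_elim (auto simp: indicator_def dest: less_asym)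
      then show ?case by (rule tendsto_eventually)
    qed
  qed auto
  then show ?thesis by simp
qed

end

section \<open>Small values of the exponential functional\<close>

lemma le_of_ennreal_exp_mult_le:
  assumes "0 \<le> s" "ennreal (exp s) * a \<le> b" shows "a \<le> b"
proof -
  have "1 * a \<le> ennreal (exp s) * a" using assms(1) by (intro mult_right_mono) auto
  with assms(2) show ?thesis by simp
qed

context spectrally_positive_up begin

lemma sets_shift_tau:
  assumes s: "0 \<le> s" and [measurable]: "Measurable.pred skorokhod_space P" "Measurable.pred skorokhod_space Q"
  shows "{\<omega> \<in> space M. dies s (path \<omega>) \<and> P (path \<omega>) \<and> Q (shift (tau s (path \<omega>)) (path \<omega>))} \<in> events"
proof -
  have [measurable]: "(\<lambda>w. shift (max 0 (tau s w)) w) \<in> measurable skorokhod_space skorokhod_space"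
    by (rule measurable_shift_at) auto
  have "{\<omega> \<in> space M. dies s (path \<omega>) \<and> P (path \<omega>) \<and> Q (shift (tau s (path \<omega>)) (path \<omega>))} =
      {\<omega> \<in> space M. dies s (path \<omega>) \<and> P (path \<omega>) \<and> Q (shift (max 0 (tau s (path \<omega>))) (path \<omega>))}"
    using tau_path_nonneg[OF _ _ s] by (auto simp: max_absorb2)
  also have "\<dots> \<in> events" by measurable
  finally show ?thesis .
qed

lemma strong_markov_prob:
  assumes s: "0 \<le> s" and P: "adapted s P"
    and [measurable]: "Measurable.pred skorokhod_space P" "Measurable.pred skorokhod_space Q"
  shows "prob {\<omega> \<in> space M. dies s (path \<omega>) \<and> P (path \<omega>) \<and> Q (shift (tau s (path \<omega>)) (path \<omega>))} =
    prob {\<omega> \<in> space M. dies s (path \<omega>) \<and> P (path \<omega>)} * prob {\<omega> \<in> space M. Q (path \<omega>)}"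
proof -
  let ?A = "{\<omega> \<in> space M. dies s (path \<omega>) \<and> P (path \<omega>) \<and> Q (shift (tau s (path \<omega>)) (path \<omega>))}"
  let ?B = "{\<omega> \<in> space M. dies s (path \<omega>) \<and> P (path \<omega>)}"
  let ?C = "{\<omega> \<in> space M. Q (path \<omega>)}"
  note [measurable] = sets_shift_tau[OF s assms(3,4)]
  have "ennreal (prob ?A) = (\<integral>\<^sup>+\<omega>. indicator ?A \<omega> \<partial>M)" by (simp add: emeasure_eq_measure)
  also have "\<dots> = (\<integral>\<^sup>+\<omega>. indicator {w. P w} (path \<omega>) * indicator {w. dies s w} (path \<omega>) *
      indicator {w. Q w} (shift (tau s (path \<omega>)) (path \<omega>)) \<partial>M)"
    by (rule nn_integral_cong) (auto split: split_indicator)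
  also have "\<dots> = (\<integral>\<^sup>+\<omega>. indicator {w. P w} (path \<omega>) * indicator {w. dies s w} (path \<omega>) \<partial>M) *
      (\<integral>\<^sup>+\<omega>. indicator {w. Q w} (path \<omega>) \<partial>M)"
  proof (rule strong_markov[OF s])
    show "adapted s (indicator {w. P w} :: _ \<Rightarrow> ennreal)" using P by (simp add: adapted_def indicator_def)
  qed (auto split: split_indicator)
  also have "(\<integral>\<^sup>+\<omega>. indicator {w. P w} (path \<omega>) * indicator {w. dies s w} (path \<omega>) \<partial>M) = (\<integral>\<^sup>+\<omega>. indicator ?B \<omega> \<partial>M)"
    by (rule nn_integral_cong) (auto split: split_indicator)
  also have "(\<integral>\<^sup>+\<omega>. indicator {w. Q w} (path \<omega>) \<partial>M) = (\<integral>\<^sup>+\<omega>. indicator ?C \<omega> \<partial>M)"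
    by (rule nn_integral_cong) (auto split: split_indicator)
  finally show ?thesis by (simp add: emeasure_eq_measure ennreal_mult[symmetric])
qed

lemma adapted_True: "adapted s (\<lambda>_. True)"
  by (simp add: adapted_def)

lemma adapted_efun: "adapted s (\<lambda>w. efun {0..<tau s w} w \<le> y)"
  by (simp add: adapted_def efun_tau_stop)

text \<open>If the level is passed, the remainder of the path has the smaller tail integral and is
  an independent copy, so \<open>dies\<close> takes at most its proportional share of the event. The
  case \<open>T = 0\<close> yields the domination, large \<open>T\<close> the uniform control of
  tails.\<close>

lemma conditioning_increases:
  assumes T: "0 \<le> T" and d: "0 \<le> \<delta>"
  shows "(1 - exp (- kap * \<delta>)) * prob {\<omega> \<in> space M. efun {T..} (path \<omega>) \<le> y} \<le>
    prob {\<omega> \<in> space M. \<not> dies \<delta> (path \<omega>) \<and> efun {T..} (path \<omega>) \<le> y}"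
proof -
  have [measurable]: "Measurable.pred skorokhod_space (\<lambda>w. efun {T..} w \<le> y)" using T by measurable
  let ?U = "prob {\<omega> \<in> space M. efun {T..} (path \<omega>) \<le> y}"
  have "prob {\<omega> \<in> space M. dies \<delta> (path \<omega>) \<and> efun {T..} (path \<omega>) \<le> y} \<le>
      prob {\<omega> \<in> space M. dies \<delta> (path \<omega>) \<and> True \<and> efun {T..} (shift (tau \<delta> (path \<omega>)) (path \<omega>)) \<le> y}"
  proof (rule finite_measure_mono)
    show "{\<omega> \<in> space M. dies \<delta> (path \<omega>) \<and> efun {T..} (path \<omega>) \<le> y} \<subseteq>
        {\<omega> \<in> space M. dies \<delta> (path \<omega>) \<and> True \<and> efun {T..} (shift (tau \<delta> (path \<omega>)) (path \<omega>)) \<le> y}"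
      using efun_shift_tau[OF path_good d _ T] le_of_ennreal_exp_mult_le[OF d] by (blast intro: order_trans)
    show "{\<omega> \<in> space M. dies \<delta> (path \<omega>) \<and> True \<and> efun {T..} (shift (tau \<delta> (path \<omega>)) (path \<omega>)) \<le> y} \<in> events"
      by (rule sets_shift_tau[OF d]) measurable
  qed
  also have "\<dots> = prob {\<omega> \<in> space M. dies \<delta> (path \<omega>) \<and> True} * ?U"
    by (rule strong_markov_prob[OF d adapted_True]) measurable
  also have "\<dots> = exp (- kap * \<delta>) * ?U" using prob_dies[OF d] by simp
  finally have 1: "prob {\<omega> \<in> space M. dies \<delta> (path \<omega>) \<and> efun {T..} (path \<omega>) \<le> y} \<le> exp (- kap * \<delta>) * ?U" .
  have "?U = prob ({\<omega> \<in> space M. dies \<delta> (path \<omega>) \<and> efun {T..} (path \<omega>) \<le> y} \<union>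
      {\<omega> \<in> space M. \<not> dies \<delta> (path \<omega>) \<and> efun {T..} (path \<omega>) \<le> y})"
    by (rule arg_cong[of _ _ prob]) auto
  also have "\<dots> \<le> prob {\<omega> \<in> space M. dies \<delta> (path \<omega>) \<and> efun {T..} (path \<omega>) \<le> y} +
      prob {\<omega> \<in> space M. \<not> dies \<delta> (path \<omega>) \<and> efun {T..} (path \<omega>) \<le> y}"
    by (rule measure_Un_le) measurable
  finally show ?thesis using 1 by (simp add: algebra_simps)
qed

definition small :: "real \<Rightarrow> real" where
  "small y = prob {\<omega> \<in> space M. efun {0..} (path \<omega>) \<le> ennreal y}"

text \<open>Divided by \<open>1 - exp (- kap * \<delta>)\<close>, this is the law of the functional
  conditioned on never passing \<delta>, without the shift of the starting point.\<close>

definition small_alive :: "real \<Rightarrow> real \<Rightarrow> real" where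
  "small_alive \<delta> y = prob {\<omega> \<in> space M. \<not> dies \<delta> (path \<omega>) \<and> efun {0..} (path \<omega>) \<le> ennreal y}"

lemma small_nonneg: "0 \<le> small y" "0 \<le> small_alive \<delta> y"
  by (simp_all add: small_def small_alive_def)

lemma small_alive_mono: "y \<le> z \<Longrightarrow> small_alive \<delta> y \<le> small_alive \<delta> z"
  unfolding small_alive_def by (rule finite_measure_mono) (auto intro: order_trans ennreal_leI)

text \<open>In the splitting at \<open>tau s\<close>, both the part before the passage and the
  functional of the remainder are at most the whole; the strong Markov property factorizes the
  enlarged event.\<close>

lemma efun_prob_step_le:
  assumes s: "0 \<le> s" and [measurable]: "Measurable.pred skorokhod_space Q"
  shows "prob {\<omega> \<in> space M. dies s (path \<omega>) \<and> Q (shift (tau s (path \<omega>)) (path \<omega>)) \<and> efun {0..} (path \<omega>) \<le> y} \<le>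
    prob {\<omega> \<in> space M. dies s (path \<omega>) \<and> efun {0..<tau s (path \<omega>)} (path \<omega>) \<le> y} *
    prob {\<omega> \<in> space M. Q (path \<omega>) \<and> efun {0..} (path \<omega>) \<le> y}"
proof -
  have "prob {\<omega> \<in> space M. dies s (path \<omega>) \<and> Q (shift (tau s (path \<omega>)) (path \<omega>)) \<and> efun {0..} (path \<omega>) \<le> y} \<le>
    prob {\<omega> \<in> space M. dies s (path \<omega>) \<and> efun {0..<tau s (path \<omega>)} (path \<omega>) \<le> y \<and>
      (Q (shift (tau s (path \<omega>)) (path \<omega>)) \<and> efun {0..} (shift (tau s (path \<omega>)) (path \<omega>)) \<le> y)}"
  proof (rule finite_measure_mono)
    show "{\<omega> \<in> space M. dies s (path \<omega>) \<and> efun {0..<tau s (path \<omega>)} (path \<omega>) \<le> y \<and>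
      (Q (shift (tau s (path \<omega>)) (path \<omega>)) \<and> efun {0..} (shift (tau s (path \<omega>)) (path \<omega>)) \<le> y)} \<in> events"
      by (rule sets_shift_tau[OF s]) measurable
    show "{\<omega> \<in> space M. dies s (path \<omega>) \<and> Q (shift (tau s (path \<omega>)) (path \<omega>)) \<and> efun {0..} (path \<omega>) \<le> y} \<subseteq>
      {\<omega> \<in> space M. dies s (path \<omega>) \<and> efun {0..<tau s (path \<omega>)} (path \<omega>) \<le> y \<and>
      (Q (shift (tau s (path \<omega>)) (path \<omega>)) \<and> efun {0..} (shift (tau s (path \<omega>)) (path \<omega>)) \<le> y)}"
    proof (rule subsetI, clarsimp)
      fix \<omega> assume w: "\<omega> \<in> space M" "dies s (path \<omega>)" "efun {0..} (path \<omega>) \<le> y"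
      have "efun {0..<tau s (path \<omega>)} (path \<omega>) \<le> efun {0..} (path \<omega>)" by (rule efun_mono_set) auto
      moreover have "efun {0..} (shift (tau s (path \<omega>)) (path \<omega>)) \<le> efun {0..} (path \<omega>)"
        using efun_shift_tau[OF path_good[OF w(1)] s w(2), of 0] le_of_ennreal_exp_mult_le[OF s] by simp
      ultimately show "efun {0..<tau s (path \<omega>)} (path \<omega>) \<le> y \<and> efun {0..} (shift (tau s (path \<omega>)) (path \<omega>)) \<le> y"
        using w(3) by (meson order_trans)
    qed
  qed
  also have "\<dots> = prob {\<omega> \<in> space M. dies s (path \<omega>) \<and> efun {0..<tau s (path \<omega>)} (path \<omega>) \<le> y} *
    prob {\<omega> \<in> space M. Q (path \<omega>) \<and> efun {0..} (path \<omega>) \<le> y}"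
    by (rule strong_markov_prob[OF s adapted_efun]) measurable
  finally show ?thesis .
qed

text \<open>Conversely, a budget \<open>\<alpha>\<close> before the passage and
  \<open>exp (- s) * \<beta>\<close> for the remainder keep the whole below
  \<open>\<alpha> + \<beta>\<close>. The remainder is not allowed to descend by \<delta>, which
  makes these events disjoint for different grid levels.\<close>

lemma efun_prob_step_ge:
  assumes s: "0 \<le> s" and a: "0 \<le> \<alpha>" and b: "0 \<le> \<beta>" and d: "0 \<le> \<delta>"
  shows "prob {\<omega> \<in> space M. dies s (path \<omega>) \<and> efun {0..<tau s (path \<omega>)} (path \<omega>) \<le> ennreal \<alpha>} *
      small_alive \<delta> (exp (- s) * \<beta>) \<le>
    prob {\<omega> \<in> space M. dies s (path \<omega>) \<and> \<not> dies (s + \<delta>) (path \<omega>) \<and> efun {0..} (path \<omega>) \<le> ennreal (\<alpha> + \<beta>)}"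
proof -
  have "prob {\<omega> \<in> space M. dies s (path \<omega>) \<and> efun {0..<tau s (path \<omega>)} (path \<omega>) \<le> ennreal \<alpha>} *
      small_alive \<delta> (exp (- s) * \<beta>) =
    prob {\<omega> \<in> space M. dies s (path \<omega>) \<and> efun {0..<tau s (path \<omega>)} (path \<omega>) \<le> ennreal \<alpha> \<and>
      (\<not> dies \<delta> (shift (tau s (path \<omega>)) (path \<omega>)) \<and>
       efun {0..} (shift (tau s (path \<omega>)) (path \<omega>)) \<le> ennreal (exp (- s) * \<beta>))}"
    unfolding small_alive_def by (rule strong_markov_prob[OF s adapted_efun, symmetric]) measurable
  also have "\<dots> \<le> prob {\<omega> \<in> space M. dies s (path \<omega>) \<and> \<not> dies (s + \<delta>) (path \<omega>) \<and> efun {0..} (path \<omega>) \<le> ennreal (\<alpha> + \<beta>)}"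
  proof (rule finite_measure_mono)
    show "{\<omega> \<in> space M. dies s (path \<omega>) \<and> efun {0..<tau s (path \<omega>)} (path \<omega>) \<le> ennreal \<alpha> \<and>
      (\<not> dies \<delta> (shift (tau s (path \<omega>)) (path \<omega>)) \<and>
       efun {0..} (shift (tau s (path \<omega>)) (path \<omega>)) \<le> ennreal (exp (- s) * \<beta>))} \<subseteq>
      {\<omega> \<in> space M. dies s (path \<omega>) \<and> \<not> dies (s + \<delta>) (path \<omega>) \<and> efun {0..} (path \<omega>) \<le> ennreal (\<alpha> + \<beta>)}"
    proof (rule subsetI, clarsimp)
      fix \<omega> assume w: "\<omega> \<in> space M" "dies s (path \<omega>)"
        and A: "efun {0..<tau s (path \<omega>)} (path \<omega>) \<le> ennreal \<alpha>"
        and n: "\<not> dies \<delta> (shift (tau s (path \<omega>)) (path \<omega>))"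
        and B: "efun {0..} (shift (tau s (path \<omega>)) (path \<omega>)) \<le> ennreal (exp (- s) * \<beta>)"
      have "ennreal (exp s) * efun {0..} (shift (tau s (path \<omega>)) (path \<omega>)) \<le> ennreal (exp s) * ennreal (exp (- s) * \<beta>)"
        using B by (rule mult_left_mono) simp
      also have "\<dots> = ennreal \<beta>" using b by (simp add: ennreal_mult[symmetric] mult.assoc[symmetric] exp_add[symmetric])
      finally have "efun {0..} (path \<omega>) \<le> ennreal \<alpha> + ennreal \<beta>"
        unfolding efun_split_tau[OF path_good[OF w(1)] s w(2)] by (rule add_mono[OF A])
      then show "\<not> dies (s + \<delta>) (path \<omega>) \<and> efun {0..} (path \<omega>) \<le> ennreal (\<alpha> + \<beta>)"
        using n dies_add[OF path_good[OF w(1)] s d] a b by (simp add: ennreal_plus)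
    qed
  qed measurable
  finally show ?thesis .
qed

text \<open>Markov's inequality for one minus the discounted passage indicator, which is at least
  \<open>1 - exp (- q * T)\<close> when there is no passage before \<open>T\<close>.\<close>

lemma prob_tau_small:
  assumes q: "0 < q" and s: "0 \<le> s" and T: "0 < T"
  shows "1 - (1 - exp (- s * phi q)) / (1 - exp (- q * T)) \<le> prob {\<omega> \<in> space M. dies s (path \<omega>) \<and> tau s (path \<omega>) < T}"
proof -
  let ?A = "{\<omega> \<in> space M. dies s (path \<omega>) \<and> tau s (path \<omega>) < T}"
  have c: "0 < 1 - exp (- q * T)" using q T by simp
  have ib: "integrable M (\<lambda>\<omega>. indicator {w. dies s w} (path \<omega>) * exp (- q * tau s (path \<omega>)) :: real)"
    using q s by (intro lap_integrable) auto
  have ia: "integrable M (indicat_real ?A)"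
    by (intro integrable_real_indicator) (auto simp: emeasure_eq_measure)
  have "(\<integral>\<omega>. (1 - exp (- q * T)) * (1 - indicator ?A \<omega>) \<partial>M) \<le>
      (\<integral>\<omega>. 1 - indicator {w. dies s w} (path \<omega>) * exp (- q * tau s (path \<omega>)) \<partial>M)"
  proof (rule integral_mono)
    show "integrable M (\<lambda>\<omega>. (1 - exp (- q * T)) * (1 - indicator ?A \<omega>))"
      using ia by (intro integrable_mult_right Bochner_Integration.integrable_diff) auto
    show "integrable M (\<lambda>\<omega>. 1 - indicator {w. dies s w} (path \<omega>) * exp (- q * tau s (path \<omega>)))"
      using ib by simp
    fix \<omega> assume w: "\<omega> \<in> space M"
    show "(1 - exp (- q * T)) * (1 - indicator ?A \<omega>) \<le> 1 - indicator {w. dies s w} (path \<omega>) * exp (- q * tau s (path \<omega>))"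
      using w q tau_path_nonneg[OF w _ s] by (auto split: split_indicator)
  qed
  then have "(1 - exp (- q * T)) * (1 - prob ?A) \<le> 1 - lap q s"
    using ia ib by (simp add: lap_def prob_space)
  then have "1 - prob ?A \<le> (1 - exp (- s * phi q)) / (1 - exp (- q * T))"
    using c q s by (simp add: lap_exp pos_le_divide_eq mult.commute)
  then show ?thesis by simp
qed

text \<open>Outside this event, \<open>Z\<close> stays below \<open>a\<close> until the passage below \<open>- r\<close>.\<close>

definition bad :: "real \<Rightarrow> real \<Rightarrow> real \<Rightarrow> real" where
  "bad a e r = prob {\<omega> \<in> space M. (\<exists>t\<ge>0. t < e \<and> a < path \<omega> t) \<or> \<not> (dies r (path \<omega>) \<and> tau r (path \<omega>) < e)}"

text \<open>Outside the bad event the path is at most \<open>a\<close> up to \<open>tau s\<close>,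
  so a functional at most \<open>x\<close> forces \<open>q * tau s \<le> 1\<close> for
  \<open>q = exp (- a) / x\<close>. Then the indicator is at most
  \<open>exp 1 * exp (- q * tau s)\<close>; this is the origin of Euler's number.\<close>

lemma prob_efun_tau_le:
  assumes x: "0 < x" and s: "0 \<le> s" "s \<le> r"
  shows "prob {\<omega> \<in> space M. dies s (path \<omega>) \<and> efun {0..<tau s (path \<omega>)} (path \<omega>) \<le> ennreal x} \<le>
    exp 1 * exp (- s * phi (exp (- a) / x)) + bad a e r"
proof -
  let ?B = "{\<omega> \<in> space M. (\<exists>t\<ge>0. t < e \<and> a < path \<omega> t) \<or> \<not> (dies r (path \<omega>) \<and> tau r (path \<omega>) < e)}"
  let ?A = "{\<omega> \<in> space M. dies s (path \<omega>) \<and> efun {0..<tau s (path \<omega>)} (path \<omega>) \<le> ennreal x}"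
  let ?q = "exp (- a) / x"
  have ia: "integrable M (indicat_real ?A)" and ibd: "integrable M (indicat_real ?B)"
    by (intro integrable_real_indicator; simp add: emeasure_eq_measure)+
  have ib: "integrable M (\<lambda>\<omega>. indicator {w. dies s w} (path \<omega>) * exp (- ?q * tau s (path \<omega>)) :: real)"
    using x s by (intro lap_integrable) auto
  have "(\<integral>\<omega>. indicator ?A \<omega> \<partial>M) \<le>
      (\<integral>\<omega>. exp 1 * (indicator {w. dies s w} (path \<omega>) * exp (- ?q * tau s (path \<omega>))) + indicator ?B \<omega> \<partial>M)"
  proof (rule integral_mono[OF ia])
    show "integrable M (\<lambda>\<omega>. exp 1 * (indicator {w. dies s w} (path \<omega>) * exp (- ?q * tau s (path \<omega>))) + indicator ?B \<omega>)"
      using ib ibd by (intro Bochner_Integration.integrable_add integrable_mult_right)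
    fix \<omega> assume w: "\<omega> \<in> space M"
    show "indicator ?A \<omega> \<le> exp 1 * (indicator {w. dies s w} (path \<omega>) * exp (- ?q * tau s (path \<omega>))) + indicat_real ?B \<omega>"
    proof (cases "\<omega> \<in> ?A \<and> \<omega> \<notin> ?B")
      case True
      then have d: "dies s (path \<omega>)" and A: "efun {0..<tau s (path \<omega>)} (path \<omega>) \<le> ennreal x"
        and dr: "dies r (path \<omega>)" "tau r (path \<omega>) < e" and le: "\<And>t. 0 \<le> t \<Longrightarrow> t < e \<Longrightarrow> path \<omega> t \<le> a"
        using w by (auto simp: not_less)
      have "tau s (path \<omega>) \<le> tau r (path \<omega>)" by (rule tau_mono[OF s(2) dr(1)])
      then have "ennreal (exp (- a) * tau s (path \<omega>)) \<le> efun {0..<tau s (path \<omega>)} (path \<omega>)"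
        using le dr(2) tau_path_nonneg[OF w d s(1)] by (intro efun_ge) auto
      then have "ennreal (exp (- a) * tau s (path \<omega>)) \<le> ennreal x" using A by (rule order_trans)
      then have "exp (- a) * tau s (path \<omega>) \<le> x" using x by (simp add: ennreal_le_iff)
      then have "?q * tau s (path \<omega>) \<le> 1" using x by (simp add: divide_le_eq)
      then have "1 \<le> exp (1 - ?q * tau s (path \<omega>))" by simp
      also have "\<dots> = exp 1 * exp (- ?q * tau s (path \<omega>))" by (simp add: exp_add[symmetric])
      finally show ?thesis using True d by (simp add: indicator_def)
    qed (auto split: split_indicator)
  qed
  also have "\<dots> = exp 1 * lap ?q s + prob ?B"
    using ib ibd by (subst Bochner_Integration.integral_add) (auto simp: lap_def intro!: integrable_mult_right)
  finally show ?thesis using x s by (simp add: lap_exp bad_def)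
qed

text \<open>Induction over the grid levels below \<open>r\<close>: a path whose last passed level is
  \<open>k * \<delta>\<close> contributes at most the bound of \<open>prob_efun_tau_le\<close> times
  \<open>small_alive\<close>. Paths that pass \<open>r\<close> contribute a small multiple of
  \<open>small x\<close>, which is moved to the left.\<close>

lemma small_lower_estimate:
  fixes a e :: real
  assumes x: "0 < x" and r: "0 < r" and n: "0 < n"
  defines "b \<equiv> bad a e r" and "f \<equiv> phi (exp (- a) / x)" and "\<delta> \<equiv> r / real n"
  shows "small x * (1 - exp 1 * exp (- r * f) - b) \<le>
    small_alive \<delta> x * (exp 1 * (\<Sum>k<n. exp (- (real k * \<delta>) * f)) + real n * b)"
proof -
  have d: "0 \<le> \<delta>" using r by (simp add: \<delta>_def)
  have step: "prob {\<omega> \<in> space M. \<not> dies (real m * \<delta>) (path \<omega>) \<and> efun {0..} (path \<omega>) \<le> ennreal x} \<le>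
      small_alive \<delta> x * (\<Sum>k<m. exp 1 * exp (- (real k * \<delta>) * f) + b)" if "m \<le> n" for m
    using that
  proof (induction m)
    \<comment> \<open>Level 0 is almost surely passed, so the empty sum is correct.\<close>
    case 0
    have "prob {\<omega> \<in> space M. \<not> dies 0 (path \<omega>) \<and> efun {0..} (path \<omega>) \<le> ennreal x} \<le> prob {\<omega> \<in> space M. \<not> dies 0 (path \<omega>)}"
      by (rule finite_measure_mono) auto
    then show ?case using prob_not_dies[of 0] by simp
  next
    case (Suc m)
    let ?s = "real m * \<delta>"
    have s: "0 \<le> ?s" "?s \<le> r" using d Suc.prems r n
      by (auto simp: \<delta>_def divide_le_eq mult_left_mono mult.commute)
    have e: "real (Suc m) * \<delta> = ?s + \<delta>" by (simp add: algebra_simps)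
    have "prob {\<omega> \<in> space M. \<not> dies (real (Suc m) * \<delta>) (path \<omega>) \<and> efun {0..} (path \<omega>) \<le> ennreal x} \<le>
        prob ({\<omega> \<in> space M. \<not> dies ?s (path \<omega>) \<and> efun {0..} (path \<omega>) \<le> ennreal x} \<union>
         {\<omega> \<in> space M. dies ?s (path \<omega>) \<and> \<not> dies (?s + \<delta>) (path \<omega>) \<and> efun {0..} (path \<omega>) \<le> ennreal x})"
      unfolding e by (rule finite_measure_mono) auto
    also have "\<dots> \<le> prob {\<omega> \<in> space M. \<not> dies ?s (path \<omega>) \<and> efun {0..} (path \<omega>) \<le> ennreal x} +
        prob {\<omega> \<in> space M. dies ?s (path \<omega>) \<and> \<not> dies (?s + \<delta>) (path \<omega>) \<and> efun {0..} (path \<omega>) \<le> ennreal x}"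
      by (rule measure_Un_le) measurable
    \<comment> \<open>Seen from the passage of the current level, not reaching the next one is an
      event of the remainder alone.\<close>
    also have "{\<omega> \<in> space M. dies ?s (path \<omega>) \<and> \<not> dies (?s + \<delta>) (path \<omega>) \<and> efun {0..} (path \<omega>) \<le> ennreal x} =
        {\<omega> \<in> space M. dies ?s (path \<omega>) \<and> \<not> dies \<delta> (shift (tau ?s (path \<omega>)) (path \<omega>)) \<and> efun {0..} (path \<omega>) \<le> ennreal x}"
      using dies_add[OF path_good s(1) d] by blast
    also have "prob \<dots> \<le> prob {\<omega> \<in> space M. dies ?s (path \<omega>) \<and> efun {0..<tau ?s (path \<omega>)} (path \<omega>) \<le> ennreal x} * small_alive \<delta> x"
      unfolding small_alive_def by (rule efun_prob_step_le[OF s(1), where Q = "\<lambda>w. \<not> dies \<delta> w"]) measurable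
    also have "\<dots> \<le> (exp 1 * exp (- ?s * f) + b) * small_alive \<delta> x"
      unfolding f_def b_def by (intro mult_right_mono prob_efun_tau_le x s small_nonneg)
    finally show ?case using Suc by (simp add: algebra_simps)
  qed
  have "real n * \<delta> = r" using n by (simp add: \<delta>_def)
  then have 1: "prob {\<omega> \<in> space M. \<not> dies r (path \<omega>) \<and> efun {0..} (path \<omega>) \<le> ennreal x} \<le>
      small_alive \<delta> x * (exp 1 * (\<Sum>k<n. exp (- (real k * \<delta>) * f)) + real n * b)"
    using step[OF order_refl] by (simp add: sum.distrib sum_distrib_left)
  have "small x \<le> prob ({\<omega> \<in> space M. \<not> dies r (path \<omega>) \<and> efun {0..} (path \<omega>) \<le> ennreal x} \<union>
      {\<omega> \<in> space M. dies r (path \<omega>) \<and> True \<and> efun {0..} (path \<omega>) \<le> ennreal x})"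
    unfolding small_def by (rule finite_measure_mono) auto
  also have "\<dots> \<le> prob {\<omega> \<in> space M. \<not> dies r (path \<omega>) \<and> efun {0..} (path \<omega>) \<le> ennreal x} +
      prob {\<omega> \<in> space M. dies r (path \<omega>) \<and> True \<and> efun {0..} (path \<omega>) \<le> ennreal x}"
    by (rule measure_Un_le) measurable
  also have "prob {\<omega> \<in> space M. dies r (path \<omega>) \<and> True \<and> efun {0..} (path \<omega>) \<le> ennreal x} \<le>
      prob {\<omega> \<in> space M. dies r (path \<omega>) \<and> efun {0..<tau r (path \<omega>)} (path \<omega>) \<le> ennreal x} *
      prob {\<omega> \<in> space M. True \<and> efun {0..} (path \<omega>) \<le> ennreal x}"
    by (rule efun_prob_step_le[where Q = "\<lambda>_. True"]) (use r in auto)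
  also have "\<dots> \<le> (exp 1 * exp (- r * f) + b) * small x"
  proof -
    have "prob {\<omega> \<in> space M. dies r (path \<omega>) \<and> efun {0..<tau r (path \<omega>)} (path \<omega>) \<le> ennreal x} \<le>
        exp 1 * exp (- r * f) + b"
      unfolding f_def b_def by (rule prob_efun_tau_le[OF x]) (use r in auto)
    from mult_right_mono[OF this small_nonneg(1)[of x]] show ?thesis by (simp add: small_def)
  qed
  finally show ?thesis using 1 by (simp add: algebra_simps)
qed

text \<open>The \<open>n\<close> events of having \<open>k * \<delta>\<close> as last passed level,
  for \<open>k\<close> from 1 to \<open>n\<close>, are disjoint. A quick passage of
  \<open>s0\<close> bounds the functional before every one of these levels by \<alpha>, so the
  single constant \<open>c\<close> serves them all.\<close>

lemma small_upper_estimate: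
  assumes s0: "0 < s0" and n: "0 < n" and a: "0 < \<alpha>" and b: "0 \<le> \<beta>"
  defines "c \<equiv> prob {\<omega> \<in> space M. dies s0 (path \<omega>) \<and> tau s0 (path \<omega>) < exp (- s0) * \<alpha>}"
    and "\<delta> \<equiv> s0 / real n"
  shows "real n * (c * small_alive \<delta> (exp (- s0) * \<beta>)) \<le> small (\<alpha> + \<beta>)"
proof -
  have d: "0 \<le> \<delta>" using s0 by (simp add: \<delta>_def)
  let ?y = "ennreal (\<alpha> + \<beta>)"
  let ?E = "\<lambda>m. {\<omega> \<in> space M. dies \<delta> (path \<omega>) \<and> \<not> dies (real (Suc m) * \<delta>) (path \<omega>) \<and> efun {0..} (path \<omega>) \<le> ?y}"
  have "real m * (c * small_alive \<delta> (exp (- s0) * \<beta>)) \<le> prob (?E m)" if "m \<le> n" for m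
    using that
  proof (induction m)
    case (Suc m)
    let ?s = "real (Suc m) * \<delta>"
    have s: "0 \<le> ?s" "\<delta> \<le> ?s" using d by (auto simp: algebra_simps)
    have "real (Suc m) \<le> real n" using Suc.prems by simp
    then have "real (Suc m) * s0 \<le> real n * s0" using s0 by (intro mult_right_mono) auto
    then have ss: "?s \<le> s0" using n by (simp add: \<delta>_def divide_le_eq mult.commute)
    have e: "real (Suc (Suc m)) * \<delta> = ?s + \<delta>" by (simp add: algebra_simps)
    let ?F = "{\<omega> \<in> space M. dies ?s (path \<omega>) \<and> \<not> dies (?s + \<delta>) (path \<omega>) \<and> efun {0..} (path \<omega>) \<le> ?y}"
    have "c \<le> prob {\<omega> \<in> space M. dies ?s (path \<omega>) \<and> efun {0..<tau ?s (path \<omega>)} (path \<omega>) \<le> ennreal \<alpha>}"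
      unfolding c_def
    proof (rule finite_measure_mono, rule subsetI, clarsimp simp del: of_nat_Suc)
      fix \<omega> assume w: "\<omega> \<in> space M" "dies s0 (path \<omega>)" "tau s0 (path \<omega>) < exp (- s0) * \<alpha>"
      have ds: "dies ?s (path \<omega>)" by (rule dies_antimono[OF ss w(2)])
      have "exp ?s * tau ?s (path \<omega>) \<le> exp s0 * tau s0 (path \<omega>)"
        using ss tau_mono[OF ss w(2)] tau_path_nonneg[OF w(1) ds s(1)] by (intro mult_mono) auto
      also have "\<dots> \<le> exp s0 * (exp (- s0) * \<alpha>)" using w(3) by (intro mult_left_mono) auto
      also have "\<dots> = \<alpha>" by (simp add: mult.assoc[symmetric] exp_add[symmetric])
      finally have "ennreal (exp ?s * tau ?s (path \<omega>)) \<le> ennreal \<alpha>" by (rule ennreal_leI)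
      with efun_tau_le[OF path_good[OF w(1)] s(1) ds]
      show "dies ?s (path \<omega>) \<and> efun {0..<tau ?s (path \<omega>)} (path \<omega>) \<le> ennreal \<alpha>"
        using ds by (auto intro: order_trans)
    qed measurable
    moreover have "small_alive \<delta> (exp (- s0) * \<beta>) \<le> small_alive \<delta> (exp (- ?s) * \<beta>)"
      using ss b by (intro small_alive_mono mult_right_mono) auto
    ultimately have "c * small_alive \<delta> (exp (- s0) * \<beta>) \<le>
        prob {\<omega> \<in> space M. dies ?s (path \<omega>) \<and> efun {0..<tau ?s (path \<omega>)} (path \<omega>) \<le> ennreal \<alpha>} *
        small_alive \<delta> (exp (- ?s) * \<beta>)"
      by (intro mult_mono small_nonneg) (auto simp: c_def)
    also have "\<dots> \<le> prob ?F" using a b d s by (intro efun_prob_step_ge) auto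
    finally have "c * small_alive \<delta> (exp (- s0) * \<beta>) \<le> prob ?F" .
    then have "real (Suc m) * (c * small_alive \<delta> (exp (- s0) * \<beta>)) \<le> prob (?E m) + prob ?F"
      using Suc by (simp add: algebra_simps)
    also have "\<dots> = prob (?E m \<union> ?F)"
      by (rule finite_measure_Union[symmetric]) (measurable, auto)
    also have "\<dots> \<le> prob (?E (Suc m))"
    proof (rule finite_measure_mono)
      have "dies \<delta> w" if "dies ?s w" for w using dies_antimono[OF s(2) that] .
      moreover have "\<not> dies (?s + \<delta>) w" if "\<not> dies ?s w" for w using that dies_antimono[of ?s "?s + \<delta>" w] d by auto
      ultimately show "?E m \<union> ?F \<subseteq> ?E (Suc m)" unfolding e by blast
    qed measurable
    finally show ?case .
  qed simp
  from this[OF order_refl] have "real n * (c * small_alive \<delta> (exp (- s0) * \<beta>)) \<le> prob (?E n)" .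
  also have "\<dots> \<le> small (\<alpha> + \<beta>)" unfolding small_def by (rule finite_measure_mono) auto
  finally show ?thesis .
qed

lemma bad_le:
  assumes e: "0 < e" and r: "0 \<le> r"
  shows "bad a e r \<le> prob {\<omega> \<in> space M. \<exists>t\<ge>0. t < e \<and> a < path \<omega> t} + (1 - exp (- r * phi 1)) / (1 - exp (- e))"
proof -
  have "bad a e r \<le> prob ({\<omega> \<in> space M. \<exists>t\<ge>0. t < e \<and> a < path \<omega> t} \<union>
      {\<omega> \<in> space M. \<not> (dies r (path \<omega>) \<and> tau r (path \<omega>) < e)})"
    unfolding bad_def by (rule finite_measure_mono) auto
  also have "\<dots> \<le> prob {\<omega> \<in> space M. \<exists>t\<ge>0. t < e \<and> a < path \<omega> t} +
      prob {\<omega> \<in> space M. \<not> (dies r (path \<omega>) \<and> tau r (path \<omega>) < e)}"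
    by (rule measure_Un_le) measurable
  also have "prob {\<omega> \<in> space M. \<not> (dies r (path \<omega>) \<and> tau r (path \<omega>) < e)} =
      1 - prob {\<omega> \<in> space M. dies r (path \<omega>) \<and> tau r (path \<omega>) < e}"
    by (rule prob_neg) measurable
  finally show ?thesis using prob_tau_small[OF zero_less_one r e] by simp
qed

text \<open>The events decrease to the empty set, as paths start at 0 and are right-continuous
  there.\<close>

lemma prob_early_high:
  assumes a: "0 < a"
  shows "(\<lambda>n. prob {\<omega> \<in> space M. \<exists>t\<ge>0. t < 1 / real (Suc n) \<and> a < path \<omega> t}) \<longlonglongrightarrow> 0"
proof -
  let ?A = "\<lambda>n. {\<omega> \<in> space M. \<exists>t\<ge>0. t < 1 / real (Suc n) \<and> a < path \<omega> t}"
  have "(\<lambda>n. prob (?A n)) \<longlonglongrightarrow> prob (\<Inter>n. ?A n)"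
  proof (rule finite_Lim_measure_decseq)
    show "range ?A \<subseteq> events" by auto
    show "decseq ?A"
    proof (rule decseq_SucI, clarify)
      fix n \<omega> t assume "\<omega> \<in> space M" "0 \<le> t" "t < 1 / real (Suc (Suc n))" "a < path \<omega> t"
      moreover have "1 / real (Suc (Suc n)) \<le> 1 / real (Suc n)" by (simp add: field_simps)
      ultimately show "\<exists>t\<ge>0. t < 1 / real (Suc n) \<and> a < path \<omega> t" by (intro exI[of _ t]) linarith
    qed
  qed
  moreover have "(\<Inter>n. ?A n) = {}"
  proof (rule equals0I)
    fix \<omega> assume w: "\<omega> \<in> (\<Inter>n. ?A n)"
    then have ws: "\<omega> \<in> space M" by auto
    have "eventually (\<lambda>t. path \<omega> t < a) (at_right 0)"
      using cadlag_right[OF path_cadlag[OF ws], of 0] Z_0[OF ws] a by (intro order_tendstoD) auto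
    then obtain d where d: "0 < d" "\<And>t. 0 < t \<Longrightarrow> t < d \<Longrightarrow> path \<omega> t < a"
      by (auto simp: eventually_at_right_field)
    obtain n where n: "1 / real (Suc n) < d" using nat_approx_posE[OF d(1)] by auto
    from w have "\<omega> \<in> ?A n" by blast
    then obtain t where t: "0 \<le> t" "t < 1 / real (Suc n)" "a < path \<omega> t" by blast
    then show False using d(2)[of t] n Z_0[OF ws] a by (cases "t = 0") auto
  qed
  ultimately show ?thesis by simp
qed

end

section \<open>Asymptotics as \<open>x\<close> tends to 0\<close>

lemma one_minus_exp_ge:
  fixes y :: real
  assumes "0 \<le> y" "y \<le> 1" shows "y / 2 \<le> 1 - exp (- y)"
proof -
  have "exp (- y) \<le> 1 / (1 + y)"
    using exp_ge_add_one_self[of y] assms by (simp add: exp_minus inverse_eq_divide frac_le)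
  moreover have "1 - 1 / (1 + y) = y / (1 + y)" using assms by (simp add: field_simps)
  moreover have "y / 2 \<le> y / (1 + y)" using assms by (intro divide_left_mono) auto
  ultimately show ?thesis by linarith
qed

text \<open>Geometric series with \<open>1 / (1 - exp (- y)) \<le> 1 / y + 1\<close>. For
  \<open>y\<close> equal to mesh times exponent, the summand 1 is the discretization error.\<close>

lemma sum_exp_le:
  fixes y :: real
  assumes y: "0 < y" shows "(\<Sum>k<n. exp (- (real k * y))) \<le> 1 / y + 1"
proof -
  have e: "exp (- y) < 1" using y by simp
  have "(\<Sum>k<n. exp (- (real k * y))) = (\<Sum>k<n. exp (- y) ^ k)"
    by (simp add: exp_of_nat_mult[symmetric])
  also have "\<dots> = (1 - exp (- y) ^ n) / (1 - exp (- y))" using e by (simp add: sum_gp_strict)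
  also have "\<dots> \<le> 1 / (1 - exp (- y))" using e by (intro divide_right_mono) auto
  also have "\<dots> \<le> 1 / (y / (1 + y))"
  proof (rule divide_left_mono)
    have "exp (- y) \<le> 1 / (1 + y)"
      using exp_ge_add_one_self[of y] y by (simp add: exp_minus inverse_eq_divide frac_le)
    moreover have "1 - 1 / (1 + y) = y / (1 + y)" using y by (simp add: field_simps)
    ultimately show "y / (1 + y) \<le> 1 - exp (- y)" by linarith
  qed (use y e in auto)
  also have "\<dots> = 1 / y + 1" using y by (simp add: field_simps)
  finally show ?thesis .
qed

lemma tendsto_div_Suc_add: "(\<lambda>n. c / real (n + N)) \<longlonglongrightarrow> (0::real)"
  using LIMSEQ_ignore_initial_segment[OF lim_const_over_n[of c], of N] by simp

context spectrally_positive_up begin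

lemma phi_over_x: "0 < c \<Longrightarrow> filterlim (\<lambda>x. phi (c / x)) at_top (at_right 0)"
proof (rule filterlim_compose[OF phi_at_top])
  assume "0 < c"
  then have "filterlim (\<lambda>x::real. c * inverse x) at_top (at_right 0)"
    by (intro filterlim_tendsto_pos_mult_at_top[OF tendsto_const _ filterlim_inverse_at_top_right])
  then show "filterlim (\<lambda>x::real. c / x) at_top (at_right 0)" by (simp add: divide_inverse)
qed

lemma const_over_phi: "0 < c \<Longrightarrow> ((\<lambda>x. k / phi (c / x)) \<longlongrightarrow> 0) (at_right 0)"
  by (intro tendsto_divide_0[OF tendsto_const] filterlim_at_top_imp_at_infinity phi_over_x)

text \<open>Each approximation may cost \<epsilon> / 8: distortion of time, passage of the depth
  \<open>r = K / f\<close>, the bad event, and the mesh. The meshes may depend on \<open>x\<close>,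
  because the limit \<delta> to 0 is taken for fixed \<open>x\<close>.\<close>

lemma conditioned_lower_bound:
  assumes eps: "0 < \<epsilon>" "\<epsilon> < 1"
  shows "\<forall>\<^sub>F x in at_right 0. \<exists>\<delta>::nat \<Rightarrow> real. (\<forall>n. 0 < \<delta> n) \<and> \<delta> \<longlonglongrightarrow> 0 \<and>
    (\<forall>n. (1 - \<epsilon>) / (kap * exp 1) * phi (1 / x) * small x \<le> small_alive (\<delta> n) x / (1 - exp (- kap * \<delta> n)))"
proof -
  define \<theta> where "\<theta> = 1 - \<epsilon> / 8"
  have th: "0 < \<theta>" "\<theta> < 1" using eps by (auto simp: \<theta>_def)
  define a where "a = - ln \<theta>"
  have a: "0 < a" "exp (- a) = \<theta>" using th by (auto simp: a_def)
  \<comment> \<open>Chosen so that the term \<open>exp 1 * exp (- r * f)\<close> for passing the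
    depth \<open>r\<close> equals \<epsilon> / 8.\<close>
  define K where "K = 1 - ln (\<epsilon> / 8)"
  have lneg: "ln (\<epsilon> / 8) < 0" using eps by (subst ln_less_zero_iff) auto
  have K: "0 < K" "exp 1 * exp (- K) = \<epsilon> / 8"
    unfolding K_def using lneg by (linarith, use eps in \<open>simp add: exp_add[symmetric]\<close>)
  \<comment> \<open>The bad event enters once alone and once in each of the \<open>l\<close> cells.
    Relative to the main term \<open>l / K\<close> the latter is \<open>K * b\<close>, whence the
    second bound.\<close>
  define b0 where "b0 = min (\<epsilon> / 8) (\<epsilon> / (8 * K))"
  have "K * b0 \<le> K * (\<epsilon> / (8 * K))" using K(1) by (intro mult_left_mono) (auto simp: b0_def)
  also have "\<dots> = \<epsilon> / 8" using K(1) by simp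
  finally have b0: "0 < b0" "b0 \<le> \<epsilon> / 8" "K * b0 \<le> \<epsilon> / 8"
    using eps K(1) by (auto simp: b0_def)
  \<comment> \<open>Starting the cell count at \<open>N\<close> makes even the first mesh fine
    enough for the discretization error \<open>K / l\<close>.\<close>
  obtain N :: nat where N: "8 * K / \<epsilon> < real N" using reals_Archimedean2 by blast
  have "0 < 8 * K / \<epsilon>" using K eps by simp
  then have N0: "0 < N" using N by (cases N) auto
  have "eventually (\<lambda>n. prob {\<omega> \<in> space M. \<exists>t\<ge>0. t < 1 / real (Suc n) \<and> a < path \<omega> t} < b0 / 2) sequentially"
    using prob_early_high[OF a(1)] b0(1) by (intro order_tendstoD(2)) auto
  then obtain m where m: "prob {\<omega> \<in> space M. \<exists>t\<ge>0. t < 1 / real (Suc m) \<and> a < path \<omega> t} < b0 / 2"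
    by (auto simp: eventually_sequentially)
  \<comment> \<open>The time window is fixed before \<open>x\<close>. As \<open>x\<close> tends to 0
    so does \<open>r\<close>, and level \<open>r\<close> is passed within the window with
    probability close to 1.\<close>
  define e where "e = 1 / real (Suc m)"
  have e: "0 < e" by (simp add: e_def)
  have "((\<lambda>x. (1 - exp (- (K / phi (\<theta> / x)) * phi 1)) / (1 - exp (- e))) \<longlongrightarrow> (1 - exp (- 0 * phi 1)) / (1 - exp (- e))) (at_right 0)"
    using e by (intro tendsto_intros const_over_phi th) auto
  then have ev1: "eventually (\<lambda>x. (1 - exp (- (K / phi (\<theta> / x)) * phi 1)) / (1 - exp (- e)) < b0 / 2) (at_right 0)"
    using b0(1) by (intro order_tendstoD(2)) auto
  have ev2: "eventually (\<lambda>x. 1 \<le> phi (\<theta> / x)) (at_right 0)"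
    using phi_over_x[OF th(1)] by (simp add: filterlim_at_top)
  show ?thesis
    using ev1 ev2 eventually_at_right_less[of 0]
  proof eventually_elim
    case (elim x)
    define f where "f = phi (\<theta> / x)"
    define r where "r = K / f"
    have f: "1 \<le> f" using elim by (simp add: f_def)
    have r: "0 < r" "r * f = K" using K f by (auto simp: r_def)
    define b where "b = bad a e r"
    have "b \<le> b0 / 2 + b0 / 2"
      using bad_le[OF e less_imp_le[OF r(1)], of a] elim(1)[folded f_def, folded r_def] m[folded e_def]
      unfolding b_def by linarith
    then have "b \<le> b0" by simp
    with mult_left_mono[OF this less_imp_le[OF K(1)]] have b: "b \<le> \<epsilon> / 8" "K * b \<le> \<epsilon> / 8"
      using b0 by linarith+
    have bnn: "0 \<le> b" by (simp add: b_def bad_def)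
    have fphi: "\<theta> * phi (1 / x) \<le> f" using phi_scale[OF th, of "1 / x"] elim(3) by (simp add: f_def)
    define \<delta> where "\<delta> n = r / real (n + N)" for n
    have "(1 - \<epsilon>) / (kap * exp 1) * phi (1 / x) * small x \<le> small_alive (\<delta> n) x / (1 - exp (- kap * \<delta> n))" for n
    proof -
      define l where "l = real (n + N)"
      have l: "8 * K / \<epsilon> < l" "0 < l" using N N0 by (auto simp: l_def)
      have Kl: "K / l \<le> \<epsilon> / 8" using l eps by (simp add: field_simps)
      define u where "u = small x"
      define p where "p = small_alive (\<delta> n) x"
      have u: "0 \<le> u" and p: "0 \<le> p" by (auto simp: u_def p_def small_nonneg)
      have d1: "\<delta> n = r / l" by (simp add: \<delta>_def l_def)
      have d: "\<delta> n = r / l" "\<delta> n * f = K / l" "0 < \<delta> n" using r l unfolding d1 by simp_all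
      define w where "w = 1 - exp (- kap * \<delta> n)"
      have w: "0 < w" "w \<le> kap * \<delta> n"
        using mult_pos_pos[OF kap_pos d(3)] exp_ge_add_one_self[of "- (kap * \<delta> n)"] by (simp_all add: w_def)
      have "u * (1 - \<epsilon> / 4) \<le> u * (1 - exp 1 * exp (- r * f) - b)"
        using u b(1) K(2) r(2) by (intro mult_left_mono) auto
      also have "\<dots> \<le> p * (exp 1 * (\<Sum>k<n + N. exp (- (real k * \<delta> n) * f)) + l * b)"
        using small_lower_estimate[OF elim(3) r(1), of "n + N" a e] N0
        by (simp add: u_def p_def b_def f_def \<delta>_def l_def a(2))
      also have "(\<Sum>k<n + N. exp (- (real k * \<delta> n) * f)) = (\<Sum>k<n + N. exp (- (real k * (K / l))))"
        using d(2) by (simp add: mult.assoc)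
      also have "p * (exp 1 * \<dots> + l * b) \<le> p * (exp 1 * (1 / (K / l) + 1) + l * b)"
        using p K l by (intro mult_left_mono add_right_mono sum_exp_le) auto
      \<comment> \<open>Enlarging \<open>l * b\<close> by the factor \<open>exp 1\<close> allows the
        main term to be factored out.\<close>
      also have "exp 1 * (1 / (K / l) + 1) + l * b \<le> exp 1 * (1 / (K / l) + 1) + exp 1 * (l * b)"
        using bnn l mult_right_mono[of 1 "exp 1" "l * b"] by simp
      also have "\<dots> = (l / K) * exp 1 * (1 + K / l + K * b)"
        using K l by (simp add: field_simps)
      also have "\<dots> \<le> (l / K) * exp 1 * (1 + \<epsilon> / 4)"
      proof (rule mult_left_mono)
        show "1 + K / l + K * b \<le> 1 + \<epsilon> / 4" using Kl b by linarith
      qed (use K l in auto)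
      finally have 1: "u * (1 - \<epsilon> / 4) \<le> p * ((l / K) * exp 1 * (1 + \<epsilon> / 4))"
        using p by (simp add: mult_left_mono)
      \<comment> \<open>The probability \<open>w\<close> of never passing the mesh is at most
        \<open>kap * \<delta> n\<close>, and \<open>\<delta> n * f = K / l\<close>. This trades the
        cell count for \<open>1 / w\<close>, leaving a bound free of \<open>n\<close>.\<close>
      have "w * (l * f) \<le> kap * (\<delta> n * f) * l" 
        using mult_right_mono[OF w(2), of "l * f"] l f by (simp add: mult_ac)
      also have "\<dots> = kap * K" using d(2) l by simp
      finally have "l / K \<le> kap / (w * f)" using w f K by (simp add: field_simps)
      then have "p * ((l / K) * exp 1 * (1 + \<epsilon> / 4)) \<le> p * (kap / (w * f) * exp 1 * (1 + \<epsilon> / 4))"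
        using p eps by (intro mult_left_mono mult_right_mono) auto
      with 1 have "u * (1 - \<epsilon> / 4) \<le> p * (kap / (w * f) * exp 1 * (1 + \<epsilon> / 4))" by linarith
      then have "u * (1 - \<epsilon> / 4) * f \<le> p * (kap / (w * f) * exp 1 * (1 + \<epsilon> / 4)) * f"
        using f by (intro mult_right_mono) auto
      also have "\<dots> = (p / w) * (kap * exp 1) * (1 + \<epsilon> / 4)" using f w by simp
      finally have 2: "(1 - \<epsilon> / 4) * (f * u) \<le> (p / w) * (kap * exp 1) * (1 + \<epsilon> / 4)"
        by (simp only: mult_ac)
      \<comment> \<open>Collects the four losses; \<theta> is the one from replacing
        \<open>f\<close> by \<open>phi (1 / x)\<close>.\<close>
      have poly: "(1 - \<epsilon>) * (1 + \<epsilon> / 4) \<le> (1 - \<epsilon> / 4) * \<theta>"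
      proof -
        have "(1 - \<epsilon> / 4) * \<theta> - (1 - \<epsilon>) * (1 + \<epsilon> / 4) = 3 * \<epsilon> / 8 + 9 * (\<epsilon> * \<epsilon>) / 32"
          by (simp add: \<theta>_def field_simps)
        then show ?thesis using eps by (smt (verit) mult_nonneg_nonneg divide_nonneg_nonneg)
      qed
      have "0 \<le> phi (1 / x) * u" using u elim(3) by (intro mult_nonneg_nonneg phi_nonneg) auto
      from mult_right_mono[OF poly this]
      have "(1 - \<epsilon>) * (1 + \<epsilon> / 4) * (phi (1 / x) * u) \<le> (1 - \<epsilon> / 4) * ((\<theta> * phi (1 / x)) * u)"
        by (simp add: algebra_simps)
      also have "\<dots> \<le> (1 - \<epsilon> / 4) * (f * u)"
        using fphi u eps by (intro mult_left_mono mult_right_mono) auto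
      also note 2
      finally have "((1 - \<epsilon>) * (phi (1 / x) * u)) * (1 + \<epsilon> / 4) \<le> ((p / w) * (kap * exp 1)) * (1 + \<epsilon> / 4)"
        by (simp only: mult_ac)
      then have "(1 - \<epsilon>) * (phi (1 / x) * u) \<le> (p / w) * (kap * exp 1)"
        using eps by (subst (asm) mult_le_cancel_right_pos) auto
      then have "(1 - \<epsilon>) * (phi (1 / x) * u) / (kap * exp 1) \<le> p / w"
        using kap_pos by (subst pos_divide_le_eq) auto
      then show ?thesis by (simp add: u_def p_def w_def)
    qed
    moreover have "0 < \<delta> n" for n using r N0 by (simp add: \<delta>_def)
    moreover have "\<delta> \<longlonglongrightarrow> 0" unfolding \<delta>_def by (rule tendsto_div_Suc_add)
    ultimately show ?case by blast
  qed
qed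

text \<open>The depth \<open>s0 = \<rho> / phi (1 / x)\<close> is passed within a time of order
  \<open>x\<close> with probability at least 1/2. Of the budget \<open>(1 + \<epsilon>) * x\<close>,
  half of \<open>\<epsilon> * x\<close> is spent before the passage; the rest absorbs the factors
  \<open>exp s0\<close> and \<open>exp (\<delta> n)\<close> and the margin \<open>y > x\<close>
  needed by \<open>limit_le\<close>.\<close>

lemma conditioned_upper_bound:
  assumes eps: "0 < \<epsilon>"
  shows "\<exists>C>0. \<forall>\<^sub>F x in at_right 0. \<exists>y>x. \<exists>\<delta>::nat \<Rightarrow> real. (\<forall>n. 0 < \<delta> n) \<and> \<delta> \<longlonglongrightarrow> 0 \<and>
    (\<forall>n. small_alive (\<delta> n) (exp (\<delta> n) * y) / (1 - exp (- kap * \<delta> n)) \<le> C * phi (1 / x) * small ((1 + \<epsilon>) * x))"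
proof -
  \<comment> \<open>A lower bound for \<open>1 - exp (- T / x)\<close>, where \<open>T\<close>, the
    time allowed for the passage, is at least \<open>\<epsilon> * x / 4\<close> once
    \<open>exp (- s0) \<ge> 1 / 2\<close>. Half of it as \<rho> makes the failure probability in
    \<open>prob_tau_small\<close> at most 1/2.\<close>
  define \<theta> where "\<theta> = 1 - exp (- (\<epsilon> / 4))"
  have th: "0 < \<theta>" using eps by (simp add: \<theta>_def)
  define \<rho> where "\<rho> = \<theta> / 2"
  have rho: "0 < \<rho>" using th by (simp add: \<rho>_def)
  define s where "s x = \<rho> / phi (1 / x)" for x
  have slim: "(s \<longlongrightarrow> 0) (at_right 0)" unfolding s_def[abs_def] by (rule const_over_phi) simp
  have ev1: "eventually (\<lambda>x. s x < ln 2) (at_right 0)" using slim by (rule order_tendstoD) simp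
  have ev2: "eventually (\<lambda>x. kap * s x < 1) (at_right 0)"
    using tendsto_mult[OF tendsto_const[of kap] slim] by (intro order_tendstoD(2)) auto
  have "((\<lambda>x. exp (2 * s x) * (1 + \<epsilon> / 8)) \<longlongrightarrow> exp (2 * 0) * (1 + \<epsilon> / 8)) (at_right 0)"
    by (intro tendsto_intros slim)
  then have ev3: "eventually (\<lambda>x. exp (2 * s x) * (1 + \<epsilon> / 8) < 1 + \<epsilon> / 2) (at_right 0)"
    using eps by (intro order_tendstoD(2)) auto
  have ev4: "eventually (\<lambda>x. 1 \<le> phi (1 / x)) (at_right 0)"
    using phi_over_x[of 1] by (simp add: filterlim_at_top)
  \<comment> \<open>One factor 2 comes from \<open>c \<ge> 1 / 2\<close>, the other from
    \<open>one_minus_exp_ge\<close>.\<close>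
  define C where "C = 4 / (kap * \<rho>)"
  have "\<forall>\<^sub>F x in at_right 0. \<exists>y>x. \<exists>\<delta>::nat \<Rightarrow> real. (\<forall>n. 0 < \<delta> n) \<and> \<delta> \<longlonglongrightarrow> 0 \<and>
    (\<forall>n. small_alive (\<delta> n) (exp (\<delta> n) * y) / (1 - exp (- kap * \<delta> n)) \<le> C * phi (1 / x) * small ((1 + \<epsilon>) * x))"
    using ev1 ev2 ev3 ev4 eventually_at_right_less[of 0]
  proof eventually_elim
    case (elim x)
    define s0 where "s0 = s x"
    have s0: "0 < s0" "s0 * phi (1 / x) = \<rho>" using rho elim(4) by (auto simp: s0_def s_def)
    define \<delta> where "\<delta> n = s0 / real (Suc n)" for n
    define y where "y = (1 + \<epsilon> / 8) * x"
    define c where "c = prob {\<omega> \<in> space M. dies s0 (path \<omega>) \<and> tau s0 (path \<omega>) < exp (- s0) * (\<epsilon> / 2 * x)}"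
    have c: "1 / 2 \<le> c"
    proof -
      define T where "T = exp (- s0) * (\<epsilon> / 2 * x)"
      have T: "0 < T" using eps elim(5) by (simp add: T_def)
      have "exp (- ln 2) \<le> exp (- s0)" using elim(1) by (simp add: s0_def)
      then have "1 / 2 \<le> exp (- s0)" by (simp add: exp_minus)
      then have "1 / 2 * (\<epsilon> / 2) \<le> exp (- s0) * (\<epsilon> / 2)" using eps by (intro mult_right_mono) auto
      then have "\<epsilon> / 4 \<le> 1 / x * T" using elim(5) by (simp add: T_def)
      then have "\<theta> \<le> 1 - exp (- (1 / x) * T)" by (simp add: \<theta>_def)
      moreover have "1 - exp (- s0 * phi (1 / x)) \<le> \<rho>" using s0(2) exp_ge_add_one_self[of "- \<rho>"] by simp
      moreover have "0 \<le> 1 - exp (- s0 * phi (1 / x))" using s0 rho by simp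
      ultimately have "(1 - exp (- s0 * phi (1 / x))) / (1 - exp (- (1 / x) * T)) \<le> \<rho> / \<theta>"
        using th rho by (intro frac_le) auto
      also have "\<dots> = 1 / 2" using th by (simp add: \<rho>_def)
      finally show ?thesis
        using prob_tau_small[OF zero_less_divide_1_iff[THEN iffD2, OF elim(5)] less_imp_le[OF s0(1)] T]
        unfolding c_def T_def[symmetric] by linarith
    qed
    have "small_alive (\<delta> n) (exp (\<delta> n) * y) / (1 - exp (- kap * \<delta> n)) \<le> C * phi (1 / x) * small ((1 + \<epsilon>) * x)" for n
    proof -
      define l where "l = real (Suc n)"
      have l: "1 \<le> l" by (simp add: l_def)
      have d: "0 < \<delta> n" "\<delta> n \<le> s0" "\<delta> n = s0 / l" using s0 l by (auto simp: \<delta>_def l_def divide_le_eq mult_le_cancel_left1)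
      define p where "p = small_alive (\<delta> n) (exp (- s0) * ((1 + \<epsilon> / 2) * x))"
      define u where "u = small ((1 + \<epsilon>) * x)"
      have p0: "0 \<le> p" "0 \<le> u" by (auto simp: p_def u_def small_nonneg)
      have "exp (\<delta> n) * exp s0 \<le> exp (2 * s0)" using d by (simp add: exp_add[symmetric])
      then have "exp (\<delta> n) * exp s0 * (1 + \<epsilon> / 8) \<le> exp (2 * s0) * (1 + \<epsilon> / 8)"
        using eps by (intro mult_right_mono) auto
      then have "exp (\<delta> n) * exp s0 * (1 + \<epsilon> / 8) \<le> 1 + \<epsilon> / 2" using elim(3) by (simp add: s0_def)
      then have "exp (- s0) * (exp (\<delta> n) * exp s0 * (1 + \<epsilon> / 8)) \<le> exp (- s0) * (1 + \<epsilon> / 2)"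
        by (intro mult_left_mono) auto
      moreover have "exp (- s0) * (exp (\<delta> n) * exp s0 * (1 + \<epsilon> / 8)) = exp (\<delta> n) * (1 + \<epsilon> / 8)"
        by (simp add: exp_minus)
      ultimately have "exp (\<delta> n) * (1 + \<epsilon> / 8) \<le> exp (- s0) * (1 + \<epsilon> / 2)" by simp
      from mult_right_mono[OF this, of x] have "exp (\<delta> n) * y \<le> exp (- s0) * ((1 + \<epsilon> / 2) * x)"
        using elim(5) by (simp add: y_def mult.assoc)
      then have "small_alive (\<delta> n) (exp (\<delta> n) * y) \<le> p" unfolding p_def by (rule small_alive_mono)
      moreover have "l * (c * p) \<le> u"
      proof -
        have "\<epsilon> / 2 * x + (1 + \<epsilon> / 2) * x = (1 + \<epsilon>) * x" by (simp add: algebra_simps)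
        then show ?thesis
          using small_upper_estimate[OF s0(1), of "Suc n" "\<epsilon> / 2 * x" "(1 + \<epsilon> / 2) * x"] eps elim(5)
          by (simp add: c_def p_def u_def l_def \<delta>_def)
      qed
      moreover have "l * (1 / 2 * p) \<le> l * (c * p)" using c p0 l by (intro mult_left_mono mult_right_mono) auto
      ultimately have "small_alive (\<delta> n) (exp (\<delta> n) * y) \<le> p" "l * p \<le> 2 * u" by auto
      moreover from this(2) have "p \<le> 2 * u / l" using l by (simp add: pos_le_divide_eq mult.commute)
      ultimately have "small_alive (\<delta> n) (exp (\<delta> n) * y) \<le> 2 * u / l" by linarith
      moreover have "kap * s0 / (2 * l) \<le> 1 - exp (- kap * \<delta> n)"
      proof -
        have "kap * \<delta> n \<le> kap * s0" using d kap_pos by (intro mult_left_mono) auto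
        also have "\<dots> \<le> 1" using elim(2) by (simp add: s0_def)
        finally have "kap * \<delta> n / 2 \<le> 1 - exp (- (kap * \<delta> n))"
          by (rule one_minus_exp_ge[OF less_imp_le[OF mult_pos_pos[OF kap_pos d(1)]]])
        then show ?thesis using d(3) by simp
      qed
      moreover have "0 < kap * s0 / (2 * l)" using kap_pos s0 l by simp
      ultimately have "small_alive (\<delta> n) (exp (\<delta> n) * y) / (1 - exp (- kap * \<delta> n)) \<le> (2 * u / l) / (kap * s0 / (2 * l))"
        using p0 l by (intro frac_le) auto
      also have "\<dots> = C * phi (1 / x) * u"
        using s0 kap_pos l elim(4) rho by (simp add: C_def s0_def s_def field_simps)
      finally show ?thesis by (simp add: u_def)
    qed
    moreover have "0 < \<delta> n" for n using s0 by (simp add: \<delta>_def)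
    moreover have "\<delta> \<longlonglongrightarrow> 0" unfolding \<delta>_def using tendsto_div_Suc_add[of s0 1] by simp
    moreover have "x < y" using eps elim(5) by (simp add: y_def)
    ultimately show ?case by blast
  qed
  moreover have "0 < C" using kap_pos rho by (simp add: C_def)
  ultimately show ?thesis by blast
qed

end

section \<open>Passage to the limit in the Skorokhod space\<close>

text \<open>Every time \<open>t\<close> is the image under the time change of a nearby
  \<open>s\<close>, so values of \<open>w n\<close> are close to values of the limit at nearby
  times.\<close>

lemma skorokhod_tendsto_approx:
  assumes "skorokhod_tendsto w v" "0 < \<epsilon>"
  shows "\<forall>\<^sub>F n in sequentially. \<forall>t\<in>{0..T}. \<exists>s\<ge>0. \<bar>s - t\<bar> < \<epsilon> \<and> \<bar>w n t - v s\<bar> < \<epsilon>"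
proof (cases "0 \<le> T")
  case True
  obtain h where h: "\<And>n. time_change (h n)" "uniform_limit {0..} h (\<lambda>t. t) sequentially"
    "\<And>T. 0 \<le> T \<Longrightarrow> uniform_limit {0..T} (\<lambda>n t. w n (h n t)) v sequentially"
    using assms(1) by (auto simp: skorokhod_tendsto_def)
  \<comment> \<open>The preimage of a time up to \<open>T\<close> can exceed \<open>T\<close> by
    less than \<epsilon>.\<close>
  have "0 \<le> T + \<epsilon>" using True assms by simp
  note h(3)[OF this]
  then have "\<forall>\<^sub>F n in sequentially. \<forall>s\<in>{0..T + \<epsilon>}. dist (w n (h n s)) (v s) < \<epsilon>"
    using assms(2) by (rule uniform_limitD)
  moreover have "\<forall>\<^sub>F n in sequentially. \<forall>s\<in>{0..}. dist (h n s) s < \<epsilon>"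
    using h(2) assms(2) by (rule uniform_limitD)
  ultimately show ?thesis
  proof eventually_elim
    case (elim n)
    show ?case
    proof
      fix t assume t: "t \<in> {0..T}"
      have "t \<in> h n ` {0..}" using h(1)[of n] t by (auto simp: time_change_def bij_betw_def)
      then obtain s where s: "0 \<le> s" "t = h n s" by auto
      have d: "\<bar>s - t\<bar> < \<epsilon>" using elim(2) s by (auto simp: dist_real_def abs_minus_commute)
      then have "s \<in> {0..T + \<epsilon>}" using s t by auto
      then have "\<bar>w n t - v s\<bar> < \<epsilon>" using elim(1) s by (auto simp: dist_real_def)
      with s d show "\<exists>s\<ge>0. \<bar>s - t\<bar> < \<epsilon> \<and> \<bar>w n t - v s\<bar> < \<epsilon>" by blast
    qed
  qed
qed simp

lemma skorokhod_tendsto_at_continuity: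
  assumes "skorokhod_tendsto w v" and t: "0 \<le> t" and c: "isCont v t"
  shows "(\<lambda>n. w n t) \<longlonglongrightarrow> v t"
proof (rule tendstoI)
  fix e :: real assume e: "0 < e"
  obtain d where d: "0 < d" "\<And>s. \<bar>s - t\<bar> < d \<Longrightarrow> \<bar>v s - v t\<bar> < e / 2"
    using c e unfolding continuous_at_eps_delta dist_real_def by (meson half_gt_zero)
  have "0 < min d (e / 2)" using d e by simp
  from skorokhod_tendsto_approx[OF assms(1) this, of t]
  show "\<forall>\<^sub>F n in sequentially. dist (w n t) (v t) < e"
  proof eventually_elim
    case (elim n)
    have "t \<in> {0..t}" using t by simp
    with elim obtain s where "\<bar>s - t\<bar> < min d (e / 2)" "\<bar>w n t - v s\<bar> < min d (e / 2)" by blast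
    moreover from this have "\<bar>v s - v t\<bar> < e / 2" by (intro d(2)) simp
    ultimately show ?case unfolding dist_real_def by linarith
  qed
qed

lemma isCont_cadlag:
  assumes "cadlag v" "0 < t" and "t \<notin> {t. \<exists>l. (v \<longlongrightarrow> l) (at_left t) \<and> l \<noteq> v t}"
  shows "isCont v t"
proof -
  obtain l where l: "(v \<longlongrightarrow> l) (at_left t)" using cadlag_left[OF assms(1,2)] by blast
  with assms(3) have "(v \<longlongrightarrow> v t) (at_left t)" by auto
  with cadlag_right[OF assms(1), of t] assms(2) show ?thesis
    by (simp add: isCont_def filterlim_split_at)
qed

lemma efun_upto_less_top:
  assumes "cadlag w" shows "efun {0..<T} w < \<top>"
proof -
  obtain B where B: "\<And>t. t \<in> {0..T} \<Longrightarrow> \<bar>w t\<bar> \<le> B" using cadlag_bounded_on_compact[OF assms] by blast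
  have "efun {0..<T} w \<le> (\<integral>\<^sup>+t. ennreal (exp B) * indicator {0..<T} t \<partial>lborel)"
    unfolding efun_def using B by (intro nn_integral_mono) (force split: split_indicator intro!: ennreal_leI)
  also have "\<dots> = ennreal (exp B) * emeasure lborel {0..<T}" by (rule nn_integral_cmult_indicator) simp
  also have "\<dots> < \<top>" by (cases "0 \<le> T") (simp_all add: ennreal_mult_less_top)
  finally show ?thesis .
qed

text \<open>Dominated convergence: pointwise convergence holds off the countably many jump times of
  the limit, and its bound on \<open>{0..T + 1}\<close> gives a common lower bound on
  \<open>{0..T}\<close> for late members of the sequence.\<close>

lemma efun_upto_skorokhod_continuous:
  assumes "\<And>n. w n \<in> space skorokhod_space" "v \<in> space skorokhod_space" and tends: "skorokhod_tendsto w v"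
  shows "(\<lambda>n. efun {0..<T} (w n)) \<longlonglongrightarrow> efun {0..<T} v"
proof -
  have c: "cadlag (w n)" "cadlag v" for n using assms by (auto simp: space_skorokhod)
  obtain B where B: "\<And>t. t \<in> {0..T + 1} \<Longrightarrow> \<bar>v t\<bar> \<le> B" using cadlag_bounded_on_compact[OF c(2)] by blast
  obtain N where N: "\<And>n t. N \<le> n \<Longrightarrow> t \<in> {0..T} \<Longrightarrow> \<exists>s\<ge>0. \<bar>s - t\<bar> < 1 \<and> \<bar>w n t - v s\<bar> < 1"
    using skorokhod_tendsto_approx[OF tends zero_less_one, of T] unfolding eventually_sequentially by blast
  have bd: "- (B + 1) \<le> w n t" if nt: "N \<le> n" "t \<in> {0..T}" for n t
  proof -
    obtain s where s: "0 \<le> s" "\<bar>s - t\<bar> < 1" "\<bar>w n t - v s\<bar> < 1" using N[OF nt] by blast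
    then have "s \<in> {0..T + 1}" using nt by auto
    from B[OF this] s show ?thesis by linarith
  qed
  have e: "efun {0..<T} u = (\<integral>\<^sup>+t. ennreal (exp (- u (max 0 t))) * indicator {0..<T} t \<partial>lborel)" for u
    by (rule efun_eq_max) auto
  have "(\<lambda>n. \<integral>\<^sup>+t. ennreal (exp (- w (n + N) (max 0 t))) * indicator {0..<T} t \<partial>lborel) \<longlonglongrightarrow>
      (\<integral>\<^sup>+t. ennreal (exp (- v (max 0 t))) * indicator {0..<T} t \<partial>lborel)"
  proof (rule nn_integral_dominated_convergence[where w = "\<lambda>t. ennreal (exp (B + 1)) * indicator {0..<T} t"])
    show "(\<lambda>t. ennreal (exp (- w (n + N) (max 0 t))) * indicator {0..<T} t) \<in> borel_measurable lborel" for n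
      using cadlag_measurable[OF c(1)] by measurable
    show "(\<lambda>t. ennreal (exp (- v (max 0 t))) * indicator {0..<T} t) \<in> borel_measurable lborel"
      using cadlag_measurable[OF c(2)] by measurable
    have "(\<integral>\<^sup>+t. ennreal (exp (B + 1)) * indicator {0..<T} t \<partial>lborel) = ennreal (exp (B + 1)) * emeasure lborel {0..<T}"
      by (rule nn_integral_cmult_indicator) simp
    also have "\<dots> < \<infinity>" by (cases "0 \<le> T") (simp_all add: ennreal_mult_less_top)
    finally show "(\<integral>\<^sup>+t. ennreal (exp (B + 1)) * indicator {0..<T} t \<partial>lborel) < \<infinity>" .
    show "AE t in lborel. ennreal (exp (- w (n + N) (max 0 t))) * indicator {0..<T} t \<le> ennreal (exp (B + 1)) * indicator {0..<T} t" for n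
      using bd[of "n + N"] by (intro AE_I2) (force split: split_indicator simp: max_def intro!: ennreal_leI)
    \<comment> \<open>Continuity at 0 would involve negative times, so this point is discarded
      together with the jumps.\<close>
    have "AE t in lborel. t \<notin> {t. \<exists>l. (v \<longlongrightarrow> l) (at_left t) \<and> l \<noteq> v t} \<union> {0}"
      by (intro AE_not_in countable_imp_null_set_lborel countable_Un countable_jumps) simp
    then show "AE t in lborel. (\<lambda>n. ennreal (exp (- w (n + N) (max 0 t))) * indicator {0..<T} t) \<longlonglongrightarrow>
        ennreal (exp (- v (max 0 t))) * indicator {0..<T} t"
    proof eventually_elim
      case (elim t)
      show ?case
      proof (cases "0 < t")
        case True
        then have "isCont v t" using elim by (intro isCont_cadlag c) auto
        then have "(\<lambda>n. w n t) \<longlonglongrightarrow> v t" using True by (intro skorokhod_tendsto_at_continuity[OF tends]) auto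
        then have "(\<lambda>n. w (n + N) t) \<longlonglongrightarrow> v t" by (rule LIMSEQ_ignore_initial_segment)
        then have "(\<lambda>n. ennreal (exp (- w (n + N) t))) \<longlonglongrightarrow> ennreal (exp (- v t))"
          by (intro tendsto_ennrealI tendsto_exp tendsto_minus)
        then show ?thesis using True by (auto simp: max_absorb2 split: split_indicator)
      next
        case False
        then have "t < 0" using elim by auto
        then show ?thesis by simp
      qed
    qed
  qed auto
  then have "(\<lambda>n. efun {0..<T} (w (n + N))) \<longlonglongrightarrow> efun {0..<T} v" unfolding e .
  then show ?thesis by (rule LIMSEQ_offset)
qed

text \<open>A Skorokhod-continuous replacement for the indicator of \<open>{I \<le> y}\<close>: a
  finite horizon, and a ramp instead of a jump. The conversion to a real is faithful, as the
  integral up to a finite time is finite.\<close>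

definition trunc_fun :: "real \<Rightarrow> real \<Rightarrow> real \<Rightarrow> (real \<Rightarrow> real) \<Rightarrow> real" where
  "trunc_fun m T y w = ramp m (enn2real (efun {0..<T} w) - y)"

lemma trunc_fun_measurable [measurable]: "trunc_fun m T y \<in> borel_measurable skorokhod_space"
  unfolding trunc_fun_def[abs_def] by measurable

lemma trunc_fun_bounds: "0 \<le> trunc_fun m T y w" "trunc_fun m T y w \<le> 1"
  by (simp_all add: trunc_fun_def ramp_bounds)

lemma trunc_fun_weak_limit:
  assumes "skorokhod_weak_limit P Q F"
  shows "((\<lambda>i. \<integral>w. trunc_fun m T y w \<partial>P i) \<longlongrightarrow> (\<integral>w. trunc_fun m T y w \<partial>Q)) F"
proof -
  have "skorokhod_continuous (trunc_fun m T y)"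
    unfolding skorokhod_continuous_def
  proof (intro allI impI)
    fix w v assume a: "(\<forall>n. w n \<in> space skorokhod_space) \<and> v \<in> space skorokhod_space \<and> skorokhod_tendsto w v"
    then have "(\<lambda>n. efun {0..<T} (w n)) \<longlonglongrightarrow> efun {0..<T} v" by (intro efun_upto_skorokhod_continuous) auto
    moreover have "efun {0..<T} v < \<top>" using a by (intro efun_upto_less_top) (auto simp: space_skorokhod)
    ultimately have "(\<lambda>n. enn2real (efun {0..<T} (w n))) \<longlonglongrightarrow> enn2real (efun {0..<T} v)"
      by (intro tendsto_enn2real) auto
    then show "(\<lambda>n. trunc_fun m T y (w n)) \<longlonglongrightarrow> trunc_fun m T y v"
      unfolding trunc_fun_def by (intro ramp_tendsto tendsto_diff tendsto_const)
  qed
  moreover have "bounded (trunc_fun m T y ` space skorokhod_space)"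
    unfolding bounded_iff using trunc_fun_bounds by (intro exI[of _ 1]) (auto simp: abs_le_iff intro: order_trans[of _ 0])
  ultimately show ?thesis using assms trunc_fun_measurable unfolding skorokhod_weak_limit_def by blast
qed

lemma efun_upto_tendsto:
  assumes "cadlag w" shows "(\<lambda>n. efun {0..<real n} w) \<longlonglongrightarrow> efun {0..} w"
proof -
  note e = efun_eq_max[of _ w]
  have "(\<lambda>n. \<integral>\<^sup>+t. ennreal (exp (- w (max 0 t))) * indicator {0..<real n} t \<partial>lborel) \<longlonglongrightarrow>
      (\<integral>\<^sup>+t. ennreal (exp (- w (max 0 t))) * indicator {0..} t \<partial>lborel)"
  proof (rule nn_integral_LIMSEQ)
    show "incseq (\<lambda>n t. ennreal (exp (- w (max 0 t))) * indicator {0..<real n} t)"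
      by (auto simp: incseq_def le_fun_def split: split_indicator)
    show "(\<lambda>t. ennreal (exp (- w (max 0 t))) * indicator {0..<real n} t) \<in> borel_measurable lborel" for n
      using cadlag_measurable[OF assms] by measurable
    show "(\<lambda>n. ennreal (exp (- w (max 0 t))) * indicator {0..<real n} t) \<longlonglongrightarrow> ennreal (exp (- w (max 0 t))) * indicator {0..} t" for t
    proof (rule tendsto_eventually)
      obtain N :: nat where "t < real N" using reals_Archimedean2 by blast
      then show "eventually (\<lambda>n. ennreal (exp (- w (max 0 t))) * indicator {0..<real n} t = ennreal (exp (- w (max 0 t))) * indicator {0..} t) sequentially"
        unfolding eventually_sequentially by (intro exI[of _ N]) (auto split: split_indicator)
    qed
  qed
  then show ?thesis by (subst e, force)+
qed

text \<open>If the functional is at most \<open>y\<close>, all values are 1. Otherwise some finite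
  horizon already exceeds \<open>y\<close> by a fixed amount, and growing steepness brings the value
  to 0; horizon and steepness can thus grow together.\<close>

lemma trunc_fun_tendsto:
  assumes w: "cadlag w" and y: "0 \<le> y"
  shows "(\<lambda>n. trunc_fun (real n) (real n) y w) \<longlonglongrightarrow> indicator {w. efun {0..} w \<le> ennreal y} w"
proof (rule tendsto_eventually)
  show "eventually (\<lambda>n. trunc_fun (real n) (real n) y w = indicator {w. efun {0..} w \<le> ennreal y} w) sequentially"
  proof (cases "efun {0..} w \<le> ennreal y")
    case True
    have "enn2real (efun {0..<T} w) \<le> y" for T
    proof (rule enn2real_leI[OF y])
      have "efun {0..<T} w \<le> efun {0..} w" by (rule efun_mono_set) auto
      then show "efun {0..<T} w \<le> ennreal y" using True by (rule order_trans)
    qed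
    then show ?thesis using True by (simp add: trunc_fun_def ramp_nonpos)
  next
    case False
    then have "eventually (\<lambda>n. ennreal y < efun {0..<real n} w) sequentially"
      by (intro order_tendstoD(1)[OF efun_upto_tendsto[OF w]]) simp
    then obtain k :: nat where k: "ennreal y < efun {0..<real k} w" by (auto simp: eventually_sequentially)
    define g where "g T = enn2real (efun {0..<T} w)" for T
    have g: "efun {0..<T} w = ennreal (g T)" for T
      using efun_upto_less_top[OF w, of T] by (simp add: g_def)
    have g0: "0 \<le> g T" for T by (simp add: g_def)
    define \<eta> where "\<eta> = g (real k) - y"
    have eta: "0 < \<eta>" using k y by (simp add: g \<eta>_def ennreal_less_iff)
    obtain j :: nat where j: "1 < real j * \<eta>" using ex_less_of_nat_mult[OF eta] by blast
    have "trunc_fun (real n) (real n) y w = 0" if n: "max k j \<le> n" for n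
    proof -
      have "efun {0..<real k} w \<le> efun {0..<real n} w" using n by (intro efun_mono_set) auto
      then have "g (real k) \<le> g (real n)" using g0 by (simp add: g)
      then have "\<eta> \<le> g (real n) - y" by (simp add: \<eta>_def)
      moreover have "real j \<le> real n" using n by simp
      ultimately have "real j * \<eta> \<le> real n * (g (real n) - y)" using eta by (intro mult_mono) auto
      then show ?thesis unfolding trunc_fun_def g_def[symmetric] using j by (intro ramp_eq_0) linarith
    qed
    then show ?thesis using False unfolding eventually_sequentially by (intro exI[of _ "max k j"]) auto
  qed
qed

lemma cadlag_process_path_measurable:
  assumes "cadlag_process M X" shows "(\<lambda>\<omega>. \<lambda>t\<in>{0..}. X t \<omega>) \<in> measurable M skorokhod_space"
  by (rule measurable_skorokhodI)
    (use assms in \<open>auto simp: cadlag_process_def intro: restrict_in_space_skorokhod\<close>)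

lemma exp_functional_eq: "exp_functional X \<omega> = efun {0..} (\<lambda>t\<in>{0..}. X t \<omega>)"
  unfolding exp_functional_def efun_def by (intro nn_integral_cong) (auto split: split_indicator)

lemma cadlag_add_const:
  assumes "cadlag f" shows "cadlag (\<lambda>t. x + f t)"
  unfolding cadlag_def
proof (intro conjI allI impI)
  show "continuous (at_right t) (\<lambda>t. x + f t)" if "0 \<le> t" for t
    using assms that by (intro continuous_add continuous_const) (simp add: cadlag_def)
  show "\<exists>l. ((\<lambda>t. x + f t) \<longlongrightarrow> l) (at_left t)" if t: "0 < t" for t
  proof -
    obtain l where "(f \<longlongrightarrow> l) (at_left t)" using cadlag_left[OF assms t] by blast
    then have "((\<lambda>t. x + f t) \<longlongrightarrow> x + l) (at_left t)" by (intro tendsto_intros)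
    then show ?thesis ..
  qed
qed

section \<open>Laws conditioned to stay positive and their limit\<close>

context spectrally_positive_up begin

lemma translated_path_in_space:
  assumes "\<omega> \<in> space M" shows "(\<lambda>t\<in>{0..}. x + Z t \<omega>) \<in> space skorokhod_space"
  using Z_good[OF assms] by (intro restrict_in_space_skorokhod cadlag_add_const) (simp add: good_path_def)

lemma efun_add_const:
  assumes w: "\<omega> \<in> space M" and S: "S \<subseteq> {0..}" "S \<in> sets borel"
  shows "efun S (\<lambda>t\<in>{0..}. x + Z t \<omega>) = ennreal (exp (- x)) * efun S (path \<omega>)"
proof -
  have m: "(\<lambda>t. ennreal (exp (- path \<omega> (max 0 t))) * indicator S t) \<in> borel_measurable lborel"
    using cadlag_measurable[OF path_cadlag[OF w]] S(2) by measurable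
  have "efun S (\<lambda>t\<in>{0..}. x + Z t \<omega>) =
      (\<integral>\<^sup>+t. ennreal (exp (- x)) * (ennreal (exp (- path \<omega> (max 0 t))) * indicator S t) \<partial>lborel)"
    unfolding efun_def using S(1)
    by (intro nn_integral_cong) (auto split: split_indicator simp: ennreal_mult[symmetric] exp_add[symmetric] max_def)
  also have "\<dots> = ennreal (exp (- x)) * (\<integral>\<^sup>+t. ennreal (exp (- path \<omega> (max 0 t))) * indicator S t \<partial>lborel)"
    by (rule nn_integral_cmult[OF m])
  also have "(\<integral>\<^sup>+t. ennreal (exp (- path \<omega> (max 0 t))) * indicator S t \<partial>lborel) = efun S (path \<omega>)"
    using efun_eq_max[OF S(1)] by simp
  finally show ?thesis .
qed

lemma efun_add_const_le_iff:
  assumes w: "\<omega> \<in> space M" and S: "S \<subseteq> {0..}" "S \<in> sets borel" and y: "0 \<le> y"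
  shows "efun S (\<lambda>t\<in>{0..}. x + Z t \<omega>) \<le> ennreal y \<longleftrightarrow> efun S (path \<omega>) \<le> ennreal (exp x * y)"
proof -
  have "ennreal (exp (- x)) * a \<le> ennreal y \<longleftrightarrow> a \<le> ennreal (exp x * y)" for a
  proof
    assume "ennreal (exp (- x)) * a \<le> ennreal y"
    then have "ennreal (exp x) * (ennreal (exp (- x)) * a) \<le> ennreal (exp x) * ennreal y" by (rule mult_left_mono) simp
    then show "a \<le> ennreal (exp x * y)"
      using y by (simp add: ennreal_mult[symmetric] mult.assoc[symmetric] exp_add[symmetric])
  next
    assume "a \<le> ennreal (exp x * y)"
    then have "ennreal (exp (- x)) * a \<le> ennreal (exp (- x)) * ennreal (exp x * y)" by (rule mult_left_mono) simp
    then show "ennreal (exp (- x)) * a \<le> ennreal y"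
      using y by (simp add: ennreal_mult[symmetric] mult.assoc[symmetric] exp_add[symmetric])
  qed
  then show ?thesis using efun_add_const[OF w S] by simp
qed

lemma
  assumes x: "0 < x"
  shows prob_space_conditioned: "prob_space (conditioned_positive_law M Z x)"
    and measure_conditioned: "\<And>A. A \<in> sets skorokhod_space \<Longrightarrow> measure (conditioned_positive_law M Z x) A =
      prob {\<omega> \<in> space M. \<not> dies x (path \<omega>) \<and> (\<lambda>t\<in>{0..}. x + Z t \<omega>) \<in> A} / (1 - exp (- kap * x))"
proof -
  let ?S = "stays_positive M Z x"
  let ?f = "\<lambda>\<omega>. \<lambda>t\<in>{0..}. x + Z t \<omega>"
  have fm: "?f \<in> measurable M skorokhod_space"
  proof (rule measurable_skorokhodI)
    show "(\<lambda>\<omega>. ?f \<omega> t) \<in> borel_measurable M" if "0 \<le> t" for t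
      using Z_measurable[OF that] that by simp
  qed (rule translated_path_in_space)
  have fm': "?f \<in> measurable (uniform_measure M ?S) skorokhod_space"
    using fm by (simp add: measurable_def)
  have pos: "0 < prob ?S" using prob_stays_positive[OF x] kap_pos x by simp
  then have "emeasure M ?S \<noteq> 0" by (simp add: emeasure_eq_measure)
  then have "prob_space (uniform_measure M ?S)" by (rule prob_space_uniform_measure) (simp add: emeasure_eq_measure)
  then show "prob_space (conditioned_positive_law M Z x)"
    unfolding conditioned_positive_law_def path_law_def using fm' by (rule prob_space.prob_space_distr)
  fix A assume A: "A \<in> sets skorokhod_space"
  have ev: "?f -` A \<inter> space M \<in> events" by (rule measurable_sets[OF fm A])
  have "measure (conditioned_positive_law M Z x) A = measure (uniform_measure M ?S) (?f -` A \<inter> space M)"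
    unfolding conditioned_positive_law_def path_law_def using measure_distr[OF fm' A] by simp
  also have "\<dots> = prob (?S \<inter> (?f -` A \<inter> space M)) / prob ?S"
    using ev \<open>emeasure M ?S \<noteq> 0\<close> by (intro measure_uniform_measure) (simp only: emeasure_eq_measure ennreal_neq_top infinity_ennreal_def not_False_eq_True)+
  also have "prob (?S \<inter> (?f -` A \<inter> space M)) = prob {\<omega> \<in> space M. \<not> dies x (path \<omega>) \<and> ?f \<omega> \<in> A}"
  proof (rule finite_measure_eq_AE)
    show "AE \<omega> in M. (\<omega> \<in> ?S \<inter> (?f -` A \<inter> space M)) = (\<omega> \<in> {\<omega> \<in> space M. \<not> dies x (path \<omega>) \<and> ?f \<omega> \<in> A})"
      using AE_stays_positive[OF x] AE_space by eventually_elim auto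
    show "?S \<inter> (?f -` A \<inter> space M) \<in> events" using stays_positive_events[OF x] ev by (rule sets.Int)
    have "{\<omega> \<in> space M. \<not> dies x (path \<omega>) \<and> ?f \<omega> \<in> A} = {\<omega> \<in> space M. \<not> dies x (path \<omega>)} \<inter> (?f -` A \<inter> space M)" by auto
    also have "\<dots> \<in> events" by (rule sets.Int[OF _ ev]) measurable
    finally show "{\<omega> \<in> space M. \<not> dies x (path \<omega>) \<and> ?f \<omega> \<in> A} \<in> events" .
  qed
  finally show "measure (conditioned_positive_law M Z x) A =
      prob {\<omega> \<in> space M. \<not> dies x (path \<omega>) \<and> (\<lambda>t\<in>{0..}. x + Z t \<omega>) \<in> A} / (1 - exp (- kap * x))"
    using prob_stays_positive[OF x] by simp
qed

lemma sets_conditioned: "sets (conditioned_positive_law M Z x) = sets skorokhod_space"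
  by (simp add: conditioned_positive_law_def path_law_def)

text \<open>Starting from \<open>x\<close> multiplies the functional by \<open>exp (- x)\<close>,
  whence the argument \<open>exp x * y\<close>.\<close>

lemma conditioned_small:
  assumes x: "0 < x" and y: "0 \<le> y"
  shows "measure (conditioned_positive_law M Z x) {w \<in> space skorokhod_space. efun {0..} w \<le> ennreal y} =
    small_alive x (exp x * y) / (1 - exp (- kap * x))"
proof -
  have "{w \<in> space skorokhod_space. efun {0..} w \<le> ennreal y} \<in> sets skorokhod_space" by measurable
  moreover have "(\<lambda>t\<in>{0..}. x + Z t \<omega>) \<in> space skorokhod_space" if "\<omega> \<in> space M" for \<omega>
    using that by (rule translated_path_in_space)
  ultimately show ?thesis
    using efun_add_const_le_iff[OF _ _ _ y, of _ "{0..}" x]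
    by (subst measure_conditioned[OF x]) (auto simp: small_alive_def intro!: arg_cong[of _ _ prob])
qed

text \<open>Complement of \<open>conditioning_increases\<close>; starting from \<open>x > 0\<close>
  shrinks the tail further. The bound is uniform in \<open>x\<close>, which lets it survive the
  limit.\<close>

lemma conditioned_tail:
  assumes x: "0 < x" and T: "0 \<le> T" and eta: "0 \<le> \<eta>"
  shows "measure (conditioned_positive_law M Z x) {w \<in> space skorokhod_space. ennreal \<eta> < efun {T..} w} \<le>
    prob {\<omega> \<in> space M. ennreal \<eta> < efun {T..} (path \<omega>)}"
proof -
  interpret P: prob_space "conditioned_positive_law M Z x" by (rule prob_space_conditioned[OF x])
  have sp: "space (conditioned_positive_law M Z x) = space skorokhod_space"
    using sets_conditioned by (rule sets_eq_imp_space_eq)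
  let ?A = "{w \<in> space skorokhod_space. efun {T..} w \<le> ennreal \<eta>}"
  have A: "?A \<in> sets skorokhod_space" using T by measurable
  note in_sp = translated_path_in_space
  have c: "0 < 1 - exp (- kap * x)" using kap_pos x by simp
  have "prob {\<omega> \<in> space M. efun {T..} (path \<omega>) \<le> ennreal \<eta>} * (1 - exp (- kap * x)) \<le>
      prob {\<omega> \<in> space M. \<not> dies x (path \<omega>) \<and> efun {T..} (path \<omega>) \<le> ennreal \<eta>}"
    using conditioning_increases[OF T less_imp_le[OF x], of "ennreal \<eta>"] by (simp add: mult.commute)
  also have "\<dots> \<le> prob {\<omega> \<in> space M. \<not> dies x (path \<omega>) \<and> (\<lambda>t\<in>{0..}. x + Z t \<omega>) \<in> ?A}"
  proof (rule finite_measure_mono)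
    have iff: "(\<lambda>t\<in>{0..}. x + Z t \<omega>) \<in> ?A \<longleftrightarrow> efun {T..} (path \<omega>) \<le> ennreal (exp x * \<eta>)" if "\<omega> \<in> space M" for \<omega>
      using efun_add_const_le_iff[OF that _ _ eta, of "{T..}" x] in_sp[OF that] T by auto
    have "{\<omega> \<in> space M. \<not> dies x (path \<omega>) \<and> (\<lambda>t\<in>{0..}. x + Z t \<omega>) \<in> ?A} =
        {\<omega> \<in> space M. \<not> dies x (path \<omega>) \<and> efun {T..} (path \<omega>) \<le> ennreal (exp x * \<eta>)}"
      using iff by blast
    also have "\<dots> \<in> events" using T by measurable
    finally show "{\<omega> \<in> space M. \<not> dies x (path \<omega>) \<and> (\<lambda>t\<in>{0..}. x + Z t \<omega>) \<in> ?A} \<in> events" .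
    have "ennreal \<eta> \<le> ennreal (exp x * \<eta>)" using eta x by (intro ennreal_leI) (simp add: mult_le_cancel_right1)
    then show "{\<omega> \<in> space M. \<not> dies x (path \<omega>) \<and> efun {T..} (path \<omega>) \<le> ennreal \<eta>} \<subseteq>
        {\<omega> \<in> space M. \<not> dies x (path \<omega>) \<and> (\<lambda>t\<in>{0..}. x + Z t \<omega>) \<in> ?A}"
      using iff by (blast intro: order_trans)
  qed
  finally have "prob {\<omega> \<in> space M. efun {T..} (path \<omega>) \<le> ennreal \<eta>} \<le> measure (conditioned_positive_law M Z x) ?A"
    unfolding measure_conditioned[OF x A] using c by (simp add: pos_le_divide_eq)
  moreover have "prob {\<omega> \<in> space M. ennreal \<eta> < efun {T..} (path \<omega>)} = 1 - prob {\<omega> \<in> space M. efun {T..} (path \<omega>) \<le> ennreal \<eta>}"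
    using T by (subst prob_neg[symmetric]) (auto simp: not_le)
  moreover have "measure (conditioned_positive_law M Z x) {w \<in> space skorokhod_space. ennreal \<eta> < efun {T..} w} =
      1 - measure (conditioned_positive_law M Z x) ?A"
    using P.prob_neg[of "\<lambda>w. efun {T..} w \<le> ennreal \<eta>"] A by (simp add: sp sets_conditioned not_le)
  ultimately show ?thesis by simp
qed

context
  fixes N :: "'b measure" and Y :: "real \<Rightarrow> 'b \<Rightarrow> real"
  assumes Y: "cadlag_process N Y"
    and lim: "skorokhod_weak_limit (conditioned_positive_law M Z) (path_law N Y) (at_right 0)"
begin

lemma limit_prob_space: "prob_space (path_law N Y)"
  unfolding path_law_def using Y
  by (intro prob_space.prob_space_distr cadlag_process_path_measurable) (auto simp: cadlag_process_def)

lemma limit_sets: "sets (path_law N Y) = sets skorokhod_space"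
  by (simp add: path_law_def)

lemma limit_small:
  "measure N {\<omega> \<in> space N. exp_functional Y \<omega> \<le> ennreal y} =
    measure (path_law N Y) {w \<in> space skorokhod_space. efun {0..} w \<le> ennreal y}"
proof -
  have "{w \<in> space skorokhod_space. efun {0..} w \<le> ennreal y} \<in> sets skorokhod_space" by measurable
  then have "measure (path_law N Y) {w \<in> space skorokhod_space. efun {0..} w \<le> ennreal y} =
      measure N ((\<lambda>\<omega>. \<lambda>t\<in>{0..}. Y t \<omega>) -` {w \<in> space skorokhod_space. efun {0..} w \<le> ennreal y} \<inter> space N)"
    unfolding path_law_def by (rule measure_distr[OF cadlag_process_path_measurable[OF Y]])
  also have "(\<lambda>\<omega>. \<lambda>t\<in>{0..}. Y t \<omega>) -` {w \<in> space skorokhod_space. efun {0..} w \<le> ennreal y} \<inter> space N =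
      {\<omega> \<in> space N. exp_functional Y \<omega> \<le> ennreal y}"
    using measurable_space[OF cadlag_process_path_measurable[OF Y]] by (auto simp: exp_functional_eq)
  finally show ?thesis ..
qed

lemma trunc_fun_limit:
  assumes "\<And>n. 0 < \<delta> n" "\<delta> \<longlonglongrightarrow> 0"
  shows "(\<lambda>n. \<integral>w. trunc_fun m T y w \<partial>conditioned_positive_law M Z (\<delta> n)) \<longlonglongrightarrow> (\<integral>w. trunc_fun m T y w \<partial>path_law N Y)"
proof (rule filterlim_compose[OF trunc_fun_weak_limit[OF lim]])
  show "filterlim \<delta> (at_right 0) sequentially"
    unfolding filterlim_at using assms by (auto simp: less_imp_neq[THEN not_sym])
qed

lemma trunc_fun_integrable:
  assumes "prob_space P" "sets P = sets skorokhod_space" shows "integrable P (trunc_fun m T y)"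
proof -
  interpret P: prob_space P by fact
  show ?thesis
    by (rule P.integrable_const_bound[where B = 1])
      (use trunc_fun_measurable assms(2) measurable_cong_sets[OF assms(2) refl] trunc_fun_bounds in auto)
qed

lemma small_le_trunc_fun:
  assumes P: "prob_space P" "sets P = sets skorokhod_space" and y: "0 \<le> y" and m: "0 \<le> m"
  shows "measure P {w \<in> space skorokhod_space. efun {0..} w \<le> ennreal y} \<le> (\<integral>w. trunc_fun m T y w \<partial>P)"
proof -
  interpret P: prob_space P by fact
  let ?A = "{w \<in> space skorokhod_space. efun {0..} w \<le> ennreal y}"
  have A: "?A \<in> sets P" unfolding P(2) by measurable
  have "measure P ?A = (\<integral>w. indicator ?A w \<partial>P)" using A by simp
  also have "\<dots> \<le> (\<integral>w. trunc_fun m T y w \<partial>P)"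
  proof (rule integral_mono)
    show "integrable P (indicat_real ?A)" using A by (intro integrable_real_indicator) (auto simp: P.emeasure_eq_measure)
    show "integrable P (trunc_fun m T y)" by (rule trunc_fun_integrable[OF P])
    fix w
    have "trunc_fun m T y w = 1" if "w \<in> ?A"
    proof -
      have "efun {0..<T} w \<le> efun {0..} w" by (rule efun_mono_set) auto
      also have "\<dots> \<le> ennreal y" using that by simp
      finally have "enn2real (efun {0..<T} w) \<le> y" using y by (intro enn2real_leI)
      then show ?thesis using m by (simp add: trunc_fun_def ramp_nonpos)
    qed
    then show "indicat_real ?A w \<le> trunc_fun m T y w" using trunc_fun_bounds by (auto split: split_indicator)
  qed
  finally show ?thesis .
qed

text \<open>\<open>trunc_fun\<close> majorizes the indicator, so the lower bound passes to its
  integral under the limit law, and then to the indicator as horizon and steepness grow. No margin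
  in \<open>y\<close> is lost.\<close>

lemma limit_ge:
  assumes d: "\<And>n. 0 < \<delta> n" "\<delta> \<longlonglongrightarrow> 0" and y: "0 \<le> y"
    and c: "\<And>n. c \<le> small_alive (\<delta> n) (exp (\<delta> n) * y) / (1 - exp (- kap * \<delta> n))"
  shows "c \<le> measure N {\<omega> \<in> space N. exp_functional Y \<omega> \<le> ennreal y}"
proof -
  interpret Q: prob_space "path_law N Y" by (rule limit_prob_space)
  have sp: "space (path_law N Y) = space skorokhod_space" using limit_sets by (rule sets_eq_imp_space_eq)
  have 1: "c \<le> (\<integral>w. trunc_fun (real m) (real m) y w \<partial>path_law N Y)" for m :: nat
  proof (rule LIMSEQ_le_const[OF trunc_fun_limit[OF d]])
    have "c \<le> (\<integral>w. trunc_fun (real m) (real m) y w \<partial>conditioned_positive_law M Z (\<delta> n))" for n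
      using c[of n] small_le_trunc_fun[OF prob_space_conditioned[OF d(1)] sets_conditioned y, of "real m" n "real m"]
        conditioned_small[OF d(1) y, of n] by simp
    then show "\<exists>N. \<forall>n\<ge>N. c \<le> (\<integral>w. trunc_fun (real m) (real m) y w \<partial>conditioned_positive_law M Z (\<delta> n))" by blast
  qed
  let ?A = "{w \<in> space skorokhod_space. efun {0..} w \<le> ennreal y}"
  have A: "?A \<in> sets (path_law N Y)" unfolding limit_sets by measurable
  have "(\<lambda>m. \<integral>w. trunc_fun (real m) (real m) y w \<partial>path_law N Y) \<longlonglongrightarrow> (\<integral>w. indicator ?A w \<partial>path_law N Y)"
  proof (rule integral_dominated_convergence[where w = "\<lambda>_. 1"])
    show "indicat_real ?A \<in> borel_measurable (path_law N Y)" using A by simp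
    show "trunc_fun (real m) (real m) y \<in> borel_measurable (path_law N Y)" for m
      using trunc_fun_integrable[OF limit_prob_space limit_sets] by (rule borel_measurable_integrable)
    show "AE w in path_law N Y. (\<lambda>m. trunc_fun (real m) (real m) y w) \<longlonglongrightarrow> indicat_real ?A w"
    proof (rule AE_I2)
      fix w assume "w \<in> space (path_law N Y)"
      then have w: "w \<in> space skorokhod_space" by (simp add: sp)
      then have "(\<lambda>m. trunc_fun (real m) (real m) y w) \<longlonglongrightarrow> indicator {w. efun {0..} w \<le> ennreal y} w"
        using y by (intro trunc_fun_tendsto) (auto simp: space_skorokhod)
      then show "(\<lambda>m. trunc_fun (real m) (real m) y w) \<longlonglongrightarrow> indicat_real ?A w"
        using w by (simp add: indicator_def)
    qed
    show "AE w in path_law N Y. norm (trunc_fun (real m) (real m) y w) \<le> 1" for m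
      using trunc_fun_bounds by (intro AE_I2) auto
  qed simp
  then have "c \<le> (\<integral>w. indicator ?A w \<partial>path_law N Y)" using 1 by (intro LIMSEQ_le_const) auto
  also have "\<dots> = measure (path_law N Y) ?A" using A by simp
  finally show ?thesis by (simp add: limit_small)
qed

text \<open>Here a margin is needed: the gap from \<open>y\<close> to \<open>y'\<close> is split
  evenly between the width of the ramp and the part of the integral beyond the horizon. The starting
  point tends to 0 first; the horizon grows afterwards, which the uniform tail bound
  permits.\<close>

lemma limit_le:
  assumes d: "\<And>n. 0 < \<delta> n" "\<delta> \<longlonglongrightarrow> 0" and y: "0 \<le> y" "y < y'"
    and c: "\<And>n. small_alive (\<delta> n) (exp (\<delta> n) * y') / (1 - exp (- kap * \<delta> n)) \<le> c"
  shows "measure N {\<omega> \<in> space N. exp_functional Y \<omega> \<le> ennreal y} \<le> c"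
proof -
  define \<eta> where "\<eta> = (y' - y) / 2"
  have eta: "0 < \<eta>" "y + \<eta> + \<eta> = y'" using y by (auto simp: \<eta>_def)
  let ?A = "{w \<in> space skorokhod_space. efun {0..} w \<le> ennreal y'}"
  have bound: "(\<integral>w. trunc_fun (1 / \<eta>) (real k) y w \<partial>conditioned_positive_law M Z (\<delta> n)) \<le>
      c + prob {\<omega> \<in> space M. ennreal \<eta> < efun {real k..} (path \<omega>)}" for k n :: nat
  proof -
    let ?P = "conditioned_positive_law M Z (\<delta> n)"
    let ?B = "{w \<in> space skorokhod_space. ennreal \<eta> < efun {real k..} w}"
    note P = prob_space_conditioned[OF d(1)[of n]]
    interpret P: prob_space ?P by (rule P)
    have A: "?A \<in> sets ?P" and B: "?B \<in> sets ?P" unfolding sets_conditioned by measurable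
    have iA: "integrable ?P (indicat_real ?A)" and iB: "integrable ?P (indicat_real ?B)"
      using A B by (auto intro!: integrable_real_indicator simp: P.emeasure_eq_measure)
    have "(\<integral>w. trunc_fun (1 / \<eta>) (real k) y w \<partial>?P) \<le> (\<integral>w. indicator ?A w + indicator ?B w \<partial>?P)"
    proof (rule integral_mono)
      show "integrable ?P (trunc_fun (1 / \<eta>) (real k) y)" by (rule trunc_fun_integrable[OF P sets_conditioned])
      show "integrable ?P (\<lambda>w. indicat_real ?A w + indicat_real ?B w)" using iA iB by simp
      fix w assume "w \<in> space ?P"
      then have w: "w \<in> space skorokhod_space" using sets_eq_imp_space_eq[OF sets_conditioned] by simp
      then have cw: "cadlag w" by (simp add: space_skorokhod)
      show "trunc_fun (1 / \<eta>) (real k) y w \<le> indicat_real ?A w + indicat_real ?B w"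
      proof (cases "w \<in> ?A \<or> w \<in> ?B")
        case True
        then have "1 \<le> indicat_real ?A w + indicat_real ?B w" by (auto simp: indicator_def)
        then show ?thesis using trunc_fun_bounds(2) order_trans by blast
      next
        case False
        then have a: "ennreal y' < efun {0..} w" and b: "efun {real k..} w \<le> ennreal \<eta>" using w by auto
        define g where "g = enn2real (efun {0..<real k} w)"
        have g: "efun {0..<real k} w = ennreal g" "0 \<le> g"
          using efun_upto_less_top[OF cw, of "real k"] by (simp_all add: g_def)
        have "efun ({0..<real k} \<union> {real k..}) w = efun {0..<real k} w + efun {real k..} w"
          by (rule efun_Un[OF cw]) auto
        moreover have "{0..<real k} \<union> {real k..} = {0..}" by auto
        ultimately have "efun {0..} w \<le> ennreal g + ennreal \<eta>" using b g by (simp add: add_left_mono)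
        also have "\<dots> = ennreal (g + \<eta>)" using g eta by simp
        finally have "ennreal y' < ennreal (g + \<eta>)" using a by simp
        then have "y' < g + \<eta>" using y by (simp add: ennreal_less_iff)
        then have "\<eta> \<le> g - y" using eta by simp
        then have "1 \<le> 1 / \<eta> * (g - y)" using eta by (simp add: pos_le_divide_eq)
        then show ?thesis by (simp add: trunc_fun_def g_def[symmetric] ramp_eq_0)
      qed
    qed
    also have "\<dots> = measure ?P ?A + measure ?P ?B" using A B iA iB by simp
    also have "\<dots> \<le> c + prob {\<omega> \<in> space M. ennreal \<eta> < efun {real k..} (path \<omega>)}"
      using conditioned_small[OF d(1), of y' n] c[of n] conditioned_tail[OF d(1), of "real k" \<eta> n] eta y
      by (intro add_mono) auto
    finally show ?thesis .
  qed
  have "measure N {\<omega> \<in> space N. exp_functional Y \<omega> \<le> ennreal y} \<le>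
      c + prob {\<omega> \<in> space M. ennreal \<eta> < efun {real k..} (path \<omega>)}" for k :: nat
  proof -
    have "measure N {\<omega> \<in> space N. exp_functional Y \<omega> \<le> ennreal y} \<le> (\<integral>w. trunc_fun (1 / \<eta>) (real k) y w \<partial>path_law N Y)"
      unfolding limit_small using eta by (intro small_le_trunc_fun limit_prob_space limit_sets y) auto
    also have "\<dots> \<le> c + prob {\<omega> \<in> space M. ennreal \<eta> < efun {real k..} (path \<omega>)}"
      by (rule LIMSEQ_le_const2[OF trunc_fun_limit[OF d]]) (use bound in blast)
    finally show ?thesis .
  qed
  moreover have "(\<lambda>k. c + prob {\<omega> \<in> space M. ennreal \<eta> < efun {real k..} (path \<omega>)}) \<longlonglongrightarrow> c + 0"
    by (intro tendsto_intros prob_efun_tail eta)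
  ultimately show ?thesis using LIMSEQ_le_const[of _ "c + 0"] by auto
qed

lemma limit_dominates:
  assumes y: "0 \<le> y" shows "small y \<le> measure N {\<omega> \<in> space N. exp_functional Y \<omega> \<le> ennreal y}"
proof (rule limit_ge[where \<delta> = "\<lambda>n. 1 / real (Suc n)"])
  show "(\<lambda>n. 1 / real (Suc n)) \<longlonglongrightarrow> 0" by (rule LIMSEQ_Suc[OF lim_1_over_n])
  fix n
  let ?d = "1 / real (Suc n)"
  have c: "0 < 1 - exp (- kap * ?d)" using kap_pos by simp
  have "(1 - exp (- kap * ?d)) * small y \<le> small_alive ?d y"
    unfolding small_def small_alive_def by (rule conditioning_increases) auto
  also have "\<dots> \<le> small_alive ?d (exp ?d * y)" using y by (intro small_alive_mono) (simp add: mult_le_cancel_right1)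
  finally show "small y \<le> small_alive ?d (exp ?d * y) / (1 - exp (- kap * ?d))"
    using c by (simp add: pos_le_divide_eq mult.commute)
qed (use y in auto)

end

end

section \<open>Passing to a version without exceptional outcomes\<close>

lemma cadlag_mono_of_rats:
  assumes c: "cadlag f" and le: "\<And>r r'. r \<in> \<rat> \<Longrightarrow> r' \<in> \<rat> \<Longrightarrow> 0 \<le> r \<Longrightarrow> r \<le> r' \<Longrightarrow> f r \<le> f r'"
    and uv: "0 \<le> u" "u \<le> v"
  shows "f u \<le> f v"
proof (rule ccontr)
  assume n: "\<not> f u \<le> f v"
  then have "u < v" using uv by (cases "u = v") auto
  obtain q where q: "f v < q" "q < f u" using n dense[of "f v" "f u"] by auto
  obtain r where r: "r \<in> \<rat>" "u < r" "r < v" "q < f r"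
    using cadlag_approx_greater[OF c uv(1) q(2) \<open>u < v\<close>] by blast
  have "0 \<le> v" using uv by simp
  obtain r' where r': "r' \<in> \<rat>" "v < r'" "f r' < q"
    using cadlag_approx_less[OF c \<open>0 \<le> v\<close> q(1), of "v + 1"] by auto
  have "f r \<le> f r'" using r r' uv by (intro le) auto
  then show False using r r' by simp
qed

lemma mono_bounded_variation:
  assumes "\<And>u v. 0 \<le> u \<Longrightarrow> u \<le> v \<Longrightarrow> f u \<le> f v"
  shows "bounded_variation_upto T f"
  unfolding bounded_variation_upto_def
proof (intro exI[of _ "f T - f 0"] allI impI)
  fix n :: nat and u :: "nat \<Rightarrow> real"
  assume u: "mono_on {..n} u \<and> u ` {..n} \<subseteq> {0..T}"
  then have uT: "0 \<le> u i" "u i \<le> T" if "i \<le> n" for i using that by auto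
  have "(\<Sum>i<n. \<bar>f (u (Suc i)) - f (u i)\<bar>) = (\<Sum>i<n. f (u (Suc i)) - f (u i))"
  proof (rule sum.cong[OF refl])
    fix i assume "i \<in> {..<n}"
    then have "u i \<le> u (Suc i)" using u by (auto simp: mono_on_def)
    then have "f (u i) \<le> f (u (Suc i))" using uT[of i] \<open>i \<in> {..<n}\<close> by (intro assms) auto
    then show "\<bar>f (u (Suc i)) - f (u i)\<bar> = f (u (Suc i)) - f (u i)" by simp
  qed
  also have "\<dots> = f (u n) - f (u 0)" by (rule sum_lessThan_telescope)
  also have "\<dots> \<le> f T - f 0" using uT[of n] uT[of 0] by (intro diff_mono assms) auto
  finally show "(\<Sum>i<n. \<bar>f (u (Suc i)) - f (u i)\<bar>) \<le> f T - f 0" .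
qed

lemma good_path_identity: "good_path (\<lambda>t. t)"
proof -
  have id: "((\<lambda>t::real. t) \<longlongrightarrow> t) (at_left t)" for t by (rule tendsto_ident_at)
  have "t = l" if "((\<lambda>t::real. t) \<longlongrightarrow> l) (at_left t)" for t l
    using tendsto_unique[OF _ id that] by simp
  then show ?thesis
    unfolding good_path_def cadlag_def no_negative_jumps_def using id by (auto intro: continuous_ident)
qed

text \<open>Independence says that the joint law is the product of the marginals, and laws do not
  see null sets. The empty family, to which this characterization does not apply, is treated
  apart.\<close>

lemma (in prob_space) indep_vars_cong_AE:
  fixes X Y :: "'i \<Rightarrow> 'a \<Rightarrow> real"
  assumes I: "finite I" and X: "indep_vars (\<lambda>_. borel) X I"
    and Y: "\<And>i. i \<in> I \<Longrightarrow> Y i \<in> borel_measurable M" and eq: "\<And>i. i \<in> I \<Longrightarrow> AE \<omega> in M. X i \<omega> = Y i \<omega>"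
  shows "indep_vars (\<lambda>_. borel) Y I"
proof (cases "I = {}")
  case True then show ?thesis by (simp add: indep_vars_def indep_sets_def)
next
  case False
  have Xm: "X i \<in> borel_measurable M" if "i \<in> I" for i using X that by (auto simp: indep_vars_def)
  have "AE \<omega> in M. \<forall>i\<in>I. X i \<omega> = Y i \<omega>" using I eq by (rule AE_finite_allI)
  then have AE: "AE \<omega> in M. (\<lambda>i\<in>I. Y i \<omega>) = (\<lambda>i\<in>I. X i \<omega>)"
    by eventually_elim (auto simp: restrict_def)
  have "distr M (\<Pi>\<^sub>M i\<in>I. borel) (\<lambda>\<omega>. \<lambda>i\<in>I. Y i \<omega>) = distr M (\<Pi>\<^sub>M i\<in>I. borel) (\<lambda>\<omega>. \<lambda>i\<in>I. X i \<omega>)"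
    using AE Xm Y by (intro distr_cong_AE) (auto intro!: measurable_restrict)
  also have "\<dots> = (\<Pi>\<^sub>M i\<in>I. distr M borel (X i))"
    using X by (subst (asm) indep_vars_iff_distr_eq_PiM'[OF False]) (auto simp: Xm)
  also have "\<dots> = (\<Pi>\<^sub>M i\<in>I. distr M borel (Y i))"
    using Xm Y eq by (intro PiM_cong refl distr_cong_AE) auto
  finally show ?thesis using Y by (subst indep_vars_iff_distr_eq_PiM'[OF False]) auto
qed

text \<open>If almost no path went below 0, stationarity would make increments nonnegative,
  simultaneously for all pairs of rational times. By right-continuity the paths would be
  nondecreasing, hence of bounded variation on \<open>{0..1}\<close>.\<close>

lemma AE_hits_below_0:
  assumes levy: "levy_process M Z" and var: "unbounded_variation M Z"
  shows "\<not> (AE \<omega> in M. \<not> dies 0 (\<lambda>t. Z t \<omega>))"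
proof
  assume a: "AE \<omega> in M. \<not> dies 0 (\<lambda>t. Z t \<omega>)"
  have cp: "cadlag_process M Z" using levy by (simp add: levy_process_def)
  interpret prob_space M using cp by (simp add: cadlag_process_def)
  have Zm: "Z t \<in> borel_measurable M" if "0 \<le> t" for t using cp that by (simp add: cadlag_process_def)
  have "AE \<omega> in M. Z s \<omega> \<le> Z t \<omega>" if st: "0 \<le> s" "s \<le> t" for s t
  proof -
    have h: "0 \<le> t - s" using st by simp
    have "distr M borel (\<lambda>\<omega>. Z (s + (t - s)) \<omega> - Z s \<omega>) = distr M borel (Z (t - s))"
      using levy st(1) h unfolding levy_process_def by blast
    then have "distr M borel (\<lambda>\<omega>. Z t \<omega> - Z s \<omega>) = distr M borel (Z (t - s))" by simp
    moreover have "AE \<omega> in M. 0 \<le> Z (t - s) \<omega>"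
      using a by eventually_elim (use h in \<open>auto simp: dies_def not_less\<close>)
    then have "AE x in distr M borel (Z (t - s)). 0 \<le> x" using Zm[OF h] by (subst AE_distr_iff) auto
    ultimately have "AE x in distr M borel (\<lambda>\<omega>. Z t \<omega> - Z s \<omega>). 0 \<le> x" by (simp only:)
    then have "AE \<omega> in M. 0 \<le> Z t \<omega> - Z s \<omega>"
      using Zm[of s] Zm[of t] st by (subst (asm) AE_distr_iff) auto
    then show ?thesis by eventually_elim simp
  qed
  then have "AE \<omega> in M. \<forall>r\<in>\<rat> \<inter> {0..}. \<forall>r'\<in>\<rat> \<inter> {r..}. Z r \<omega> \<le> Z r' \<omega>"
    by (subst AE_ball_countable, simp add: countable_Int1 countable_rat)+ auto
  then have "AE \<omega> in M. False"
    using var[unfolded unbounded_variation_def] AE_space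
  proof eventually_elim
    case (elim \<omega>)
    have "cadlag (\<lambda>t. Z t \<omega>)" using cp elim(3) by (simp add: cadlag_process_def)
    from cadlag_mono_of_rats[OF this] elim(1)
    have "bounded_variation_upto 1 (\<lambda>t. Z t \<omega>)" by (intro mono_bounded_variation) auto
    with elim(2) show ?case by simp
  qed
  then show False by simp
qed

text \<open>On the null set where some path property fails, the path is replaced by the identity, which has them all.\<close>

lemma spectrally_positive_modification:
  assumes sp: "spectrally_positive_levy M Z" and var: "unbounded_variation M Z" and drift: "drifts_to_infinity M Z"
  shows "\<exists>Z'. spectrally_positive_up M Z' \<and> (AE \<omega> in M. \<forall>t. Z' t \<omega> = Z t \<omega>)"
proof -
  have levy: "levy_process M Z" using sp by (simp add: spectrally_positive_levy_def)
  then have cp: "cadlag_process M Z" by (simp add: levy_process_def)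
  interpret prob_space M using cp by (simp add: cadlag_process_def)
  have Zm: "Z t \<in> borel_measurable M" if "0 \<le> t" for t using cp that by (simp add: cadlag_process_def)
  have "AE \<omega> in M. Z 0 \<omega> = 0 \<and> no_negative_jumps (\<lambda>t. Z t \<omega>) \<and> filterlim (\<lambda>t. Z t \<omega>) at_top at_top"
    using sp drift by (simp add: spectrally_positive_levy_def levy_process_def drifts_to_infinity_def)
  then obtain E where E: "{\<omega> \<in> space M. \<not> (Z 0 \<omega> = 0 \<and> no_negative_jumps (\<lambda>t. Z t \<omega>) \<and> filterlim (\<lambda>t. Z t \<omega>) at_top at_top)} \<subseteq> E"
    "emeasure M E = 0" "E \<in> sets M" by (rule AE_E)
  define Z' where "Z' t \<omega> = (if \<omega> \<in> E then t else Z t \<omega>)" for t \<omega>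
  have "AE \<omega> in M. \<omega> \<notin> E" using E by (intro AE_not_in) auto
  then have AE: "AE \<omega> in M. \<forall>t. Z' t \<omega> = Z t \<omega>" by eventually_elim (simp add: Z'_def)
  have Z'm: "Z' t \<in> borel_measurable M" if "0 \<le> t" for t
    unfolding Z'_def[abs_def] using Zm[OF that] E(3) by (intro measurable_If_set) auto
  have good: "good_path (\<lambda>t. Z' t \<omega>)" if w: "\<omega> \<in> space M" for \<omega>
  proof (cases "\<omega> \<in> E")
    case True then show ?thesis using good_path_identity by (simp add: Z'_def)
  next
    case False
    then have "Z 0 \<omega> = 0" "no_negative_jumps (\<lambda>t. Z t \<omega>)" using E(1) w by auto
    moreover have "cadlag (\<lambda>t. Z t \<omega>)" using cp w by (simp add: cadlag_process_def)
    ultimately show ?thesis using False by (simp add: Z'_def good_path_def)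
  qed
  have "spectrally_positive_up M Z'"
  proof
    fix t :: real assume "0 \<le> t" then show "Z' t \<in> borel_measurable M" by (rule Z'm)
  next
    fix \<omega> assume w: "\<omega> \<in> space M"
    show "good_path (\<lambda>t. Z' t \<omega>)" by (rule good[OF w])
    show "filterlim (\<lambda>t. Z' t \<omega>) at_top at_top"
    proof (cases "\<omega> \<in> E")
      case True then show ?thesis by (simp add: Z'_def filterlim_ident)
    next
      case False then show ?thesis using E(1) w by (auto simp: Z'_def)
    qed
  next
    fix u :: "nat \<Rightarrow> real" and n :: nat assume u: "0 \<le> u 0" "mono_on {..n} u"
    have u0: "0 \<le> u i" if "i \<le> n" for i
      using u that by (auto simp: mono_on_def intro: order_trans[of 0 "u 0" "u i"])
    have "indep_vars (\<lambda>_. borel) (\<lambda>i \<omega>. Z (u (Suc i)) \<omega> - Z (u i) \<omega>) {..<n}"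
      using levy u unfolding levy_process_def by blast
    then show "indep_vars (\<lambda>_. borel) (\<lambda>i \<omega>. Z' (u (Suc i)) \<omega> - Z' (u i) \<omega>) {..<n}"
    proof (rule indep_vars_cong_AE[OF finite_lessThan])
      fix i assume "i \<in> {..<n}"
      then show "(\<lambda>\<omega>. Z' (u (Suc i)) \<omega> - Z' (u i) \<omega>) \<in> borel_measurable M"
        using u0[of i] u0[of "Suc i"] by (intro borel_measurable_diff Z'm) auto
      show "AE \<omega> in M. Z (u (Suc i)) \<omega> - Z (u i) \<omega> = Z' (u (Suc i)) \<omega> - Z' (u i) \<omega>"
        using AE by eventually_elim simp
    qed
  next
    fix s h :: real assume sh: "0 \<le> s" "0 \<le> h"
    have sh': "0 \<le> s + h" using sh by simp
    have "distr M borel (\<lambda>\<omega>. Z' (s + h) \<omega> - Z' s \<omega>) = distr M borel (\<lambda>\<omega>. Z (s + h) \<omega> - Z s \<omega>)"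
    proof (rule distr_cong_AE)
      show "AE \<omega> in M. Z' (s + h) \<omega> - Z' s \<omega> = Z (s + h) \<omega> - Z s \<omega>" using AE by eventually_elim simp
    qed (use Z'm[OF sh(1)] Z'm[OF sh'] Zm[OF sh(1)] Zm[OF sh'] in simp_all)
    also have "\<dots> = distr M borel (Z h)" using levy sh unfolding levy_process_def by blast
    also have "\<dots> = distr M borel (Z' h)"
    proof (rule distr_cong_AE)
      show "AE \<omega> in M. Z h \<omega> = Z' h \<omega>" using AE by eventually_elim simp
    qed (use Z'm[OF sh(2)] Zm[OF sh(2)] in simp_all)
    finally show "distr M borel (\<lambda>\<omega>. Z' (s + h) \<omega> - Z' s \<omega>) = distr M borel (Z' h)" .
  next
    have [measurable]: "(\<lambda>\<omega>. \<lambda>t\<in>{0..}. Z' t \<omega>) \<in> measurable M skorokhod_space"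
      by (rule measurable_skorokhodI)
        (use Z'm good in \<open>auto simp: good_path_def intro: restrict_in_space_skorokhod\<close>)
    have ev: "{\<omega> \<in> space M. dies 0 (\<lambda>t\<in>{0..}. Z' t \<omega>)} \<in> events" by measurable
    have eq: "{\<omega> \<in> space M. dies 0 (\<lambda>t\<in>{0..}. Z' t \<omega>)} = {\<omega> \<in> space M. dies 0 (\<lambda>t. Z' t \<omega>)}"
      by (auto simp: dies_def)
    have "prob {\<omega> \<in> space M. dies 0 (\<lambda>t. Z' t \<omega>)} \<noteq> 0"
    proof
      assume "prob {\<omega> \<in> space M. dies 0 (\<lambda>t. Z' t \<omega>)} = 0"
      then have "AE \<omega> in M. \<omega> \<notin> {\<omega> \<in> space M. dies 0 (\<lambda>t. Z' t \<omega>)}"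
        using ev[unfolded eq] by (simp add: prob_eq_0)
      then have "AE \<omega> in M. \<not> dies 0 (\<lambda>t. Z t \<omega>)"
        using AE AE_space by eventually_elim auto
      with AE_hits_below_0[OF levy var] show False by simp
    qed
    then show "prob {\<omega> \<in> space M. dies 0 (\<lambda>t. Z' t \<omega>)} > 0" by (simp add: zero_less_measure_iff)
  qed
  with AE show ?thesis by blast
qed

lemma stays_positive_measurable:
  assumes X: "cadlag_process M X" and x: "0 < x" shows "stays_positive M X x \<in> sets M"
proof -
  note [measurable] = cadlag_process_path_measurable[OF X]
  show ?thesis unfolding stays_positive_eq[OF x] by measurable
qed

text \<open>Carries the weak limit hypothesis over to the modified process: indistinguishable
  processes have the same conditioning event up to a null set and the same paths on it.\<close>

lemma conditioned_positive_law_cong_AE: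
  assumes X: "cadlag_process M X" and Y: "cadlag_process M Y" and eq: "AE \<omega> in M. \<forall>t. Y t \<omega> = X t \<omega>" and x: "0 < x"
  shows "conditioned_positive_law M X x = conditioned_positive_law M Y x"
proof -
  note SX = stays_positive_measurable[OF X x] and SY = stays_positive_measurable[OF Y x]
  have iff: "AE \<omega> in M. \<omega> \<in> stays_positive M X x \<longleftrightarrow> \<omega> \<in> stays_positive M Y x"
    using eq by eventually_elim (simp add: stays_positive_def)
  have "emeasure M (stays_positive M X x) = emeasure M (stays_positive M Y x)"
    using iff SX SY by (intro emeasure_eq_AE) auto
  then have um: "uniform_measure M (stays_positive M X x) = uniform_measure M (stays_positive M Y x)"
    unfolding uniform_measure_def using iff SX SY
    by (intro density_cong) (auto simp: indicator_def)
  have meas: "(\<lambda>\<omega>. \<lambda>t\<in>{0..}. x + U t \<omega>) \<in> measurable (uniform_measure M (stays_positive M Y x)) skorokhod_space"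
    if U: "cadlag_process M U" for U
  proof -
    have "cadlag_process M (\<lambda>t \<omega>. x + U t \<omega>)"
      using U by (auto simp: cadlag_process_def intro: cadlag_add_const)
    from cadlag_process_path_measurable[OF this] show ?thesis by (simp add: measurable_def)
  qed
  show ?thesis
    unfolding conditioned_positive_law_def path_law_def um
  proof (rule distr_cong_AE)
    have "AE \<omega> in M. \<omega> \<in> stays_positive M Y x \<longrightarrow> (\<lambda>t\<in>{0..}. x + X t \<omega>) = (\<lambda>t\<in>{0..}. x + Y t \<omega>)"
      using eq by eventually_elim simp
    then show "AE \<omega> in uniform_measure M (stays_positive M Y x). (\<lambda>t\<in>{0..}. x + X t \<omega>) = (\<lambda>t\<in>{0..}. x + Y t \<omega>)"
      by (rule AE_uniform_measureI[OF SY])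
  qed (use meas[OF X] meas[OF Y] in auto)
qed

theorem theorem1p15:
  fixes M :: "'a measure" and Z :: "real \<Rightarrow> 'a \<Rightarrow> real"
    and N :: "'b measure" and Zup :: "real \<Rightarrow> 'b \<Rightarrow> real"
  assumes "spectrally_positive_levy M Z"
    and "unbounded_variation M Z"
    and "drifts_to_infinity M Z"
    and "conditioned_positive_from_zero M Z N Zup"
  shows "stochastically_greater M (exp_functional Z) N (exp_functional Zup)
    \<and> (\<forall>x::real. x > 0 \<longrightarrow>
        measure M {\<omega> \<in> space M. exp_functional Z \<omega> \<le> ennreal x}
          \<le> measure N {\<omega> \<in> space N. exp_functional Zup \<omega> \<le> ennreal x})
    \<and> (\<forall>\<epsilon>::real. \<epsilon> > 0 \<longrightarrow> (\<exists>C::real. C > 0 \<and> (\<forall>\<^sub>F x in at_right 0.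
        (1 - \<epsilon>) / (kappa_minus M Z * exp 1) * Phi_minus M Z (1 / x)
            * measure M {\<omega> \<in> space M. exp_functional Z \<omega> \<le> ennreal x}
          \<le> measure N {\<omega> \<in> space N. exp_functional Zup \<omega> \<le> ennreal x}
      \<and> measure N {\<omega> \<in> space N. exp_functional Zup \<omega> \<le> ennreal x}
          \<le> C * Phi_minus M Z (1 / x)
              * measure M {\<omega> \<in> space M. exp_functional Z \<omega> \<le> ennreal ((1 + \<epsilon>) * x)})))"
proof -
  obtain Z' where up: "spectrally_positive_up M Z'" and AE: "AE \<omega> in M. \<forall>t. Z' t \<omega> = Z t \<omega>"
    using spectrally_positive_modification[OF assms(1-3)] by blast
  interpret Z: spectrally_positive_up M Z' by (rule up)
  have cp: "cadlag_process M Z" using assms(1) by (simp add: spectrally_positive_levy_def levy_process_def)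
  have cp': "cadlag_process M Z'"
    using Z.prob_space_axioms Z.Z_measurable Z.Z_good by (simp add: cadlag_process_def good_path_def)
  have cpN: "cadlag_process N Zup"
    and lim: "skorokhod_weak_limit (conditioned_positive_law M Z) (path_law N Zup) (at_right 0)"
    using assms(4) by (auto simp: conditioned_positive_from_zero_def)
  interpret N: prob_space N using cpN by (simp add: cadlag_process_def)
  \<comment> \<open>The limit at 0 from the right involves only \<open>x > 0\<close>, where the two
    conditioned laws coincide.\<close>
  have lim': "skorokhod_weak_limit (conditioned_positive_law M Z') (path_law N Zup) (at_right 0)"
    unfolding skorokhod_weak_limit_def
  proof (intro allI impI)
    fix F assume F: "F \<in> borel_measurable skorokhod_space \<and> skorokhod_continuous F \<and> bounded (F ` space skorokhod_space)"
    have "eventually (\<lambda>x. (\<integral>w. F w \<partial>conditioned_positive_law M Z x) = (\<integral>w. F w \<partial>conditioned_positive_law M Z' x)) (at_right 0)"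
      using eventually_at_right_less[of 0]
      by eventually_elim (simp add: conditioned_positive_law_cong_AE[OF cp cp' AE])
    from tendsto_cong[OF this] lim F
    show "((\<lambda>x. \<integral>w. F w \<partial>conditioned_positive_law M Z' x) \<longlongrightarrow> (\<integral>w. F w \<partial>path_law N Zup)) (at_right 0)"
      unfolding skorokhod_weak_limit_def by blast
  qed
  have small: "measure M {\<omega> \<in> space M. exp_functional Z \<omega> \<le> ennreal x} = Z.small x" for x
    unfolding Z.small_def
  proof (rule Z.finite_measure_eq_AE)
    show "AE \<omega> in M. (\<omega> \<in> {\<omega> \<in> space M. exp_functional Z \<omega> \<le> ennreal x}) = (\<omega> \<in> {\<omega> \<in> space M. efun {0..} (Z.path \<omega>) \<le> ennreal x})"
      using AE by eventually_elim (simp add: exp_functional_eq Z.path_def)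
    note [measurable] = cadlag_process_path_measurable[OF cp]
    show "{\<omega> \<in> space M. exp_functional Z \<omega> \<le> ennreal x} \<in> sets M" unfolding exp_functional_eq by measurable
  qed measurable
  have Phi: "Phi_minus M Z q = Z.phi q" if "0 \<le> q" for q
  proof -
    have "passage_exponent M (\<lambda>t \<omega>. - Z t \<omega>) q = passage_exponent M (\<lambda>t \<omega>. - Z' t \<omega>) q"
    proof -
      have "AE \<omega> in M. hitting_time (\<lambda>t \<omega>. - Z t \<omega>) 1 \<omega> = hitting_time (\<lambda>t \<omega>. - Z' t \<omega>) 1 \<omega>"
        using AE by eventually_elim (simp add: hitting_time_def)
      then have "(\<integral>\<^sup>+\<omega>. (if hitting_time (\<lambda>t \<omega>. - Z t \<omega>) 1 \<omega> = \<infinity> then 0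
          else ennreal (exp (- q * real_of_ereal (hitting_time (\<lambda>t \<omega>. - Z t \<omega>) 1 \<omega>)))) \<partial>M) =
        (\<integral>\<^sup>+\<omega>. (if hitting_time (\<lambda>t \<omega>. - Z' t \<omega>) 1 \<omega> = \<infinity> then 0
          else ennreal (exp (- q * real_of_ereal (hitting_time (\<lambda>t \<omega>. - Z' t \<omega>) 1 \<omega>)))) \<partial>M)"
        by (intro nn_integral_cong_AE) (auto elim!: eventually_mono)
      then show ?thesis unfolding passage_exponent_def by simp
    qed
    then show ?thesis unfolding Phi_minus_def using Z.passage_exponent_eq[OF that] by simp
  qed
  have kappa: "kappa_minus M Z = Z.kap"
  proof -
    have "(\<integral>\<omega>. exp (q * - Z t \<omega>) \<partial>M) = (\<integral>\<omega>. exp (q * - Z' t \<omega>) \<partial>M)" if "0 \<le> t" for q t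
    proof (rule integral_cong_AE)
      show "AE \<omega> in M. exp (q * - Z t \<omega>) = exp (q * - Z' t \<omega>)" using AE by eventually_elim simp
      have [measurable]: "Z t \<in> borel_measurable M" "Z' t \<in> borel_measurable M"
        using cp cp' that by (auto simp: cadlag_process_def)
      show "(\<lambda>\<omega>. exp (q * - Z t \<omega>)) \<in> borel_measurable M" "(\<lambda>\<omega>. exp (q * - Z' t \<omega>)) \<in> borel_measurable M" by measurable
    qed
    then have "laplace_exponent M (\<lambda>t \<omega>. - Z t \<omega>) = laplace_exponent M (\<lambda>t \<omega>. - Z' t \<omega>)"
      unfolding laplace_exponent_def by (intro ext arg_cong[where f = The]) auto
    then show ?thesis unfolding kappa_minus_def using Z.nontrivial_zero_eq by simp
  qed
  have dom: "measure M {\<omega> \<in> space M. exp_functional Z \<omega> \<le> ennreal x} \<le> measure N {\<omega> \<in> space N. exp_functional Zup \<omega> \<le> ennreal x}"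
    if "0 \<le> x" for x
    unfolding small by (rule Z.limit_dominates[OF cpN lim' that])
  have "stochastically_greater M (exp_functional Z) N (exp_functional Zup)"
    unfolding stochastically_greater_def
  proof
    fix x :: ennreal
    show "measure M {\<omega> \<in> space M. exp_functional Z \<omega> \<le> x} \<le> measure N {\<omega> \<in> space N. exp_functional Zup \<omega> \<le> x}"
    proof (cases x)
      case (real r) then show ?thesis using dom by simp
    next
      \<comment> \<open>At infinity the right side is 1.\<close>
      case top then show ?thesis using Z.prob_le_1 by (simp add: N.prob_space)
    qed
  qed
  moreover have "\<exists>C::real. C > 0 \<and> (\<forall>\<^sub>F x in at_right 0.
        (1 - \<epsilon>) / (kappa_minus M Z * exp 1) * Phi_minus M Z (1 / x)
            * measure M {\<omega> \<in> space M. exp_functional Z \<omega> \<le> ennreal x}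
          \<le> measure N {\<omega> \<in> space N. exp_functional Zup \<omega> \<le> ennreal x}
      \<and> measure N {\<omega> \<in> space N. exp_functional Zup \<omega> \<le> ennreal x}
          \<le> C * Phi_minus M Z (1 / x)
              * measure M {\<omega> \<in> space M. exp_functional Z \<omega> \<le> ennreal ((1 + \<epsilon>) * x)})" if eps: "0 < \<epsilon>" for \<epsilon> :: real
  proof -
    have lower: "\<forall>\<^sub>F x in at_right 0. (1 - \<epsilon>) / (Z.kap * exp 1) * Z.phi (1 / x) * Z.small x \<le>
        measure N {\<omega> \<in> space N. exp_functional Zup \<omega> \<le> ennreal x}"
    proof (cases "\<epsilon> < 1")
      case True
      from Z.conditioned_lower_bound[OF eps True] eventually_at_right_less[of 0] show ?thesis
      proof eventually_elim
        case (elim x)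
        then obtain \<delta> :: "nat \<Rightarrow> real" where d: "\<And>n. 0 < \<delta> n" "\<delta> \<longlonglongrightarrow> 0"
          and le: "\<And>n. (1 - \<epsilon>) / (Z.kap * exp 1) * Z.phi (1 / x) * Z.small x \<le> Z.small_alive (\<delta> n) x / (1 - exp (- Z.kap * \<delta> n))"
          by blast
        show ?case
        proof (rule Z.limit_ge[OF cpN lim' d less_imp_le[OF elim(2)]])
          fix n
          have "0 \<le> 1 - exp (- Z.kap * \<delta> n)" using Z.kap_pos d(1)[of n] by simp
          \<comment> \<open>The lower estimate holds at \<open>x\<close> itself; the argument
            \<open>exp (\<delta> n) * x\<close> of the conditioned law is larger.\<close>
          moreover have "x \<le> exp (\<delta> n) * x" using elim(2) d(1)[of n] by (simp add: mult_le_cancel_right1)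
          ultimately have "Z.small_alive (\<delta> n) x / (1 - exp (- Z.kap * \<delta> n)) \<le>
              Z.small_alive (\<delta> n) (exp (\<delta> n) * x) / (1 - exp (- Z.kap * \<delta> n))"
            by (intro divide_right_mono Z.small_alive_mono)
          with le[of n] show "(1 - \<epsilon>) / (Z.kap * exp 1) * Z.phi (1 / x) * Z.small x \<le>
              Z.small_alive (\<delta> n) (exp (\<delta> n) * x) / (1 - exp (- Z.kap * \<delta> n))" by linarith
        qed
      qed
    next
      \<comment> \<open>For \<open>\<epsilon> \<ge> 1\<close> the left side is nonpositive.\<close>
      case False
      from eventually_at_right_less[of 0] show ?thesis
      proof eventually_elim
        case (elim x)
        have "(1 - \<epsilon>) / (Z.kap * exp 1) \<le> 0" using False Z.kap_pos by (intro divide_nonpos_pos) auto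
        moreover have "0 \<le> Z.phi (1 / x) * Z.small x"
          using elim by (intro mult_nonneg_nonneg Z.phi_nonneg Z.small_nonneg) auto
        ultimately have "(1 - \<epsilon>) / (Z.kap * exp 1) * (Z.phi (1 / x) * Z.small x) \<le> 0" by (rule mult_nonpos_nonneg)
        then show ?case by (simp only: mult.assoc) (rule order_trans, assumption, rule measure_nonneg)
      qed
    qed
    obtain C where C: "0 < C" and ev: "\<forall>\<^sub>F x in at_right 0. \<exists>y>x. \<exists>\<delta>::nat \<Rightarrow> real. (\<forall>n. 0 < \<delta> n) \<and> \<delta> \<longlonglongrightarrow> 0 \<and>
      (\<forall>n. Z.small_alive (\<delta> n) (exp (\<delta> n) * y) / (1 - exp (- Z.kap * \<delta> n)) \<le> C * Z.phi (1 / x) * Z.small ((1 + \<epsilon>) * x))"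
      using Z.conditioned_upper_bound[OF eps] by blast
    from ev eventually_at_right_less[of 0]
    have upper: "\<forall>\<^sub>F x in at_right 0. measure N {\<omega> \<in> space N. exp_functional Zup \<omega> \<le> ennreal x} \<le>
        C * Z.phi (1 / x) * Z.small ((1 + \<epsilon>) * x)"
    proof eventually_elim
      case (elim x)
      then obtain y and \<delta> :: "nat \<Rightarrow> real" where "x < y" "\<And>n. 0 < \<delta> n" "\<delta> \<longlonglongrightarrow> 0"
        "\<And>n. Z.small_alive (\<delta> n) (exp (\<delta> n) * y) / (1 - exp (- Z.kap * \<delta> n)) \<le> C * Z.phi (1 / x) * Z.small ((1 + \<epsilon>) * x)"
        by blast
      with elim(2) show ?case by (intro Z.limit_le[OF cpN lim', of \<delta> x y]) auto
    qed
    show ?thesis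
    proof (intro exI[of _ C] conjI C)
      show "\<forall>\<^sub>F x in at_right 0.
        (1 - \<epsilon>) / (kappa_minus M Z * exp 1) * Phi_minus M Z (1 / x)
            * measure M {\<omega> \<in> space M. exp_functional Z \<omega> \<le> ennreal x}
          \<le> measure N {\<omega> \<in> space N. exp_functional Zup \<omega> \<le> ennreal x}
      \<and> measure N {\<omega> \<in> space N. exp_functional Zup \<omega> \<le> ennreal x}
          \<le> C * Phi_minus M Z (1 / x)
              * measure M {\<omega> \<in> space M. exp_functional Z \<omega> \<le> ennreal ((1 + \<epsilon>) * x)}"
        using lower upper eventually_at_right_less[of 0]
        by eventually_elim (simp only: small kappa Phi zero_le_divide_1_iff less_imp_le simp_thms)
    qed
  qed
  ultimately show ?thesis using dom by auto
qed

end
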